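(* Let $\Omega\subset\mathbb{R}^N$ ($N\ge 1$) be an arbitrary bounded open set, let $0<s<1$, $T>0$ and $Q:=(0,T)\times\Omega$. Let $z\in L^r((0,T);L^p(\Omega))$, where the real numbers $p,r\in[1,\infty)$ satisfy $$1>\frac{N}{2ps}+\frac1r .$$ Then every weak solution $u\in\mathbb{U}_0$ of $$\partial_t u+(-\Delta)^s u=z \ \text{ in } Q,\qquad u=0\ \text{ in }(0,T)\times(\mathbb{R}^N\setminus\Omega),\qquad u(0,\cdot)=0\ \text{ in }\Omega,$$ belongs to $L^\infty(Q)$, and there is a constant $C>0$ (independent of $z$ and $u$) such that $$\|u\|_{L^\infty(Q)}\le C\,\|z\|_{L^r((0,T);L^p(\Omega))}.$$
   Context: $\widetilde W^{s,2}_0(\Omega):=\{u\in W^{s,2}(\mathbb{R}^N): u=0 \text{ in }\mathbb{R}^N\setminus\Omega\}$, where $W^{s,2}(\mathbb{R}^N)$ is the space of $u\in L^2(\mathbb{R}^N)$ with $\int_{\mathbb{R}^N}\int_{\mathbb{R}^N}\frac{|u(x)-u(y)|^2}{|x-y|^{N+2s}}\,dx\,dy<\infty$; it is normed by the square root of this double integral. $\widetilde W^{-s,2}(\Omega)$ is its dual with respect to the pivot space $L^2(\Omega)$. $(-\Delta)^s$ is the integral fractional Laplacian, $(-\Delta)^su(x)=C_{N,s}\,\mathrm{P.V.}\int_{\mathbb{R}^N}\frac{u(x)-u(y)}{|x-y|^{N+2s}}\,dy$, with $C_{N,s}=\frac{s2^{2s}\Gamma(\frac{2s+N}{2})}{\pi^{N/2}\Gamma(1-s)}$.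 $\mathbb{U}_0:=L^2((0,T);\widetilde W^{s,2}_0(\Omega))\cap H^1((0,T);\widetilde W^{-s,2}(\Omega))$. Weak solution (for $z\in L^2((0,T);\widetilde W^{-s,2}(\Omega))$): a function $u\in\mathbb{U}_0$ with $u(0,\cdot)=0$ a.e. in $\Omega$ such that, for every $v\in\widetilde W^{s,2}_0(\Omega)$ and almost every $t\in(0,T)$, $$\langle\partial_tu,v\rangle_{\widetilde W^{-s,2}(\Omega),\widetilde W^{s,2}_0(\Omega)}+\mathcal{E}(u,v)=\langle z,v\rangle_{\widetilde W^{-s,2}(\Omega),\widetilde W^{s,2}_0(\Omega)},$$ where $\mathcal{E}(u,v):=\frac{C_{N,s}}2\int_{\mathbb{R}^N}\int_{\mathbb{R}^N}\frac{(u(x)-u(y))(v(x)-v(y))}{|x-y|^{N+2s}}\,dx\,dy$. A function in $L^p(\Omega)$ acts on $v$ through $v\mapsto\int_\Omega z v\,dx$. *)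

theory Defs
  imports "HOL-Analysis.Analysis" "HOL-Probability.Essential_Supremum"
begin

text \<open>
  Elements of the function spaces below are representatives: \<open>X\<close> is a set of
  representatives and \<open>nrm\<close> a seminorm on it which vanishes exactly on the representatives of
  zero.  The dimension \<open>N\<close> is \<open>DIM('a)\<close>.
\<close>

section \<open>Lebesgue-Bochner spaces\<close>

definition Lp_space :: "'a::euclidean_space set \<Rightarrow> real \<Rightarrow> ('a \<Rightarrow> real) set" where
  "Lp_space \<Omega> p =
     {f \<in> borel_measurable (lebesgue_on \<Omega>). integrable (lebesgue_on \<Omega>) (\<lambda>x. \<bar>f x\<bar> powr p)}"

definition Lp_norm :: "'a::euclidean_space set \<Rightarrow> real \<Rightarrow> ('a \<Rightarrow> real) \<Rightarrow> real" where
  "Lp_norm \<Omega> p f = (LINT x|lebesgue_on \<Omega>. \<bar>f x\<bar> powr p) powr (1 / p)"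

definition Linfty_space :: "'a::euclidean_space set \<Rightarrow> ('a \<Rightarrow> real) set" where
  "Linfty_space Q =
     {f \<in> borel_measurable (lebesgue_on Q). esssup (lebesgue_on Q) (\<lambda>x. ennreal \<bar>f x\<bar>) < \<infinity>}"

definition Linfty_norm :: "'a::euclidean_space set \<Rightarrow> ('a \<Rightarrow> real) \<Rightarrow> real" where
  "Linfty_norm Q f = enn2real (esssup (lebesgue_on Q) (\<lambda>x. ennreal \<bar>f x\<bar>))"

definition strongly_measurable ::
  "real \<Rightarrow> ('b \<Rightarrow> real) set \<Rightarrow> (('b \<Rightarrow> real) \<Rightarrow> real) \<Rightarrow> (real \<Rightarrow> 'b \<Rightarrow> real) \<Rightarrow> bool" where
  "strongly_measurable T X nrm u \<longleftrightarrow>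
     (\<exists>f :: nat \<Rightarrow> real \<Rightarrow> 'b \<Rightarrow> real.
        (\<forall>n. simple_function (lebesgue_on {0<..<T}) (f n) \<and> (\<forall>t\<in>{0<..<T}. f n t \<in> X)) \<and>
        (AE t in lebesgue_on {0<..<T}.
           u t \<in> X \<and> (\<lambda>n. nrm (\<lambda>x. f n t x - u t x)) \<longlonglongrightarrow> 0))"

definition Bochner_space ::
  "real \<Rightarrow> real \<Rightarrow> ('b \<Rightarrow> real) set \<Rightarrow> (('b \<Rightarrow> real) \<Rightarrow> real) \<Rightarrow> (real \<Rightarrow> 'b \<Rightarrow> real) set" where
  "Bochner_space T r X nrm =
     {u. strongly_measurable T X nrm u \<and>
         integrable (lebesgue_on {0<..<T}) (\<lambda>t. nrm (u t) powr r)}"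

definition Bochner_norm ::
  "real \<Rightarrow> real \<Rightarrow> (('b \<Rightarrow> real) \<Rightarrow> real) \<Rightarrow> (real \<Rightarrow> 'b \<Rightarrow> real) \<Rightarrow> real" where
  "Bochner_norm T r nrm u = (LINT t|lebesgue_on {0<..<T}. nrm (u t) powr r) powr (1 / r)"

text \<open>
  A Bochner measurable \<open>u\<close> need not be jointly measurable, since each \<open>u t\<close> may be changed on its
  own null set.  The element of a space over \<open>(0,T) \<times> \<Omega>\<close> that \<open>u\<close> is identified with is the
  class of any \<open>U\<close> below.
\<close>

definition joint_representative ::
  "real \<Rightarrow> 'a::euclidean_space set \<Rightarrow> (real \<Rightarrow> 'a \<Rightarrow> real) \<Rightarrow> (real \<times> 'a \<Rightarrow> real) \<Rightarrow> bool" where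
  "joint_representative T \<Omega> u U \<longleftrightarrow>
     U \<in> borel_measurable (lebesgue_on ({0<..<T} \<times> \<Omega>)) \<and>
     (AE t in lebesgue_on {0<..<T}. AE x in lebesgue_on \<Omega>. U (t, x) = u t x)"


section \<open>Fractional Sobolev spaces\<close>

text \<open>The diagonal is harmless: there the quotient is \<open>0 / 0 = 0\<close>.\<close>

definition gagliardo :: "real \<Rightarrow> ('a::euclidean_space \<Rightarrow> real) \<Rightarrow> ennreal" where
  "gagliardo s u =
     (\<integral>\<^sup>+ x. (\<integral>\<^sup>+ y. ennreal (\<bar>u x - u y\<bar>\<^sup>2 / norm (x - y) powr (real DIM('a) + 2 * s))
        \<partial>lebesgue) \<partial>lebesgue)"

definition W_space :: "real \<Rightarrow> ('a::euclidean_space \<Rightarrow> real) set" where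
  "W_space s = {u \<in> Lp_space UNIV 2. gagliardo s u < \<infinity>}"

definition W0_space :: "real \<Rightarrow> 'a::euclidean_space set \<Rightarrow> ('a \<Rightarrow> real) set" where
  "W0_space s \<Omega> = {u \<in> W_space s. AE x in lebesgue. x \<notin> \<Omega> \<longrightarrow> u x = 0}"

definition W0_norm :: "real \<Rightarrow> ('a::euclidean_space \<Rightarrow> real) \<Rightarrow> real" where
  "W0_norm s u = sqrt (enn2real (gagliardo s u))"

definition W_dual :: "real \<Rightarrow> 'a::euclidean_space set \<Rightarrow> (('a \<Rightarrow> real) \<Rightarrow> real) set" where
  "W_dual s \<Omega> =
     {F. (\<forall>v\<in>W0_space s \<Omega>. \<forall>w\<in>W0_space s \<Omega>. F (\<lambda>x. v x + w x) = F v + F w) \<and>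
         (\<forall>c. \<forall>v\<in>W0_space s \<Omega>. F (\<lambda>x. c * v x) = c * F v) \<and>
         (\<exists>K. \<forall>v\<in>W0_space s \<Omega>. \<bar>F v\<bar> \<le> K * W0_norm s v)}"

definition W_dual_norm :: "real \<Rightarrow> 'a::euclidean_space set \<Rightarrow> (('a \<Rightarrow> real) \<Rightarrow> real) \<Rightarrow> real" where
  "W_dual_norm s \<Omega> F = (SUP v\<in>{v \<in> W0_space s \<Omega>. W0_norm s v \<le> 1}. \<bar>F v\<bar>)"

text \<open>
  The functional by which a function on \<open>\<Omega>\<close> acts on \<open>W0_space s \<Omega>\<close>.  With it \<open>L\<^sup>2(\<Omega>)\<close> is the pivot
  space, and right-hand sides in \<open>L\<^sup>p(\<Omega>)\<close> are tested against \<open>v\<close>.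
\<close>

definition functional_of :: "'a::euclidean_space set \<Rightarrow> ('a \<Rightarrow> real) \<Rightarrow> ('a \<Rightarrow> real) \<Rightarrow> real" where
  "functional_of \<Omega> w = (\<lambda>v. LINT x|lebesgue_on \<Omega>. w x * v x)"


section \<open>Weak solutions\<close>

definition test_function :: "real \<Rightarrow> (real \<Rightarrow> real) \<Rightarrow> bool" where
  "test_function T \<phi> \<longleftrightarrow>
     (\<forall>k t. (deriv ^^ k) \<phi> differentiable (at t)) \<and>
     (\<exists>a b. 0 < a \<and> a < b \<and> b < T \<and> (\<forall>t. t \<notin> {a..b} \<longrightarrow> \<phi> t = 0))"

text \<open>
  \<open>g\<close> is the distributional derivative of \<open>F\<close> on \<open>(0,T)\<close>.  The integrals over time have values in
  \<open>W_dual s \<Omega>\<close>; as evaluation at \<open>v\<close> is continuous, it commutes with them.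
\<close>

definition weak_time_derivative ::
  "real \<Rightarrow> 'a::euclidean_space set \<Rightarrow> real \<Rightarrow>
   (real \<Rightarrow> ('a \<Rightarrow> real) \<Rightarrow> real) \<Rightarrow> (real \<Rightarrow> ('a \<Rightarrow> real) \<Rightarrow> real) \<Rightarrow> bool" where
  "weak_time_derivative s \<Omega> T F g \<longleftrightarrow>
     (\<forall>\<phi>. test_function T \<phi> \<longrightarrow>
        (\<forall>v\<in>W0_space s \<Omega>.
           (LINT t|lebesgue_on {0<..<T}. deriv \<phi> t * F t v) =
           - (LINT t|lebesgue_on {0<..<T}. \<phi> t * g t v)))"

definition H1_dual ::
  "real \<Rightarrow> 'a::euclidean_space set \<Rightarrow> real \<Rightarrow> (real \<Rightarrow> ('a \<Rightarrow> real) \<Rightarrow> real) set" where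
  "H1_dual s \<Omega> T =
     {F \<in> Bochner_space T 2 (W_dual s \<Omega>) (W_dual_norm s \<Omega>).
        \<exists>g \<in> Bochner_space T 2 (W_dual s \<Omega>) (W_dual_norm s \<Omega>). weak_time_derivative s \<Omega> T F g}"

definition U0_space :: "real \<Rightarrow> 'a::euclidean_space set \<Rightarrow> real \<Rightarrow> (real \<Rightarrow> 'a \<Rightarrow> real) set" where
  "U0_space s \<Omega> T =
     {u \<in> Bochner_space T 2 (W0_space s \<Omega>) (W0_norm s). (\<lambda>t. functional_of \<Omega> (u t)) \<in> H1_dual s \<Omega> T}"

text \<open>
  The value at time \<open>0\<close> is that of the representative in \<open>C([0,T]; L\<^sup>2(\<Omega>))\<close>, which every element of
  \<open>U0_space s \<Omega> T\<close> has.
\<close>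

definition initial_value ::
  "'a::euclidean_space set \<Rightarrow> real \<Rightarrow> (real \<Rightarrow> 'a \<Rightarrow> real) \<Rightarrow> ('a \<Rightarrow> real) \<Rightarrow> bool" where
  "initial_value \<Omega> T u u0 \<longleftrightarrow>
     (\<exists>U. (\<forall>t\<in>{0..T}. U t \<in> Lp_space \<Omega> 2) \<and>
        (\<forall>t\<in>{0..T}. ((\<lambda>\<tau>. Lp_norm \<Omega> 2 (\<lambda>x. U \<tau> x - U t x)) \<longlongrightarrow> 0) (at t within {0..T})) \<and>
        (AE t in lebesgue_on {0<..<T}. AE x in lebesgue_on \<Omega>. U t x = u t x) \<and>
        (AE x in lebesgue_on \<Omega>. U 0 x = u0 x))"

definition C_Ns :: "nat \<Rightarrow> real \<Rightarrow> real" where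
  "C_Ns N s = s * 2 powr (2 * s) * Gamma ((2 * s + real N) / 2) /
     (pi powr (real N / 2) * Gamma (1 - s))"

definition energy_form ::
  "real \<Rightarrow> ('a::euclidean_space \<Rightarrow> real) \<Rightarrow> ('a \<Rightarrow> real) \<Rightarrow> real" where
  "energy_form s u v = C_Ns DIM('a) s / 2 *
     (LINT x|lebesgue. LINT y|lebesgue.
        (u x - u y) * (v x - v y) / norm (x - y) powr (real DIM('a) + 2 * s))"

text \<open>
  Weak solutions of \<open>\<partial>\<^sub>t u + (-\<Delta>)\<^sup>s u = F\<close> with zero exterior and initial data, for a functional-valued
  right-hand side \<open>F\<close>.  The derivative \<open>g\<close> of \<open>u\<close> is unique up to null sets of times.
\<close>

definition weak_solution ::
  "real \<Rightarrow> 'a::euclidean_space set \<Rightarrow> real \<Rightarrow>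
   (real \<Rightarrow> ('a \<Rightarrow> real) \<Rightarrow> real) \<Rightarrow> (real \<Rightarrow> 'a \<Rightarrow> real) \<Rightarrow> bool" where
  "weak_solution s \<Omega> T F u \<longleftrightarrow>
     u \<in> U0_space s \<Omega> T \<and>
     initial_value \<Omega> T u (\<lambda>x. 0) \<and>
     (\<exists>g \<in> Bochner_space T 2 (W_dual s \<Omega>) (W_dual_norm s \<Omega>).
        weak_time_derivative s \<Omega> T (\<lambda>t. functional_of \<Omega> (u t)) g \<and>
        (\<forall>v\<in>W0_space s \<Omega>. AE t in lebesgue_on {0<..<T}.
           g t v + energy_form s (u t) v = F t v))"

end

theory Submission
  imports Defs "HOL-Computational_Algebra.Polynomial"
begin

text \<open>
  The estimate is proved by De Giorgi's method with truncations that are bounded, in the space \<open>L\<^sup>1\<close>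
  instead of \<open>L\<^sup>2\<close>. Fix levels \<open>0 \<le> k < h\<close>, let \<open>\<psi>\<close> rise linearly from 0 at \<open>k\<close> to 1 at \<open>h\<close>, let \<open>\<Psi>\<close> be
  its primitive that vanishes at \<open>k\<close>, and let \<open>Y t\<close> be the integral of \<open>\<Psi> (u t)\<close> over \<open>\<Omega>\<close>. Suppose that
  every set \<open>{k < u t}\<close> has measure at most \<open>a\<close>. Testing the equation with \<open>\<psi> (u t)\<close> gives, in a weak
  sense, the differential inequality

  \<open>Y' \<le> 2 * a powr (1 - 1 / p) * m - \<mu> * Y\<close>,  where \<open>m t\<close> is the \<open>L\<^sup>p\<close> norm of \<open>z t\<close> and
  \<open>\<mu>\<close> is a constant times \<open>a powr (- 2 * s / N)\<close>.

  The source term is a Hoelder bound on the support of \<open>\<psi> (u t)\<close>. The damping comes from the nonlocal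
  energy alone: from a point \<open>x\<close> in \<open>{k < u t}\<close> the fractional kernel integrates to at least a multiple of
  \<open>a powr (- 2 * s / N)\<close> over the complement of that set, since the set cannot fill a ball of
  volume \<open>2 * a\<close> (\<open>energy_form_truncation_lower_bound\<close>).

  As \<open>Y\<close> starts from 0, damping and the \<open>L\<^sup>r\<close> bound for \<open>m\<close> yield
  \<open>Y \<le> C * R * a powr (1 - 1 / p) * \<mu> powr (1 / r - 1)\<close> with \<open>R\<close> the norm of the source
  (\<open>damped_integral_inequality_Lr\<close>). Since \<open>\<Psi>\<close> is at least \<open>(h - k) / 2\<close> above \<open>h\<close>, the sets \<open>{h < u t}\<close> have
  measure at most \<open>C * R / (h - k) * a powr (1 + \<kappa>)\<close> with
  \<open>\<kappa> = 2 * s / N * (1 - 1 / r) - 1 / p\<close> (\<open>level_set_decay\<close>). The hypothesis on \<open>p\<close> and \<open>r\<close> says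
  exactly that \<open>\<kappa>\<close> is positive, so iteration over levels that increase to a multiple of \<open>R\<close> forces the
  measures to 0 (\<open>essential_upper_bound\<close>). The lower bound follows for \<open>- u\<close>.

  The differential inequality needs care, because \<open>u\<close> is differentiable in time only with values in the
  dual space. For a fixed test function \<open>v\<close> the pairing of the continuous representative with \<open>v\<close> is the
  integral of its weak derivative (\<open>increment_of_weak_derivative\<close>). With \<open>v = \<psi> (u t)\<close> frozen at the later
  of two times, convexity of \<open>\<Psi>\<close> bounds \<open>Y t - Y (t - h)\<close> from above (\<open>ramp_testing\<close>), with an error that
  involves \<open>u \<sigma> - u t\<close> for \<open>\<sigma>\<close> between \<open>t - h\<close> and \<open>t\<close>. This error disappears in the limit by continuity of
  translations in \<open>L\<^sup>2((0,T); W)\<close> (\<open>Bochner_space_modulus\<close>, \<open>integrate_left_difference_quotients\<close>).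
\<close>

section \<open>Energies as integrals over pairs of points\<close>

lemma abs_powr_2: "\<bar>x::real\<bar> powr 2 = x\<^sup>2"
  by (cases "x = 0") (auto simp: powr_numeral)

lemma Lp_space_2_iff:
  "f \<in> Lp_space S 2 \<longleftrightarrow> f \<in> borel_measurable (lebesgue_on S) \<and> integrable (lebesgue_on S) (\<lambda>x. (f x)\<^sup>2)"
  by (simp add: Lp_space_def abs_powr_2)

lemma Lp_norm_2: "Lp_norm S 2 f = sqrt (LINT x|lebesgue_on S. (f x)\<^sup>2)"
  by (simp add: Lp_norm_def abs_powr_2 powr_half_sqrt)

text \<open>
  The Gagliardo integral and the energy are iterated integrals over \<open>lebesgue\<close>; with sigma-finiteness
  both become integrals over one product measure, where linearity and monotonicity are available.
\<close>
lemma sigma_finite_lebesgue: "sigma_finite_measure (lebesgue :: 'a::euclidean_space measure)"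
proof -
  obtain A :: "'a set set" where A: "countable A" "A \<subseteq> sets lborel" "\<Union>A = UNIV" "\<forall>a\<in>A. emeasure lborel a \<noteq> \<infinity>"
    using lborel.sigma_finite_countable by (auto simp: space_lborel)
  show ?thesis
    by (rule sigma_finite_measure.intro) (rule exI[of _ A], use A in auto)
qed

interpretation lebesgue: sigma_finite_measure "lebesgue :: 'a::euclidean_space measure"
  by (rule sigma_finite_lebesgue)

interpretation lebesgue_pair: pair_sigma_finite
  "lebesgue :: 'a::euclidean_space measure" "lebesgue :: 'a measure"
  by (intro pair_sigma_finite.intro sigma_finite_lebesgue)

abbreviation lebesgue2 :: "('a::euclidean_space \<times> 'a) measure" where
  "lebesgue2 \<equiv> lebesgue \<Otimes>\<^sub>M lebesgue"

definition gag_kernel :: "real \<Rightarrow> 'a::euclidean_space \<times> 'a \<Rightarrow> real" where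
  "gag_kernel s = (\<lambda>(x, y). 1 / norm (x - y) powr (real DIM('a) + 2 * s))"

lemma gag_kernel_nonneg [simp]: "0 \<le> gag_kernel s p"
  by (simp add: gag_kernel_def split: prod.split)

lemma borel_measurable_id_lebesgue: "(\<lambda>x. x) \<in> borel_measurable (lebesgue :: 'a::euclidean_space measure)"
  by (rule measurable_completion) simp

lemma gag_kernel_measurable [measurable]:
  "gag_kernel s \<in> borel_measurable (lebesgue2 :: ('a::euclidean_space \<times> 'a) measure)"
proof -
  have [measurable]: "fst \<in> borel_measurable (lebesgue2 :: ('a \<times> 'a) measure)"
    using measurable_compose[OF measurable_fst[of lebesgue lebesgue] borel_measurable_id_lebesgue] .
  have [measurable]: "snd \<in> borel_measurable (lebesgue2 :: ('a \<times> 'a) measure)"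
    using measurable_compose[OF measurable_snd[of lebesgue lebesgue] borel_measurable_id_lebesgue] .
  show ?thesis
    unfolding gag_kernel_def split_beta by measurable
qed

definition increment :: "('a \<Rightarrow> real) \<Rightarrow> 'a \<times> 'a \<Rightarrow> real" where
  "increment u = (\<lambda>(x, y). u x - u y)"

lemma increment_measurable [measurable]:
  assumes [measurable]: "u \<in> borel_measurable lebesgue"
  shows "increment u \<in> borel_measurable (lebesgue2 :: ('a::euclidean_space \<times> 'a) measure)"
  unfolding increment_def split_beta by measurable

lemma gagliardo_eq:
  fixes u :: "'a::euclidean_space \<Rightarrow> real"
  assumes [measurable]: "u \<in> borel_measurable lebesgue"
  shows "gagliardo s u = (\<integral>\<^sup>+p. ennreal ((increment u p)\<^sup>2 * gag_kernel s p) \<partial>lebesgue2)"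
proof -
  have "gagliardo s u = (\<integral>\<^sup>+x. \<integral>\<^sup>+y. ennreal ((increment u (x,y))\<^sup>2 * gag_kernel s (x,y)) \<partial>lebesgue \<partial>lebesgue)"
    by (simp add: gagliardo_def increment_def gag_kernel_def)
  also have "\<dots> = (\<integral>\<^sup>+p. ennreal ((increment u p)\<^sup>2 * gag_kernel s p) \<partial>lebesgue2)"
    by (rule lebesgue.nn_integral_fst) measurable
  finally show ?thesis .
qed

lemma W_space_iff:
  fixes u :: "'a::euclidean_space \<Rightarrow> real"
  shows "u \<in> W_space s \<longleftrightarrow> u \<in> borel_measurable lebesgue \<and> integrable lebesgue (\<lambda>x. (u x)\<^sup>2) \<and>
     integrable lebesgue2 (\<lambda>p. (increment u p)\<^sup>2 * gag_kernel s p)"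
proof (cases "u \<in> borel_measurable lebesgue")
  case True
  then have [measurable]: "u \<in> borel_measurable lebesgue" .
  have "gagliardo s u < \<infinity> \<longleftrightarrow> integrable lebesgue2 (\<lambda>p. (increment u p)\<^sup>2 * gag_kernel s p)"
    unfolding gagliardo_eq[OF True]
    by (subst integrable_iff_bounded) (simp add: abs_mult)
  then show ?thesis
    by (auto simp: W_space_def Lp_space_2_iff lebesgue_on_UNIV_eq)
qed (auto simp: W_space_def Lp_space_2_iff lebesgue_on_UNIV_eq)

lemma W0_norm_square:
  fixes u :: "'a::euclidean_space \<Rightarrow> real"
  assumes "u \<in> W_space s"
  shows "(W0_norm s u)\<^sup>2 = (LINT p|lebesgue2. (increment u p)\<^sup>2 * gag_kernel s p)"
proof -
  have u: "u \<in> borel_measurable lebesgue" "integrable lebesgue2 (\<lambda>p. (increment u p)\<^sup>2 * gag_kernel s p)"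
    using assms by (auto simp: W_space_iff)
  show ?thesis
    unfolding W0_norm_def gagliardo_eq[OF u(1)]
    by (subst nn_integral_eq_integral[OF u(2)]) (auto intro!: integral_nonneg_AE)
qed

lemma W0_norm_nonneg [simp]: "0 \<le> W0_norm s u"
  by (simp add: W0_norm_def)

lemma increment_mult_integrable:
  fixes u v :: "'a::euclidean_space \<Rightarrow> real"
  assumes "u \<in> W_space s" "v \<in> W_space s"
  shows "integrable lebesgue2 (\<lambda>p. increment u p * increment v p * gag_kernel s p)"
proof (rule Bochner_Integration.integrable_bound)
  show "integrable lebesgue2 (\<lambda>p. (increment u p)\<^sup>2 * gag_kernel s p + (increment v p)\<^sup>2 * gag_kernel s p)"
    using assms by (auto simp: W_space_iff)
  have [measurable]: "u \<in> borel_measurable lebesgue" "v \<in> borel_measurable lebesgue"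
    using assms by (auto simp: W_space_iff)
  show "(\<lambda>p. increment u p * increment v p * gag_kernel s p) \<in> borel_measurable lebesgue2"
    by measurable
  have *: "\<bar>a * b\<bar> \<le> a\<^sup>2 + b\<^sup>2" for a b :: real
    using sum_squares_bound[of "\<bar>a\<bar>" "\<bar>b\<bar>"] abs_ge_zero[of "a * b"] unfolding abs_mult power2_abs by linarith
  have "\<bar>a * b * k\<bar> \<le> a\<^sup>2 * k + b\<^sup>2 * k" if "0 \<le> k" for a b k :: real
    using mult_right_mono[OF *[of a b] that] that by (simp add: abs_mult algebra_simps)
  then show "AE p in lebesgue2. norm (increment u p * increment v p * gag_kernel s p)
      \<le> norm ((increment u p)\<^sup>2 * gag_kernel s p + (increment v p)\<^sup>2 * gag_kernel s p)"
    by (intro AE_I2) (auto intro!: order_trans[OF _ abs_ge_self])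
qed

lemma energy_form_eq:
  fixes u v :: "'a::euclidean_space \<Rightarrow> real"
  assumes "u \<in> W_space s" "v \<in> W_space s"
  shows "energy_form s u v = C_Ns DIM('a) s / 2 *
     (LINT p|lebesgue2. increment u p * increment v p * gag_kernel s p)"
proof -
  have "(LINT x|lebesgue. LINT y|lebesgue.
          (u x - u y) * (v x - v y) / norm (x - y) powr (real DIM('a) + 2 * s)) =
        (LINT x|lebesgue. LINT y|lebesgue. (\<lambda>p. increment u p * increment v p * gag_kernel s p) (x, y))"
    by (simp add: increment_def gag_kernel_def)
  also have "\<dots> = (LINT p|lebesgue2. increment u p * increment v p * gag_kernel s p)"
    by (rule lebesgue_pair.integral_fst') (rule increment_mult_integrable[OF assms])
  finally show ?thesis by (simp add: energy_form_def)
qed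

lemma C_Ns_pos: "0 < s \<Longrightarrow> s < 1 \<Longrightarrow> 0 < C_Ns N s"
  unfolding C_Ns_def by (intro divide_pos_pos mult_pos_pos Gamma_real_pos) auto

lemma W_space_diff:
  fixes u v :: "'a::euclidean_space \<Rightarrow> real"
  assumes "u \<in> W_space s" "v \<in> W_space s"
  shows "(\<lambda>x. u x - v x) \<in> W_space s"
    and "(W0_norm s (\<lambda>x. u x - v x))\<^sup>2 \<le> 2 * (W0_norm s u)\<^sup>2 + 2 * (W0_norm s v)\<^sup>2"
proof -
  have [measurable]: "u \<in> borel_measurable lebesgue" "v \<in> borel_measurable lebesgue"
    and sq: "integrable lebesgue (\<lambda>x. (u x)\<^sup>2)" "integrable lebesgue (\<lambda>x. (v x)\<^sup>2)"
    and int: "integrable lebesgue2 (\<lambda>p. (increment u p)\<^sup>2 * gag_kernel s p)"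
             "integrable lebesgue2 (\<lambda>p. (increment v p)\<^sup>2 * gag_kernel s p)"
    using assms by (auto simp: W_space_iff)
  have *: "(a - b)\<^sup>2 \<le> 2 * a\<^sup>2 + 2 * b\<^sup>2" for a b :: real
    using zero_le_power2[of "a + b"] by (simp add: power2_eq_square algebra_simps)
  have incr: "increment (\<lambda>x. u x - v x) p = increment u p - increment v p" for p
    by (simp add: increment_def split: prod.split)
  have le: "(increment (\<lambda>x. u x - v x) p)\<^sup>2 * gag_kernel s p
      \<le> 2 * ((increment u p)\<^sup>2 * gag_kernel s p) + 2 * ((increment v p)\<^sup>2 * gag_kernel s p)" for p
    using mult_right_mono[OF *[of "increment u p" "increment v p"] gag_kernel_nonneg[of s p]]
    by (simp add: incr algebra_simps)
  have "integrable lebesgue (\<lambda>x. (u x - v x)\<^sup>2)"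
    by (rule Bochner_Integration.integrable_bound[of _ "\<lambda>x. 2 * (u x)\<^sup>2 + 2 * (v x)\<^sup>2"])
       (use sq * in \<open>auto intro!: order_trans[OF * abs_ge_self]\<close>)
  moreover have i: "integrable lebesgue2 (\<lambda>p. (increment (\<lambda>x. u x - v x) p)\<^sup>2 * gag_kernel s p)"
    by (rule Bochner_Integration.integrable_bound[of _ "\<lambda>p. 2 * ((increment u p)\<^sup>2 * gag_kernel s p) + 2 * ((increment v p)\<^sup>2 * gag_kernel s p)"])
       (use int le in \<open>auto simp: abs_mult intro!: order_trans[OF le abs_ge_self]\<close>)
  ultimately show W: "(\<lambda>x. u x - v x) \<in> W_space s"
    by (simp add: W_space_iff)
  have "(LINT p|lebesgue2. (increment (\<lambda>x. u x - v x) p)\<^sup>2 * gag_kernel s p)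
      \<le> (LINT p|lebesgue2. 2 * ((increment u p)\<^sup>2 * gag_kernel s p) + 2 * ((increment v p)\<^sup>2 * gag_kernel s p))"
    using int i le by (intro integral_mono) auto
  then show "(W0_norm s (\<lambda>x. u x - v x))\<^sup>2 \<le> 2 * (W0_norm s u)\<^sup>2 + 2 * (W0_norm s v)\<^sup>2"
    using int by (simp add: W0_norm_square[OF W] W0_norm_square[OF assms(1)] W0_norm_square[OF assms(2)])
qed

lemma W_space_lipschitz:
  fixes u :: "'a::euclidean_space \<Rightarrow> real" and \<psi> :: "real \<Rightarrow> real"
  assumes "u \<in> W_space s" and lip: "\<And>a b. \<bar>\<psi> a - \<psi> b\<bar> \<le> L * \<bar>a - b\<bar>" and "\<psi> 0 = 0"
  shows "(\<lambda>x. \<psi> (u x)) \<in> W_space s"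
    and "(W0_norm s (\<lambda>x. \<psi> (u x)))\<^sup>2 \<le> L\<^sup>2 * (W0_norm s u)\<^sup>2"
proof -
  have [measurable]: "u \<in> borel_measurable lebesgue"
    and sq: "integrable lebesgue (\<lambda>x. (u x)\<^sup>2)"
    and int: "integrable lebesgue2 (\<lambda>p. (increment u p)\<^sup>2 * gag_kernel s p)"
    using assms by (auto simp: W_space_iff)
  have "0 \<le> L" using lip[of 0 1] by auto
  have "L-lipschitz_on UNIV \<psi>"
    by (rule lipschitz_onI) (use lip \<open>0 \<le> L\<close> in \<open>auto simp: dist_real_def\<close>)
  then have "continuous_on UNIV \<psi>"
    by (rule lipschitz_on_continuous_on)
  then have [measurable]: "\<psi> \<in> borel_measurable borel"
    by (rule borel_measurable_continuous_onI)
  have *: "(\<psi> a - \<psi> b)\<^sup>2 \<le> L\<^sup>2 * (a - b)\<^sup>2" for a b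
    using power_mono[OF lip[of a b], of 2] by (simp add: power_mult_distrib)
  have le: "(increment (\<lambda>x. \<psi> (u x)) p)\<^sup>2 * gag_kernel s p \<le> L\<^sup>2 * ((increment u p)\<^sup>2 * gag_kernel s p)" for p
    using mult_right_mono[OF *, of "gag_kernel s p" "u (fst p)" "u (snd p)"]
    by (simp add: increment_def split_beta)
  have "integrable lebesgue (\<lambda>x. (\<psi> (u x))\<^sup>2)"
    by (rule Bochner_Integration.integrable_bound[of _ "\<lambda>x. L\<^sup>2 * (u x)\<^sup>2"])
       (use sq *[of _ 0] \<open>\<psi> 0 = 0\<close> in auto)
  moreover have i: "integrable lebesgue2 (\<lambda>p. (increment (\<lambda>x. \<psi> (u x)) p)\<^sup>2 * gag_kernel s p)"
    by (rule Bochner_Integration.integrable_bound[of _ "\<lambda>p. L\<^sup>2 * ((increment u p)\<^sup>2 * gag_kernel s p)"])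
       (use int le in auto)
  ultimately show W: "(\<lambda>x. \<psi> (u x)) \<in> W_space s"
    by (simp add: W_space_iff)
  have "(LINT p|lebesgue2. (increment (\<lambda>x. \<psi> (u x)) p)\<^sup>2 * gag_kernel s p)
      \<le> (LINT p|lebesgue2. L\<^sup>2 * ((increment u p)\<^sup>2 * gag_kernel s p))"
    using int i le by (intro integral_mono) auto
  then show "(W0_norm s (\<lambda>x. \<psi> (u x)))\<^sup>2 \<le> L\<^sup>2 * (W0_norm s u)\<^sup>2"
    using int by (simp add: W0_norm_square[OF W] W0_norm_square[OF assms(1)])
qed

text \<open>
  Young's inequality for the positive semidefinite form. It is used to replace \<open>u \<sigma>\<close> by \<open>u t\<close> for nearby
  times, when the test function belongs to time \<open>t\<close>.
\<close>
lemma energy_form_diff_bound: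
  fixes u w v :: "'a::euclidean_space \<Rightarrow> real"
  assumes "u \<in> W_space s" "w \<in> W_space s" "v \<in> W_space s" and "0 < s" "s < 1" and "0 < \<delta>"
  shows "energy_form s w v \<le> energy_form s u v +
    C_Ns DIM('a) s * ((W0_norm s (\<lambda>x. u x - w x))\<^sup>2 / \<delta> + \<delta> * (W0_norm s v)\<^sup>2)"
proof -
  let ?d = "\<lambda>x. u x - w x"
  have d: "?d \<in> W_space s" using W_space_diff assms by blast
  have ids: "integrable lebesgue2 (\<lambda>p. (increment ?d p)\<^sup>2 * gag_kernel s p)"
            "integrable lebesgue2 (\<lambda>p. (increment v p)\<^sup>2 * gag_kernel s p)"
    using d assms(3) by (auto simp: W_space_iff)
  note iuv = increment_mult_integrable[OF assms(1,3)] increment_mult_integrable[OF assms(2,3)]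
  have *: "- (a * b) \<le> 2 * (a\<^sup>2 / \<delta> + \<delta> * b\<^sup>2)" for a b :: real
  proof -
    have "0 \<le> (a + \<delta> * b)\<^sup>2 / \<delta>" using \<open>0 < \<delta>\<close> by simp
    also have "\<dots> = a\<^sup>2 / \<delta> + \<delta> * b\<^sup>2 + 2 * (a * b)"
      using \<open>0 < \<delta>\<close> by (simp add: field_simps power2_eq_square)
    finally have "- (a * b) \<le> (a\<^sup>2 / \<delta> + \<delta> * b\<^sup>2) / 2" by simp
    moreover have "0 \<le> a\<^sup>2 / \<delta> + \<delta> * b\<^sup>2" using \<open>0 < \<delta>\<close> by simp
    ultimately show ?thesis by argo
  qed
  have le: "increment w p * increment v p * gag_kernel s p
     \<le> increment u p * increment v p * gag_kernel s p
        + (2 / \<delta> * ((increment ?d p)\<^sup>2 * gag_kernel s p) + 2 * \<delta> * ((increment v p)\<^sup>2 * gag_kernel s p))" for p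
  proof -
    have eq: "increment u p = increment w p + increment ?d p"
      by (simp add: increment_def split: prod.split)
    show ?thesis
      unfolding eq using mult_right_mono[OF *[of "increment ?d p" "increment v p"] gag_kernel_nonneg[of s p]]
      by (simp add: algebra_simps)
  qed
  have "(LINT p|lebesgue2. increment w p * increment v p * gag_kernel s p) \<le>
    (LINT p|lebesgue2. increment u p * increment v p * gag_kernel s p
        + (2 / \<delta> * ((increment ?d p)\<^sup>2 * gag_kernel s p) + 2 * \<delta> * ((increment v p)\<^sup>2 * gag_kernel s p)))"
    using le iuv ids by (intro integral_mono) auto
  also have "\<dots> = (LINT p|lebesgue2. increment u p * increment v p * gag_kernel s p)
      + (2 / \<delta> * (W0_norm s ?d)\<^sup>2 + 2 * \<delta> * (W0_norm s v)\<^sup>2)"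
    unfolding W0_norm_square[OF d] W0_norm_square[OF assms(3)]
    using iuv ids by (subst Bochner_Integration.integral_add | simp)+
  finally have "C_Ns DIM('a) s / 2 * (LINT p|lebesgue2. increment w p * increment v p * gag_kernel s p) \<le>
     C_Ns DIM('a) s / 2 * ((LINT p|lebesgue2. increment u p * increment v p * gag_kernel s p)
      + (2 / \<delta> * (W0_norm s ?d)\<^sup>2 + 2 * \<delta> * (W0_norm s v)\<^sup>2))"
    using C_Ns_pos[OF assms(4,5), of "DIM('a)"] by (intro mult_left_mono) auto
  then show ?thesis
    by (simp add: energy_form_eq assms algebra_simps)
qed

section \<open>Coercivity of the energy on small superlevel sets\<close>

text \<open>
  The constant that results from \<open>kernel_integral_outside\<close> when the ball there has volume \<open>2 * a\<close>.
\<close>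
definition faber_krahn_const :: "nat \<Rightarrow> real \<Rightarrow> real" where
  "faber_krahn_const N s =
     unit_ball_vol (real N) / 2 * (2 / unit_ball_vol (real N)) powr (- (2 * s / real N))"

lemma faber_krahn_const_pos: "0 < faber_krahn_const N s"
proof -
  have V: "0 < unit_ball_vol (real N)" by simp
  have "0 < unit_ball_vol (real N) / 2" "0 < 2 / unit_ball_vol (real N)"
    using V by (rule divide_pos_pos, simp) (rule divide_pos_pos[OF _ V], simp)
  then have "0 < unit_ball_vol (real N) / 2" "2 / unit_ball_vol (real N) \<noteq> 0"
    by linarith+
  then show ?thesis
    unfolding faber_krahn_const_def by (metis mult_pos_pos powr_gt_zero)
qed

text \<open>
  A set of measure at most \<open>a\<close> fills at most half of the ball around \<open>x\<close> of volume \<open>2 * a\<close>. On the other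
  half the kernel is at least \<open>R powr - (N + 2 * s)\<close>, where \<open>R\<close> is the radius of the ball and
  \<open>R powr N\<close> is proportional to \<open>a\<close>.
\<close>
lemma kernel_integral_outside:
  fixes x :: "'a::euclidean_space" and A :: "'a set"
  assumes A: "A \<in> sets lebesgue" "emeasure lebesgue A \<le> ennreal a" and "0 < a" "0 < s"
  shows "ennreal (faber_krahn_const DIM('a) s * a powr (- (2 * s / real DIM('a))))
      \<le> (\<integral>\<^sup>+y. ennreal (gag_kernel s (x, y)) * indicator (- A) y \<partial>lebesgue)"
proof -
  let ?N = "real DIM('a)"
  let ?V = "unit_ball_vol ?N"
  have V: "0 < ?V" by simp
  then have V0: "?V \<noteq> 0" by linarith
  define R where "R = (2 * a / ?V) powr (1 / ?N)"
  have R: "0 < R" using V \<open>0 < a\<close> V0 unfolding R_def powr_gt_zero by (metis divide_eq_0_iff less_irrefl mult_eq_0_iff zero_neq_numeral)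
  have RN: "R powr ?N = 2 * a / ?V"
  proof -
    have "0 < 2 * a / ?V" using V \<open>0 < a\<close> by (intro divide_pos_pos) auto
    then show ?thesis using \<open>0 < a\<close> by (simp add: R_def powr_powr)
  qed
  have ball: "emeasure lebesgue (ball x R) = ennreal (2 * a)"
    using emeasure_ball[of R x] R RN V0 by (simp add: powr_realpow)
  have "ennreal a = ennreal (2 * a) - ennreal a"
    using \<open>0 < a\<close> by (subst ennreal_minus) auto
  also have "\<dots> \<le> emeasure lebesgue (ball x R) - emeasure lebesgue A"
    unfolding ball using A(2) by (intro ennreal_minus_mono) auto
  also have "\<dots> \<le> emeasure lebesgue (ball x R - A)"
  proof -
    have "emeasure lebesgue (ball x R) \<le> emeasure lebesgue ((ball x R - A) \<union> A)"
      using A(1) by (intro emeasure_mono) auto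
    also have "\<dots> \<le> emeasure lebesgue (ball x R - A) + emeasure lebesgue A"
      using A(1) by (intro emeasure_subadditive) auto
    finally have "emeasure lebesgue (ball x R) \<le> emeasure lebesgue (ball x R - A) + emeasure lebesgue A" .
    moreover have "emeasure lebesgue A \<noteq> top"
      using A(2) by (metis ennreal_neq_top top.extremum_unique)
    ultimately show ?thesis
      by (simp add: ennreal_minus_le_iff add.commute)
  qed
  finally have meas: "ennreal a \<le> emeasure lebesgue (ball x R - A - {x})"
    by (metis (no_types, lifting) A(1) Diff_insert0 Diff_insert2 emeasure_Diff_null_set
        lmeasurable_ball fmeasurableD sets.Diff negligible_iff_null_sets negligible_sing)
  have m: "ball x R - A - {x} \<in> sets lebesgue"
    using A(1) by (intro sets.Diff) auto
  have "?V / 2 * (2 / ?V) powr (- (2 * s / ?N)) * a powr (- (2 * s / ?N)) = a * R powr (- (?N + 2 * s))"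
  proof -
    have "R powr (- (?N + 2 * s)) = (2 * a / ?V) powr (- 1 - 2 * s / ?N)"
      by (simp add: R_def powr_powr field_simps)
    also have "\<dots> = (2 * a / ?V) powr (- 1) * (2 * a / ?V) powr (- (2 * s / ?N))"
      by (subst powr_add[symmetric]) simp
    also have "(2 * a / ?V) powr (- 1) = ?V / (2 * a)"
      using V \<open>0 < a\<close> by (simp add: powr_minus_divide)
    also have "(2 * a / ?V) powr (- (2 * s / ?N)) = (2 / ?V) powr (- (2 * s / ?N)) * a powr (- (2 * s / ?N))"
      using V \<open>0 < a\<close> by (simp flip: powr_mult)
    finally show ?thesis using \<open>0 < a\<close> by simp
  qed
  then have "ennreal (?V / 2 * (2 / ?V) powr (- (2 * s / ?N)) * a powr (- (2 * s / ?N)))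
     = ennreal (R powr (- (?N + 2 * s))) * ennreal a"
    using \<open>0 < a\<close> by (simp add: ennreal_mult' mult.commute)
  also have "\<dots> \<le> ennreal (R powr (- (?N + 2 * s))) * emeasure lebesgue (ball x R - A - {x})"
    using meas by (rule mult_left_mono) simp
  also have "\<dots> = (\<integral>\<^sup>+y. ennreal (R powr (- (?N + 2 * s))) * indicator (ball x R - A - {x}) y \<partial>lebesgue)"
    using m by (subst nn_integral_cmult_indicator) auto
  also have "\<dots> \<le> (\<integral>\<^sup>+y. ennreal (gag_kernel s (x, y)) * indicator (- A) y \<partial>lebesgue)"
  proof (rule nn_integral_mono)
    fix y
    have "R powr (- (?N + 2 * s)) \<le> gag_kernel s (x, y)" if "y \<in> ball x R" "y \<noteq> x"
    proof -
      have "0 < norm (x - y)" "norm (x - y) \<le> R" using that by (auto simp: dist_norm)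
      then have "R powr (- (?N + 2 * s)) \<le> norm (x - y) powr (- (?N + 2 * s))"
        using \<open>0 < s\<close> by (intro powr_mono2') auto
      moreover have "gag_kernel s (x, y) = norm (x - y) powr (- (?N + 2 * s))"
        by (simp only: gag_kernel_def prod.case powr_minus_divide)
      ultimately show ?thesis by simp
    qed
    then show "ennreal (R powr (- (?N + 2 * s))) * indicator (ball x R - A - {x}) y
        \<le> ennreal (gag_kernel s (x, y)) * indicator (- A) y"
      by (auto simp: indicator_def intro: ennreal_leI)
  qed
  finally show ?thesis by (simp only: faber_krahn_const_def)
qed

text \<open>
  A nonlocal Faber--Krahn inequality in \<open>L\<^sup>1\<close> form. As \<open>\<psi>\<close> is monotone, the integrand of the energy is
  nonnegative, so the pairs with \<open>k < u x\<close> and \<open>u y \<le> k\<close> alone give a lower bound. For these pairs the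
  product of increments is \<open>(u x - u y) * \<psi> (u x)\<close>, which is at least \<open>(u x - k) * \<psi> (u x)\<close>; integration
  in \<open>y\<close> then uses \<open>kernel_integral_outside\<close>. The lower bound is linear in \<open>\<Psi>\<close>, so that \<open>\<psi>\<close> may be
  bounded; this admits sources in \<open>L\<^sup>p\<close> with \<open>p\<close> below 2.
\<close>
lemma energy_form_truncation_lower_bound:
  fixes u :: "'a::euclidean_space \<Rightarrow> real" and \<psi> \<Psi> :: "real \<Rightarrow> real"
  assumes u: "u \<in> W_space s" and "0 < s" "s < 1"
    and lip: "\<And>a b. \<bar>\<psi> a - \<psi> b\<bar> \<le> L * \<bar>a - b\<bar>" and mono: "mono \<psi>"
    and "0 \<le> k" and \<psi>_zero: "\<And>a. a \<le> k \<Longrightarrow> \<psi> a = 0"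
    and \<Psi>: "\<Psi> \<in> borel_measurable borel" "\<And>a. 0 \<le> \<Psi> a" "\<And>a. a \<le> k \<Longrightarrow> \<Psi> a = 0"
      "\<And>a. k < a \<Longrightarrow> \<Psi> a \<le> (a - k) * \<psi> a"
    and "0 < a" and small: "emeasure lebesgue {x. k < u x} \<le> ennreal a"
  shows "C_Ns DIM('a) s / 2 * faber_krahn_const DIM('a) s * a powr (- (2 * s / real DIM('a))) *
      (LINT x|lebesgue. \<Psi> (u x)) \<le> energy_form s u (\<lambda>x. \<psi> (u x))"
proof -
  let ?v = "\<lambda>x. \<psi> (u x)" and ?A = "{x. k < u x}"
  let ?c = "faber_krahn_const DIM('a) s * a powr (- (2 * s / real DIM('a)))"
  have c: "0 < ?c" using faber_krahn_const_pos[of "DIM('a)" s] \<open>0 < a\<close> by simp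
  have [measurable]: "u \<in> borel_measurable lebesgue" "\<Psi> \<in> borel_measurable borel"
    using u \<Psi>(1) by (auto simp: W_space_iff)
  have A[measurable]: "?A \<in> sets lebesgue"
    using borel_measurable_less[of "\<lambda>x. k" lebesgue u] by simp
  have v: "?v \<in> W_space s"
    using \<psi>_zero[of 0] \<open>0 \<le> k\<close> by (intro W_space_lipschitz(1)[OF u lip]) auto
  then have [measurable]: "?v \<in> borel_measurable lebesgue" by (simp add: W_space_iff)
  let ?f = "\<lambda>p. increment u p * increment ?v p * gag_kernel s p"
  have nonneg: "0 \<le> increment u p * increment ?v p" for p
  proof (cases p)
    case (Pair x y)
    then show ?thesis
      using monoD[OF mono, of "u x" "u y"] monoD[OF mono, of "u y" "u x"]
      by (cases "u x \<le> u y") (auto simp: increment_def zero_le_mult_iff)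
  qed
  have "ennreal ?c * (\<integral>\<^sup>+x. ennreal (\<Psi> (u x)) \<partial>lebesgue) = (\<integral>\<^sup>+x. ennreal ?c * ennreal (\<Psi> (u x)) \<partial>lebesgue)"
    by (rule nn_integral_cmult[symmetric]) measurable
  also have "\<dots> \<le> (\<integral>\<^sup>+x. (\<integral>\<^sup>+y. ennreal (?f (x, y)) \<partial>lebesgue) \<partial>lebesgue)"
  proof (rule nn_integral_mono)
    fix x :: 'a
    show "ennreal ?c * ennreal (\<Psi> (u x)) \<le> (\<integral>\<^sup>+y. ennreal (?f (x, y)) \<partial>lebesgue)"
    proof (cases "k < u x")
      case False
      then show ?thesis using \<Psi>(3)[of "u x"] by simp
    next
      case True
      have "ennreal ?c * ennreal (\<Psi> (u x))
          \<le> (\<integral>\<^sup>+y. ennreal (gag_kernel s (x, y)) * indicator (- ?A) y \<partial>lebesgue) * ennreal (\<Psi> (u x))"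
        by (intro mult_right_mono kernel_integral_outside) (use A small assms in auto)
      also have "\<dots> = (\<integral>\<^sup>+y. ennreal (gag_kernel s (x, y)) * indicator (- ?A) y * ennreal (\<Psi> (u x)) \<partial>lebesgue)"
        by (rule nn_integral_multc[symmetric]) measurable
      also have "\<dots> \<le> (\<integral>\<^sup>+y. ennreal (?f (x, y)) \<partial>lebesgue)"
      proof (rule nn_integral_mono)
        fix y
        have "gag_kernel s (x, y) * \<Psi> (u x) \<le> ?f (x, y)" if "u y \<le> k"
        proof -
          have "\<Psi> (u x) \<le> (u x - k) * \<psi> (u x)" using \<Psi>(4) True by simp
          also have "\<dots> \<le> (u x - u y) * \<psi> (u x)"
            using that monoD[OF mono, of k "u x"] \<psi>_zero[of k] True by (intro mult_right_mono) auto
          also have "\<dots> = increment u (x, y) * increment ?v (x, y)"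
            using \<psi>_zero[OF that] by (simp add: increment_def)
          finally show ?thesis
            by (metis mult.commute mult_right_mono gag_kernel_nonneg)
        qed
        then show "ennreal (gag_kernel s (x, y)) * indicator (- ?A) y * ennreal (\<Psi> (u x)) \<le> ennreal (?f (x, y))"
          by (auto simp: indicator_def ennreal_mult[symmetric] \<Psi>(2) intro: ennreal_leI)
      qed
      finally show ?thesis .
    qed
  qed
  also have "\<dots> = (\<integral>\<^sup>+p. ennreal (?f p) \<partial>lebesgue2)"
    by (rule lebesgue.nn_integral_fst) measurable
  also have "\<dots> = ennreal (LINT p|lebesgue2. ?f p)"
    using nonneg by (intro nn_integral_eq_integral increment_mult_integrable u v) auto
  finally have le: "ennreal ?c * (\<integral>\<^sup>+x. ennreal (\<Psi> (u x)) \<partial>lebesgue) \<le> ennreal (LINT p|lebesgue2. ?f p)" .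
  have "enn2real (ennreal ?c * (\<integral>\<^sup>+x. ennreal (\<Psi> (u x)) \<partial>lebesgue)) \<le> (LINT p|lebesgue2. ?f p)"
    using enn2real_mono[OF le] nonneg by (simp add: integral_nonneg_AE)
  then have "?c * (LINT x|lebesgue. \<Psi> (u x)) \<le> (LINT p|lebesgue2. ?f p)"
    using c by (subst integral_eq_nn_integral) (auto simp: \<Psi>(2) enn2real_mult)
  then have "C_Ns DIM('a) s / 2 * (?c * (LINT x|lebesgue. \<Psi> (u x))) \<le> C_Ns DIM('a) s / 2 * (LINT p|lebesgue2. ?f p)"
    using C_Ns_pos[OF \<open>0 < s\<close> \<open>s < 1\<close>, of "DIM('a)"] by (intro mult_left_mono) auto
  then show ?thesis
    by (simp add: energy_form_eq[OF u v] mult.assoc)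
qed

section \<open>Integrals over time and difference quotients\<close>

lemma time_integrable_sub:
  fixes f :: "real \<Rightarrow> real"
  assumes "integrable (lebesgue_on {0<..<T}) f" "0 \<le> a" "b \<le> T"
  shows "integrable (lebesgue_on {a<..<b}) f"
proof -
  have "set_integrable lebesgue {0<..<T} f"
    using assms(1) by (simp add: set_integrable_def integrable_restrict_space)
  then have "set_integrable lebesgue {a<..<b} f"
    by (rule set_integrable_subset) (use assms in auto)
  then show ?thesis
    by (simp add: set_integrable_def integrable_restrict_space)
qed

lemma lebesgue_Ioo: "{a<..<b::real} \<in> sets lebesgue"
  by simp

lemma continuous_integrable_Ioo:
  fixes f :: "real \<Rightarrow> real"
  assumes "continuous_on {a..b} f"
  shows "integrable (lebesgue_on {a<..<b}) f"
proof -
  have "set_integrable lebesgue {a..b} f"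
    using continuous_imp_integrable_real[OF assms] by (simp add: set_integrable_def integrable_restrict_space)
  then have "set_integrable lebesgue {a<..<b} f"
    by (rule set_integrable_subset) auto
  then show ?thesis
    by (simp add: set_integrable_def integrable_restrict_space)
qed

lemma time_integrable_on:
  fixes f :: "real \<Rightarrow> real"
  assumes "integrable (lebesgue_on {0<..<T}) f" "0 \<le> a" "b \<le> T"
  shows "f integrable_on {a..b}"
  using integrable_on_lebesgue_on[OF time_integrable_sub[OF assms]]
  by (simp add: integrable_on_Icc_iff_Ioo)

lemma time_integral_eq:
  fixes f :: "real \<Rightarrow> real"
  assumes "integrable (lebesgue_on {0<..<T}) f" "0 \<le> a" "b \<le> T"
  shows "integral {a..b} f = integral\<^sup>L (lebesgue_on {a<..<b}) f"
  using lebesgue_integral_eq_integral[OF time_integrable_sub[OF assms]]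
  by (simp add: integral_open_interval_real)

lemma time_integral_diff:
  fixes f :: "real \<Rightarrow> real"
  assumes "f integrable_on {0..b}" "0 \<le> a" "a \<le> b"
  shows "integral {0..b} f - integral {0..a} f = integral {a..b} f"
  using Henstock_Kurzweil_Integration.integral_combine[OF assms(2,3,1)] by simp

lemma time_integral_mono_AE:
  fixes f g :: "real \<Rightarrow> real"
  assumes f: "integrable (lebesgue_on {0<..<T}) f" and g: "integrable (lebesgue_on {0<..<T}) g"
    and ab: "0 \<le> a" "b \<le> T"
    and le: "AE t in lebesgue_on {0<..<T}. a < t \<and> t < b \<longrightarrow> f t \<le> g t"
  shows "integral {a..b} f \<le> integral {a..b} g"
  unfolding time_integral_eq[OF f ab] time_integral_eq[OF g ab]
proof (rule integral_mono_AE[OF time_integrable_sub[OF f ab] time_integrable_sub[OF g ab]])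
  show "AE t in lebesgue_on {a<..<b}. f t \<le> g t"
    using le by (simp add: AE_restrict_space_iff) (elim eventually_mono, use ab in auto)
qed

lemma has_left_difference_quotient:
  fixes W :: "real \<Rightarrow> real"
  assumes "(W has_field_derivative D) (at t)"
  shows "((\<lambda>h. (W t - W (t - h)) / h) \<longlongrightarrow> D) (at_right 0)"
proof -
  have "((\<lambda>h. (W (t + h) - W t) / h) \<longlongrightarrow> D) (at_left 0)"
    by (rule tendsto_within_subset[OF assms[unfolded DERIV_def] subset_UNIV])
  then have "((\<lambda>h. (W (t + - h) - W t) / - h) \<longlongrightarrow> D) (at_right 0)"
    by (subst (asm) filterlim_at_left_to_right) simp
  moreover have "(W (t + - h) - W t) / - h = (W t - W (t - h)) / h" for h
    by (cases "h = 0") (simp_all add: divide_simps)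
  ultimately show ?thesis by simp
qed

text \<open>
  A pointwise almost everywhere bound for a derivative does not control a continuous function (the
  Cantor function); a bound for all difference quotients with small \<open>h\<close>, uniform in \<open>t\<close>, does. After
  subtraction of the integral of \<open>f\<close>, the quotients are integrated over \<open>{a..b}\<close>. The integral of
  \<open>(Z t - Z (t - h)) / h\<close> telescopes to a difference of two boundary averages, and these converge to
  \<open>Z b - Z a\<close> as \<open>h\<close> tends to 0.
\<close>
lemma integrate_left_difference_quotients:
  fixes Y f q :: "real \<Rightarrow> real"
  assumes Y: "continuous_on {0..T} Y"
    and f: "integrable (lebesgue_on {0<..<T}) f" and q: "integrable (lebesgue_on {0<..<T}) q"
    and "0 < h0"
    and ineq: "AE t in lebesgue_on {0<..<T}. \<forall>h. 0 < h \<longrightarrow> h < h0 \<longrightarrow> h < t \<longrightarrow>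
                 Y t - Y (t - h) \<le> integral {t - h..t} f + h * q t"
    and t12: "0 \<le> t1" "t1 \<le> t2" "t2 \<le> T"
  shows "Y t2 - Y t1 \<le> integral {t1..t2} (\<lambda>t. f t + q t)"
proof -
  note fi = time_integrable_on[OF f] and qi = time_integrable_on[OF q]
  define \<Phi> where "\<Phi> = (\<lambda>t. integral {0..t} f)"
  define \<Theta> where "\<Theta> = (\<lambda>t. integral {0..t} q)"
  define Z where "Z = (\<lambda>t. Y t - \<Phi> t)"
  have \<Phi>c: "continuous_on {0..T} \<Phi>" and \<Theta>c: "continuous_on {0..T} \<Theta>"
    unfolding \<Phi>_def \<Theta>_def by (intro indefinite_integral_continuous_1 fi qi; simp)+
  have Zc: "continuous_on {0..T} Z"
    unfolding Z_def by (intro continuous_intros Y \<Phi>c)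
  have \<Phi>_diff: "\<Phi> b - \<Phi> a = integral {a..b} f" and \<Theta>_diff: "\<Theta> b - \<Theta> a = integral {a..b} q"
    if "0 \<le> a" "a \<le> b" "b \<le> T" for a b
    unfolding \<Phi>_def \<Theta>_def using that by (auto intro!: time_integral_diff fi qi)
  have inner: "Z b - Z a \<le> \<Theta> b - \<Theta> a" if ab: "0 < a" "a \<le> b" "b < T" for a b
  proof -
    define W where "W = (\<lambda>t. integral {0..t} Z)"
    have Zi: "Z integrable_on {c..d}" if "0 \<le> c" "d \<le> T" for c d
      by (rule integrable_continuous_interval) (use Zc that in \<open>auto intro: continuous_on_subset\<close>)
    have W_diff: "W d - W c = integral {c..d} Z" if "0 \<le> c" "c \<le> d" "d \<le> T" for c d
      unfolding W_def using that by (intro time_integral_diff Zi) auto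
    have W': "(W has_field_derivative Z t) (at t)" if "0 < t" "t < T" for t
    proof -
      have "(W has_field_derivative Z t) (at t within {0..T})"
        unfolding W_def by (rule integral_has_real_derivative) (use Zc that in auto)
      then show ?thesis using that by (simp add: at_within_Icc_at)
    qed
    \<comment> \<open>Integrating the hypothesis over \<open>{a..b}\<close> gives the bound for the boundary averages of \<open>Z\<close>.\<close>
    have ev: "eventually (\<lambda>h. (W b - W (b - h)) / h - (W a - W (a - h)) / h \<le> \<Theta> b - \<Theta> a) (at_right 0)"
    proof -
      have "(W b - W (b - h)) / h - (W a - W (a - h)) / h \<le> \<Theta> b - \<Theta> a"
        if h: "0 < h" "h < min h0 a" for h
      proof -
        have Zab: "Z integrable_on {a..b}" using Zi ab by simp
        have shift: "integral {a..b} (\<lambda>t. Z (t - h)) = integral {a - h..b - h} Z"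
          using integral_shift_Icc_real[of a b Z "- h"] by (simp add: o_def)
        have Zsh: "(\<lambda>t. Z (t - h)) integrable_on {a..b}"
          by (rule integrable_continuous_interval)
             (use Zc ab h in \<open>auto intro!: continuous_on_compose2[OF Zc] continuous_intros\<close>)
        have Zmeas: "integrable (lebesgue_on {a<..<b}) (\<lambda>t. Z t - Z (t - h))"
          by (rule continuous_integrable_Ioo)
             (use Zc ab h in \<open>auto intro!: continuous_on_compose2[OF Zc] continuous_intros\<close>)
        have "integral {a..b} (\<lambda>t. Z t - Z (t - h)) \<le> integral {a..b} (\<lambda>t. h * q t)"
        proof -
          have "AE t in lebesgue_on {a<..<b}. Z t - Z (t - h) \<le> h * q t"
          proof -
            have "AE t in lebesgue_on {a<..<b}. Y t - Y (t - h) \<le> integral {t - h..t} f + h * q t"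
              using ineq by (simp add: AE_restrict_space_iff) (elim eventually_mono, use ab h in auto)
            moreover have "AE t in lebesgue_on {a<..<b}. a < t \<and> t < b" by (auto simp: AE_restrict_space_iff)
            ultimately show ?thesis
            proof eventually_elim
              case (elim t)
              then show ?case using \<Phi>_diff[of "t - h" t] ab h by (simp add: Z_def)
            qed
          qed
          then have "integral\<^sup>L (lebesgue_on {a<..<b}) (\<lambda>t. Z t - Z (t - h)) \<le> integral\<^sup>L (lebesgue_on {a<..<b}) (\<lambda>t. h * q t)"
            using Zmeas time_integrable_sub[OF q, of a b] ab by (intro integral_mono_AE) auto
          moreover have "integral {a..b} (\<lambda>t. Z t - Z (t - h)) = integral\<^sup>L (lebesgue_on {a<..<b}) (\<lambda>t. Z t - Z (t - h))"
            unfolding lebesgue_integral_eq_integral[OF Zmeas lebesgue_Ioo] by (rule integral_open_interval_real)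
          moreover have "integral {a..b} (\<lambda>t. h * q t) = integral\<^sup>L (lebesgue_on {a<..<b}) (\<lambda>t. h * q t)"
            by (rule time_integral_eq[where T = T]) (use q ab in auto)
          ultimately show ?thesis by (simp only:)
        qed
        also have "\<dots> = h * (\<Theta> b - \<Theta> a)" using \<Theta>_diff[of a b] ab by simp
        finally have "integral {a..b} Z - integral {a - h..b - h} Z \<le> h * (\<Theta> b - \<Theta> a)"
          unfolding Henstock_Kurzweil_Integration.integral_diff[OF Zab Zsh] shift .
        then have "(W b - W a) - (W (b - h) - W (a - h)) \<le> h * (\<Theta> b - \<Theta> a)"
          using W_diff[of a b] W_diff[of "a - h" "b - h"] ab h by linarith
        then have "((W b - W a) - (W (b - h) - W (a - h))) / h \<le> \<Theta> b - \<Theta> a"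
          using h(1) by (simp add: pos_divide_le_eq mult.commute)
        then show ?thesis by (simp add: diff_divide_distrib)
      qed
      moreover have "eventually (\<lambda>h. 0 < h \<and> h < min h0 a) (at_right (0::real))"
        using ab \<open>0 < h0\<close> by (intro eventually_at_rightI[of 0 "min h0 a"]) auto
      ultimately show ?thesis by (auto elim!: eventually_mono)
    qed
    have "((\<lambda>h. (W b - W (b - h)) / h - (W a - W (a - h)) / h) \<longlongrightarrow> Z b - Z a) (at_right 0)"
      using ab by (intro tendsto_diff has_left_difference_quotient W') auto
    then show ?thesis
      by (rule tendsto_upperbound[OF _ ev]) simp
  qed
  define H where "H = (\<lambda>t. Z t - \<Theta> t)"
  have Hc: "continuous_on {0..T} H" unfolding H_def by (intro continuous_intros Zc \<Theta>c)
  have "H t2 \<le> H t1"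
  proof (cases "t1 = t2")
    case False
    then have "t1 < t2" using t12 by simp
    define c where "c = (t1 + t2) / 2"
    have c: "t1 < c" "c < t2" using \<open>t1 < t2\<close> by (auto simp: c_def)
    have Hmono: "H b \<le> H a" if "0 < a" "a \<le> b" "b < T" for a b
      using inner[OF that] by (simp add: H_def)
    have "(H \<longlongrightarrow> H t1) (at_right t1)"
      by (rule continuous_on_Icc_at_rightD[of t1 c]) (use Hc c t12 in \<open>auto intro: continuous_on_subset\<close>)
    moreover have "eventually (\<lambda>a. H c \<le> H a) (at_right t1)"
      by (rule eventually_at_rightI[of t1 c]) (use c t12 Hmono in auto)
    ultimately have "H c \<le> H t1"
      by (rule tendsto_lowerbound) simp
    moreover have "(H \<longlongrightarrow> H t2) (at_left t2)"
      by (rule continuous_on_Icc_at_leftD[of c t2]) (use Hc c t12 in \<open>auto intro: continuous_on_subset\<close>)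
    moreover have "eventually (\<lambda>b. H b \<le> H c) (at_left t2)"
      by (rule eventually_at_leftI[of c t2]) (use c t12 Hmono in auto)
    ultimately show ?thesis
      using tendsto_upperbound[of H "H t2" "at_left t2" "H c"] by auto
  qed simp
  then have "Y t2 - Y t1 \<le> (\<Phi> t2 - \<Phi> t1) + (\<Theta> t2 - \<Theta> t1)" by (simp add: H_def Z_def)
  also have "\<dots> = integral {t1..t2} (\<lambda>t. f t + q t)"
    unfolding \<Phi>_diff[OF t12] \<Theta>_diff[OF t12]
    by (rule Henstock_Kurzweil_Integration.integral_add[symmetric]) (use fi qi t12 in auto)
  finally show ?thesis .
qed

section \<open>Splitting at a level and damped integral inequalities\<close>

text \<open>
  Optimisation over the splitting parameter: equality of the two terms at
  \<open>c = m * a powr (- 1 / p)\<close> gives the exponent of Hoelder's inequality, up to the factor 2.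
\<close>
lemma le_of_young_split:
  fixes x a m p :: real
  assumes "0 < a" "0 \<le> m" "p \<noteq> 0"
    and le: "\<And>c. 0 < c \<Longrightarrow> x \<le> c * a + c powr (1 - p) * m powr p"
  shows "x \<le> 2 * m * a powr (1 - 1 / p)"
proof (cases "m = 0")
  case True
  have "x \<le> 0"
  proof (rule field_le_epsilon)
    fix e :: real assume "0 < e"
    then show "x \<le> 0 + e"
      using le[of "e / a"] \<open>0 < a\<close> by (simp add: True)
  qed
  then show ?thesis using \<open>0 < a\<close> \<open>0 \<le> m\<close> by (simp add: True)
next
  case False
  define c where "c = m * a powr (- 1 / p)"
  have "0 < m" using \<open>0 \<le> m\<close> False by simp
  then have "0 < c" using \<open>0 < a\<close> by (simp add: c_def)
  have "c * a = m * a powr (1 - 1 / p)"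
    using \<open>0 < a\<close> by (simp add: c_def powr_diff powr_minus_divide divide_inverse)
  moreover have "c powr (1 - p) * m powr p = m * a powr (1 - 1 / p)"
  proof -
    have "c powr (1 - p) = m powr (1 - p) * a powr ((- 1 / p) * (1 - p))"
      using \<open>0 < a\<close> \<open>0 < m\<close> by (simp add: c_def powr_mult powr_powr)
    also have "(- 1 / p) * (1 - p) = 1 - 1 / p"
      using \<open>p \<noteq> 0\<close> by (simp add: field_simps)
    finally show ?thesis
      using \<open>0 < m\<close> by (simp add: powr_diff)
  qed
  ultimately show ?thesis
    using le[OF \<open>0 < c\<close>] by simp
qed

text \<open>
  With \<open>le_of_young_split\<close> this is a substitute for Hoelder's inequality: a function is split into its
  part below the level \<open>c\<close> and the part above it, where \<open>(m / c) powr (r - 1)\<close> is at least 1.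
\<close>
lemma young_split:
  fixes m c r :: real
  assumes "0 \<le> m" "0 < c" "1 \<le> r"
  shows "m \<le> c + c powr (1 - r) * m powr r"
proof (cases "m \<le> c")
  case True
  then show ?thesis using assms by (simp add: add_increasing2)
next
  case False
  then have "m = m powr (1 - r) * m powr r"
    using assms by (simp flip: powr_add)
  also have "\<dots> \<le> c powr (1 - r) * m powr r"
    using False assms by (intro mult_right_mono powr_mono2') auto
  finally show ?thesis using \<open>0 < c\<close> by simp
qed

text \<open>
  As long as \<open>Y\<close> minus the integral of \<open>k\<close> exceeds \<open>c / \<mu>\<close>, so does \<open>Y\<close>, and the damping outweighs \<open>c\<close>.
  Hence \<open>Y\<close> minus the integral of \<open>k\<close> cannot grow after the last time at which it was at most \<open>c / \<mu>\<close>.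
\<close>
lemma damped_integral_inequality:
  fixes Y k :: "real \<Rightarrow> real"
  assumes Y: "continuous_on {0..T} Y" and "Y 0 = 0"
    and k: "integrable (lebesgue_on {0<..<T}) k" "\<And>t. 0 \<le> k t"
    and "0 < \<mu>" "0 \<le> c"
    and ineq: "\<And>a b. 0 \<le> a \<Longrightarrow> a \<le> b \<Longrightarrow> b \<le> T \<Longrightarrow>
                 Y b - Y a \<le> integral {a..b} (\<lambda>t. c + k t - \<mu> * Y t)"
    and t: "0 \<le> t" "t \<le> T"
  shows "Y t \<le> c / \<mu> + integral {0..t} k"
proof (rule ccontr)
  note ki = time_integrable_on[OF k(1)]
  define K where "K = (\<lambda>t. integral {0..t} k)"
  define Z where "Z = (\<lambda>t. Y t - K t)"
  assume "\<not> ?thesis"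
  then have gt: "c / \<mu> < Z t" by (simp add: Z_def K_def)
  have Kc: "continuous_on {0..T} K"
    unfolding K_def by (intro indefinite_integral_continuous_1 ki; simp)
  have Zc: "continuous_on {0..t} Z"
    unfolding Z_def by (intro continuous_intros continuous_on_subset[OF Y] continuous_on_subset[OF Kc]) (use t in auto)
  have Kdiff: "K b - K a = integral {a..b} k" if "0 \<le> a" "a \<le> b" "b \<le> T" for a b
    unfolding K_def using that by (intro time_integral_diff ki) auto
  \<comment> \<open>The last time before \<open>t\<close> at which \<open>Z\<close> is at most \<open>c / \<mu>\<close>; time 0 is one of them.\<close>
  let ?S = "{\<tau> \<in> {0..t}. Z \<tau> \<le> c / \<mu>}"
  have S0: "0 \<in> ?S" using t \<open>Y 0 = 0\<close> \<open>0 < \<mu>\<close> \<open>0 \<le> c\<close> by (simp add: Z_def K_def)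
  have "closed ?S"
    using continuous_closed_preimage[OF Zc, of "{..c / \<mu>}"] by (simp add: vimage_def Int_def)
  then have "compact ?S"
    unfolding compact_eq_bounded_closed by (intro conjI bounded_subset[of "{0..t}" ?S]) auto
  then obtain \<tau> where \<tau>: "\<tau> \<in> ?S" and max: "\<And>\<sigma>. \<sigma> \<in> ?S \<Longrightarrow> \<sigma> \<le> \<tau>"
    using compact_attains_sup[of ?S] S0 by blast
  have "\<tau> \<le> t" using \<tau> by auto
  have above: "c < \<mu> * Y \<sigma>" if "\<tau> < \<sigma>" "\<sigma> \<le> t" for \<sigma>
  proof -
    have "c / \<mu> < Z \<sigma>" using max[of \<sigma>] that \<tau> by force
    also have "Z \<sigma> \<le> Y \<sigma>"
      using k(2) by (auto simp: Z_def K_def intro!: Henstock_Kurzweil_Integration.integral_nonneg ki) (use that t in auto)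
    finally show ?thesis using \<open>0 < \<mu>\<close> by (simp add: field_simps)
  qed
  have Yi: "integrable (lebesgue_on {0<..<T}) Y" by (rule continuous_integrable_Ioo[OF Y])
  have "Y t - Y \<tau> \<le> integral {\<tau>..t} (\<lambda>t. c + k t - \<mu> * Y t)"
    using \<tau> t by (intro ineq) auto
  also have "\<dots> \<le> integral {\<tau>..t} k"
  proof (rule time_integral_mono_AE[where T = T])
    show "integrable (lebesgue_on {0<..<T}) (\<lambda>t. c + k t - \<mu> * Y t)"
      using k(1) Yi continuous_integrable_Ioo[of 0 T "\<lambda>t. c"] by simp
    show "AE \<sigma> in lebesgue_on {0<..<T}. \<tau> < \<sigma> \<and> \<sigma> < t \<longrightarrow> c + k \<sigma> - \<mu> * Y \<sigma> \<le> k \<sigma>"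
      using above by (intro AE_I2) (auto intro: less_imp_le)
  qed (use k \<tau> t in auto)
  also have "\<dots> = K t - K \<tau>" using Kdiff[of \<tau> t] \<tau> t by simp
  finally have "Z t \<le> Z \<tau>" by (simp add: Z_def)
  then show False using gt \<tau> by simp
qed

text \<open>
  The power of \<open>\<mu>\<close> is the one that convolution with \<open>exp (- \<mu> * t)\<close> and Hoelder's inequality in time would
  give. Here \<open>m\<close> is split at a constant level, and the level is optimised at the end.
\<close>
lemma damped_integral_inequality_Lr:
  fixes Y m :: "real \<Rightarrow> real"
  assumes Y: "continuous_on {0..T} Y" and "Y 0 = 0"
    and m: "integrable (lebesgue_on {0<..<T}) m" "integrable (lebesgue_on {0<..<T}) (\<lambda>t. m t powr r)" "\<And>t. 0 \<le> m t"
    and "1 \<le> r" "0 < \<mu>" "0 < b" "0 \<le> R"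
    and R: "(LINT t|lebesgue_on {0<..<T}. m t powr r) \<le> R powr r"
    and ineq: "\<And>t1 t2. 0 \<le> t1 \<Longrightarrow> t1 \<le> t2 \<Longrightarrow> t2 \<le> T \<Longrightarrow>
                 Y t2 - Y t1 \<le> integral {t1..t2} (\<lambda>t. b * m t - \<mu> * Y t)"
    and t: "0 \<le> t" "t \<le> T"
  shows "Y t \<le> 2 * b * R * \<mu> powr (1 / r - 1)"
proof -
  have Yi: "integrable (lebesgue_on {0<..<T}) Y" by (rule continuous_integrable_Ioo[OF Y])
  have "Y t / b \<le> 2 * R * (1 / \<mu>) powr (1 - 1 / r)"
  proof (rule le_of_young_split)
    fix c :: real assume "0 < c"
    define k where "k = (\<lambda>t. b * c powr (1 - r) * m t powr r)"
    have k: "integrable (lebesgue_on {0<..<T}) k" "\<And>t. 0 \<le> k t"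
      using m \<open>0 < b\<close> by (auto simp: k_def)
    have "Y t \<le> (b * c) / \<mu> + integral {0..t} k"
    proof (rule damped_integral_inequality[OF Y \<open>Y 0 = 0\<close> k \<open>0 < \<mu>\<close> _ _ t])
      fix t1 t2 :: real assume t12: "0 \<le> t1" "t1 \<le> t2" "t2 \<le> T"
      have "Y t2 - Y t1 \<le> integral {t1..t2} (\<lambda>t. b * m t - \<mu> * Y t)" by (rule ineq[OF t12])
      also have "\<dots> \<le> integral {t1..t2} (\<lambda>t. b * c + k t - \<mu> * Y t)"
      proof (rule time_integral_mono_AE[where T = T])
        show "integrable (lebesgue_on {0<..<T}) (\<lambda>t. b * c + k t - \<mu> * Y t)"
          using k(1) Yi continuous_integrable_Ioo[of 0 T "\<lambda>t. b * c"] by simp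
        show "AE \<sigma> in lebesgue_on {0<..<T}. t1 < \<sigma> \<and> \<sigma> < t2 \<longrightarrow>
            b * m \<sigma> - \<mu> * Y \<sigma> \<le> b * c + k \<sigma> - \<mu> * Y \<sigma>"
          using mult_left_mono[OF young_split[OF m(3) \<open>0 < c\<close> \<open>1 \<le> r\<close>], of b] \<open>0 < b\<close>
          by (intro AE_I2) (auto simp: k_def algebra_simps)
      qed (use m Yi t12 in auto)
      finally show "Y t2 - Y t1 \<le> integral {t1..t2} (\<lambda>t. b * c + k t - \<mu> * Y t)" .
    qed (use \<open>0 < b\<close> \<open>0 < c\<close> in auto)
    also have "integral {0..t} k \<le> integral {0..T} k"
      using k(2) t by (intro integral_subset_le time_integrable_on[OF k(1)]) auto
    also have "integral {0..T} k = integral\<^sup>L (lebesgue_on {0<..<T}) k"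
      by (rule time_integral_eq[OF k(1)]) auto
    also have "\<dots> \<le> b * c powr (1 - r) * R powr r"
      using R \<open>0 < b\<close> by (simp add: k_def mult_left_mono)
    finally show "Y t / b \<le> c * (1 / \<mu>) + c powr (1 - r) * R powr r"
      using \<open>0 < b\<close> by (simp add: field_simps)
  qed (use \<open>0 < \<mu>\<close> \<open>0 \<le> R\<close> \<open>1 \<le> r\<close> in auto)
  moreover have "(1 / \<mu>) powr (1 - 1 / r) = \<mu> powr (1 / r - 1)"
    using \<open>0 < \<mu>\<close> by (simp add: powr_divide flip: powr_minus_divide)
  ultimately show ?thesis
    using \<open>0 < b\<close> by (simp add: field_simps)
qed

section \<open>The modulus of continuity of Bochner functions\<close>

text \<open>
  Lusin's theorem for simple functions: each of the finitely many level sets contains a closed set that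
  exhausts it up to small measure, and disjoint compact sets have positive distance.
\<close>
lemma simple_function_level_separation:
  fixes f :: "real \<Rightarrow> 'b"
  assumes f: "simple_function (lebesgue_on {0<..<T}) f" and "0 < \<epsilon>"
  obtains K h where "K \<in> sets lebesgue" "K \<subseteq> {0<..<T}" "emeasure lebesgue ({0<..<T} - K) \<le> ennreal \<epsilon>"
    "0 < h" "\<And>\<sigma> t. \<sigma> \<in> K \<Longrightarrow> t \<in> K \<Longrightarrow> \<bar>\<sigma> - t\<bar> < h \<Longrightarrow> f \<sigma> = f t"
proof -
  define D where "D = f ` {0<..<T}"
  define E where "E = (\<lambda>d. f -` {d} \<inter> {0<..<T})"
  have D: "finite D" using f by (auto simp: D_def simple_function_def)
  have E: "E d \<in> sets lebesgue" if "d \<in> D" for d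
    using f that by (auto simp: E_def D_def simple_function_def sets_restrict_space_iff)
  define \<delta> where "\<delta> = \<epsilon> / (card D + 1)"
  have "0 < \<delta>" using \<open>0 < \<epsilon>\<close> by (simp add: \<delta>_def)
  have "\<forall>d\<in>D. \<exists>C. closed C \<and> C \<subseteq> E d \<and> emeasure lebesgue (E d - C) < ennreal \<delta>"
    using sets_lebesgue_inner_closed[OF E \<open>0 < \<delta>\<close>] by metis
  then obtain C where C: "\<And>d. d \<in> D \<Longrightarrow> closed (C d)" "\<And>d. d \<in> D \<Longrightarrow> C d \<subseteq> E d"
      "\<And>d. d \<in> D \<Longrightarrow> emeasure lebesgue (E d - C d) < ennreal \<delta>"
    by metis
  have Cs: "C d \<in> sets lebesgue" if "d \<in> D" for d using C(1)[OF that] by auto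
  have EC: "E d - C d \<in> sets lebesgue" if "d \<in> D" for d
    using E[OF that] Cs[OF that] by (rule sets.Diff)
  have "\<exists>h>0. \<forall>x\<in>C d. \<forall>y\<in>C d'. h \<le> dist x y" if "d \<in> D" "d' \<in> D" "d \<noteq> d'" for d d'
  proof (rule separate_compact_closed)
    show "compact (C d)"
      using C(1,2)[OF that(1)] by (auto simp: compact_eq_bounded_closed E_def intro: bounded_subset[of "{0<..<T}"])
    show "C d \<inter> C d' = {}" using C(2)[OF that(1)] C(2)[OF that(2)] that by (auto simp: E_def)
  qed (use C that in auto)
  then obtain h where h: "\<And>d d'. d \<in> D \<Longrightarrow> d' \<in> D \<Longrightarrow> d \<noteq> d' \<Longrightarrow> 0 < h d d'"
      "\<And>d d' x y. d \<in> D \<Longrightarrow> d' \<in> D \<Longrightarrow> d \<noteq> d' \<Longrightarrow> x \<in> C d \<Longrightarrow> y \<in> C d' \<Longrightarrow> h d d' \<le> dist x y"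
    by metis
  define h0 where "h0 = Min (insert 1 ((\<lambda>(d, d'). h d d') ` {(d, d') \<in> D \<times> D. d \<noteq> d'}))"
  have fin: "finite ((\<lambda>(d, d'). h d d') ` {(d, d') \<in> D \<times> D. d \<noteq> d'})"
    by (rule finite_imageI, rule finite_subset[of _ "D \<times> D"]) (use D in auto)
  show thesis
  proof (rule that[of "\<Union>d\<in>D. C d" h0])
    show "(\<Union>d\<in>D. C d) \<in> sets lebesgue" using D Cs by auto
    show "(\<Union>d\<in>D. C d) \<subseteq> {0<..<T}" using C(2) by (auto simp: E_def)
    have "emeasure lebesgue ({0<..<T} - (\<Union>d\<in>D. C d)) \<le> emeasure lebesgue (\<Union>d\<in>D. E d - C d)"
    proof (rule emeasure_mono)
      show "{0<..<T} - (\<Union>d\<in>D. C d) \<subseteq> (\<Union>d\<in>D. E d - C d)" by (auto simp: E_def D_def)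
      show "(\<Union>d\<in>D. E d - C d) \<in> sets lebesgue" by (rule sets.finite_UN[OF D EC])
    qed
    also have "\<dots> \<le> (\<Sum>d\<in>D. emeasure lebesgue (E d - C d))"
      using EC by (intro emeasure_subadditive_finite D) blast
    also have "\<dots> \<le> (\<Sum>d\<in>D. ennreal \<delta>)"
      using C(3) by (intro sum_mono) (auto intro: less_imp_le)
    also have "\<dots> = ennreal (card D * \<delta>)"
      using \<open>0 < \<delta>\<close> by (simp add: ennreal_mult ennreal_of_nat_eq_real_of_nat)
    also have "\<dots> \<le> ennreal \<epsilon>"
      using \<open>0 < \<epsilon>\<close> by (intro ennreal_leI) (simp add: \<delta>_def field_simps)
    finally show "emeasure lebesgue ({0<..<T} - (\<Union>d\<in>D. C d)) \<le> ennreal \<epsilon>" .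
    show "0 < h0" using fin h(1) by (auto simp: h0_def)
    fix \<sigma> t assume *: "\<sigma> \<in> (\<Union>d\<in>D. C d)" "t \<in> (\<Union>d\<in>D. C d)" "\<bar>\<sigma> - t\<bar> < h0"
    then obtain d d' where d: "d \<in> D" "\<sigma> \<in> C d" "d' \<in> D" "t \<in> C d'" by auto
    have "d = d'"
    proof (rule ccontr)
      assume "d \<noteq> d'"
      then have "h0 \<le> h d d'"
        unfolding h0_def using fin d by (intro Min_le) auto
      also have "\<dots> \<le> dist \<sigma> t" using h(2) d \<open>d \<noteq> d'\<close> by blast
      finally show False using *(3) by (simp add: dist_real_def)
    qed
    then have "\<sigma> \<in> E d" "t \<in> E d" using C(2) d by auto
    then show "f \<sigma> = f t" by (simp add: E_def)
  qed
qed


text \<open>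
  A form of the continuity of translations in \<open>L\<^sup>2\<close> with values in \<open>X\<close>. It bounds the oscillation of \<open>u\<close>
  between two near times by the values at these times of one function \<open>\<rho>\<close> with small integral, so that
  only integrals of real functions of one variable have to be estimated later. Off a set \<open>B\<close> of small
  measure, \<open>u\<close> is uniformly close to a simple function that is constant over short times. If one of the
  times lies in \<open>B\<close>, the oscillation is bounded by the norms of both values; these are split at the level
  \<open>m\<close>, because the part of the norm above a high level has a small integral.
\<close>
lemma Bochner_space_modulus:
  fixes u :: "real \<Rightarrow> 'b \<Rightarrow> real"
  assumes u: "u \<in> Bochner_space T 2 X nrm" and nonneg: "\<And>a. 0 \<le> nrm a"
    and quasi: "\<And>a b c. a \<in> X \<Longrightarrow> b \<in> X \<Longrightarrow> c \<in> X \<Longrightarrow>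
      (nrm (\<lambda>x. a x - c x))\<^sup>2 \<le> 2 * (nrm (\<lambda>x. a x - b x))\<^sup>2 + 2 * (nrm (\<lambda>x. c x - b x))\<^sup>2"
    and sym: "\<And>a b. a \<in> X \<Longrightarrow> b \<in> X \<Longrightarrow> nrm (\<lambda>x. a x - b x) = nrm (\<lambda>x. b x - a x)"
    and bound: "\<And>a b. a \<in> X \<Longrightarrow> b \<in> X \<Longrightarrow> (nrm (\<lambda>x. a x - b x))\<^sup>2 \<le> 2 * (nrm a)\<^sup>2 + 2 * (nrm b)\<^sup>2"
    and "0 < \<epsilon>" "0 < T"
  obtains \<rho> h G where "integrable (lebesgue_on {0<..<T}) \<rho>" "\<And>t. 0 \<le> \<rho> t"
    "(LINT t|lebesgue_on {0<..<T}. \<rho> t) \<le> \<epsilon>" "0 < h" "AE t in lebesgue_on {0<..<T}. t \<in> G"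
    "\<And>\<sigma> t. \<sigma> \<in> G \<Longrightarrow> t \<in> G \<Longrightarrow> \<bar>\<sigma> - t\<bar> < h \<Longrightarrow> (nrm (\<lambda>x. u \<sigma> x - u t x))\<^sup>2 \<le> \<rho> \<sigma> + \<rho> t"
proof -
  let ?M = "lebesgue_on {0<..<T}"
  interpret M: finite_measure ?M by (rule finite_measure_lebesgue_on) simp
  have powr2: "nrm a powr 2 = (nrm a)\<^sup>2" for a using nonneg[of a] by (cases "nrm a = 0") auto
  have meas_space: "measure ?M {0<..<T} = T"
    using \<open>0 < T\<close> by (subst measure_restrict_space) auto
  define n2 where "n2 = (\<lambda>t. (nrm (u t))\<^sup>2)"
  have n2: "integrable ?M n2" using u by (simp add: Bochner_space_def powr2 n2_def)
  then have [measurable]: "n2 \<in> borel_measurable ?M" by simp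
  have n2_nonneg: "0 \<le> n2 t" for t by (simp add: n2_def)
  from u obtain f where f: "\<And>n. simple_function ?M (f n)" "\<And>n t. t \<in> {0<..<T} \<Longrightarrow> f n t \<in> X"
    and lim: "AE t in ?M. u t \<in> X \<and> (\<lambda>n. nrm (\<lambda>x. f n t x - u t x)) \<longlonglongrightarrow> 0"
    unfolding Bochner_space_def strongly_measurable_def by blast
  \<comment> \<open>Dominated convergence: the part of the integrable \<open>n2\<close> above a high level is small.\<close>
  have "(\<lambda>m. LINT t|?M. (if real m < n2 t then n2 t else 0)) \<longlonglongrightarrow> (LINT t|?M. 0)"
  proof (rule integral_dominated_convergence[where w = n2])
    show "AE t in ?M. (\<lambda>m. if real m < n2 t then n2 t else 0) \<longlonglongrightarrow> 0"
    proof (rule AE_I2)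
      fix t
      obtain m0 where "n2 t \<le> real m0" using real_arch_simple by blast
      then have "eventually (\<lambda>m. (if real m < n2 t then n2 t else 0) = 0) sequentially"
        by (intro eventually_sequentiallyI[of m0]) auto
      then show "(\<lambda>m. if real m < n2 t then n2 t else 0) \<longlonglongrightarrow> 0" by (rule tendsto_eventually)
    qed
  qed (use n2 n2_nonneg in auto)
  then have "eventually (\<lambda>m. (LINT t|?M. (if real m < n2 t then n2 t else 0)) < \<epsilon> / 16) sequentially"
    using \<open>0 < \<epsilon>\<close> by (intro order_tendstoD(2)) auto
  then obtain m where m: "(LINT t|?M. (if real m < n2 t then n2 t else 0)) < \<epsilon> / 16"
    by (auto simp: eventually_sequentially)
  define tl where "tl = (\<lambda>t. if real m < n2 t then n2 t else 0)"
  have tl: "integrable ?M tl"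
    by (rule Bochner_Integration.integrable_bound[OF n2]) (auto simp: tl_def n2_nonneg)
  \<comment> \<open>Egorov by way of the Cauchy property: the distances of the simple functions \<open>f j\<close> and \<open>f k\<close> are
    measurable, those between \<open>f n\<close> and \<open>u\<close> need not be. The sets \<open>S' n\<close> decrease to a null set, as \<open>f\<close>
    converges almost everywhere.\<close>
  define \<eta> where "\<eta> = \<epsilon> / (32 * T)"
  have "0 < \<eta>" using \<open>0 < \<epsilon>\<close> \<open>0 < T\<close> by (simp add: \<eta>_def)
  define \<delta> where "\<delta> = \<epsilon> / (64 * (real m + 1))"
  have "0 < \<delta>" using \<open>0 < \<epsilon>\<close> by (simp add: \<delta>_def)
  define d where "d = (\<lambda>j k t. (nrm (\<lambda>x. f j t x - f k t x))\<^sup>2)"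
  have [measurable]: "d j k \<in> borel_measurable ?M" for j k
    unfolding d_def
    by (rule borel_measurable_simple_function, rule simple_function_compose2[OF f(1) f(1)])
  define S where "S = (\<lambda>n. {t \<in> space ?M. \<exists>k\<in>{n..}. \<eta> < d n k t})"
  define S' where "S' = (\<lambda>n. \<Union>j\<in>{n..}. S j)"
  have S_sets: "S n \<in> sets ?M" for n unfolding S_def by measurable
  then have S'_sets: "S' n \<in> sets ?M" for n unfolding S'_def by (intro sets.countable_UN') auto
  have "(\<lambda>n. emeasure ?M (S' n)) \<longlonglongrightarrow> emeasure ?M (\<Inter>n. S' n)"
    using S'_sets by (intro Lim_emeasure_decseq) (auto simp: S'_def decseq_def M.emeasure_eq_measure intro: order_trans)
  moreover have "emeasure ?M (\<Inter>n. S' n) = 0"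
  proof -
    have "AE t in ?M. t \<notin> (\<Inter>n. S' n)"
      using lim AE_space
    proof eventually_elim
      case (elim t)
      then have lim0: "(\<lambda>n. (nrm (\<lambda>x. f n t x - u t x))\<^sup>2) \<longlonglongrightarrow> 0"
        using tendsto_power[of "\<lambda>n. nrm (\<lambda>x. f n t x - u t x)" 0 sequentially 2] by simp
      then have "eventually (\<lambda>n. (nrm (\<lambda>x. f n t x - u t x))\<^sup>2 < \<eta> / 4) sequentially"
        using \<open>0 < \<eta>\<close> by (intro order_tendstoD(2)[OF lim0]) auto
      then obtain N where N: "\<And>n. N \<le> n \<Longrightarrow> (nrm (\<lambda>x. f n t x - u t x))\<^sup>2 < \<eta> / 4"
        by (auto simp: eventually_sequentially)
      have "d j k t \<le> \<eta>" if "N \<le> j" "N \<le> k" for j k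
        using quasi[of "f j t" "u t" "f k t"] f(2)[of t] elim N[OF that(1)] N[OF that(2)]
        by (simp add: d_def)
      then have "\<not> \<eta> < d j k t" if "N \<le> j" "j \<le> k" for j k
        using that by (meson leD order_trans)
      then have "t \<notin> S' N" by (simp add: S'_def S_def)
      then show ?case by blast
    qed
    moreover have "(\<Inter>n. S' n) \<in> sets ?M" using S'_sets by (intro sets.countable_INT) auto
    ultimately show ?thesis using AE_iff_null_sets by blast
  qed
  ultimately have "eventually (\<lambda>n. emeasure ?M (S' n) < ennreal \<delta>) sequentially"
    using \<open>0 < \<delta>\<close> by (intro order_tendstoD(2)[of _ 0]) auto
  then obtain n where n: "emeasure ?M (S' n) < ennreal \<delta>"
    by (auto simp: eventually_sequentially)
  obtain K h where K: "K \<in> sets lebesgue" "K \<subseteq> {0<..<T}" "emeasure lebesgue ({0<..<T} - K) \<le> ennreal \<delta>"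
    and h: "0 < h" "\<And>\<sigma> t. \<sigma> \<in> K \<Longrightarrow> t \<in> K \<Longrightarrow> \<bar>\<sigma> - t\<bar> < h \<Longrightarrow> f n \<sigma> = f n t"
    using simple_function_level_separation[OF f(1)[of n] \<open>0 < \<delta>\<close>] by metis
  define B where "B = S' n \<union> ({0<..<T} - K)"
  have KC: "{0<..<T} - K \<in> sets ?M"
    using sets.Diff[OF lebesgue_Ioo K(1)] by (auto simp: sets_restrict_space_iff)
  then have B: "B \<in> sets ?M" unfolding B_def using S'_sets by (intro sets.Un)
  have "emeasure ?M B \<le> emeasure ?M (S' n) + emeasure ?M ({0<..<T} - K)"
    unfolding B_def by (rule emeasure_subadditive[OF S'_sets KC])
  also have "emeasure ?M ({0<..<T} - K) = emeasure lebesgue ({0<..<T} - K)"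
    by (rule emeasure_restrict_space) auto
  also have "emeasure ?M (S' n) + \<dots> \<le> ennreal \<delta> + ennreal \<delta>"
    using n K(3) by (intro add_mono) auto
  finally have "emeasure ?M B \<le> ennreal (2 * \<delta>)"
    using \<open>0 < \<delta>\<close> by (simp flip: ennreal_plus)
  then have B_meas: "measure ?M B \<le> 2 * \<delta>"
    using \<open>0 < \<delta>\<close> by (simp add: M.emeasure_eq_measure)
  define \<rho> where "\<rho> = (\<lambda>t. 8 * \<eta> + 4 * tl t + 4 * real m * indicator B t)"
  define G where "G = {t \<in> {0<..<T}. u t \<in> X \<and> (\<lambda>n. nrm (\<lambda>x. f n t x - u t x)) \<longlonglongrightarrow> 0}"
  have tl_nonneg: "0 \<le> tl t" for t by (simp add: tl_def n2_nonneg)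
  have iB: "integrable ?M (indicator B :: real \<Rightarrow> real)"
    using B by (simp add: M.emeasure_eq_measure)
  have BT: "B \<inter> {0<..<T} = B" using sets.sets_into_space[OF B] by auto
  show thesis
  proof (rule that[of \<rho> h G])
    show "integrable ?M \<rho>" unfolding \<rho>_def using tl iB by simp
    show "0 \<le> \<rho> t" for t using \<open>0 < \<eta>\<close> tl_nonneg by (simp add: \<rho>_def)
    have "(LINT t|?M. \<rho> t) = 8 * \<eta> * T + 4 * (LINT t|?M. tl t) + 4 * real m * measure ?M B"
      unfolding \<rho>_def using tl iB meas_space BT by simp
    also have "\<dots> \<le> \<epsilon> / 4 + \<epsilon> / 4 + \<epsilon> / 8"
    proof (intro add_mono)
      show "8 * \<eta> * T \<le> \<epsilon> / 4" using \<open>0 < T\<close> by (simp add: \<eta>_def)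
      show "4 * (LINT t|?M. tl t) \<le> \<epsilon> / 4" using m by (simp add: tl_def)
      have "4 * real m * measure ?M B \<le> 4 * real m * (2 * \<delta>)"
        using B_meas by (intro mult_left_mono) auto
      also have "\<dots> \<le> \<epsilon> / 8"
      proof -
        have "\<delta> * (64 * (real m + 1)) = \<epsilon>" unfolding \<delta>_def by (rule nonzero_eq_divide_eq[THEN iffD1, OF _ refl]) simp
        then show ?thesis using \<open>0 < \<delta>\<close> by (simp add: algebra_simps)
      qed
      finally show "4 * real m * measure ?M B \<le> \<epsilon> / 8" by simp
    qed
    finally show "(LINT t|?M. \<rho> t) \<le> \<epsilon>" using \<open>0 < \<epsilon>\<close> by simp
    show "0 < h" by fact
    show "AE t in ?M. t \<in> G" using lim AE_space by eventually_elim (auto simp: G_def)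
    fix \<sigma> t assume G: "\<sigma> \<in> G" "t \<in> G" and "\<bar>\<sigma> - t\<bar> < h"
    then have X: "u \<sigma> \<in> X" "u t \<in> X" by (auto simp: G_def)
    show "(nrm (\<lambda>x. u \<sigma> x - u t x))\<^sup>2 \<le> \<rho> \<sigma> + \<rho> t"
    proof (cases "\<sigma> \<in> B \<or> t \<in> B")
      case True
      have le: "n2 \<tau> \<le> real m + tl \<tau>" for \<tau> by (simp add: tl_def)
      have "(nrm (\<lambda>x. u \<sigma> x - u t x))\<^sup>2 \<le> 2 * n2 \<sigma> + 2 * n2 t"
        using bound[OF X] by (simp add: n2_def)
      also have "\<dots> \<le> 4 * real m + 2 * tl \<sigma> + 2 * tl t" using le[of \<sigma>] le[of t] by simp
      also have "\<dots> \<le> \<rho> \<sigma> + \<rho> t"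
        using True \<open>0 < \<eta>\<close> tl_nonneg[of \<sigma>] tl_nonneg[of t] by (auto simp: \<rho>_def indicator_def)
      finally show ?thesis .
    next
      case False
      have close: "(nrm (\<lambda>x. u \<tau> x - f n \<tau> x))\<^sup>2 \<le> 2 * \<eta>" if "\<tau> \<in> G" "\<tau> \<notin> B" for \<tau>
      proof (rule LIMSEQ_le_const)
        have lim0: "(\<lambda>k. (nrm (\<lambda>x. f k \<tau> x - u \<tau> x))\<^sup>2) \<longlonglongrightarrow> 0"
          using that tendsto_power[of "\<lambda>n. nrm (\<lambda>x. f n \<tau> x - u \<tau> x)" 0 sequentially 2] by (simp add: G_def)
        show "(\<lambda>k. 2 * \<eta> + 2 * (nrm (\<lambda>x. f k \<tau> x - u \<tau> x))\<^sup>2) \<longlonglongrightarrow> 2 * \<eta>"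
          using tendsto_add[OF tendsto_const[of "2 * \<eta>"] tendsto_mult_left[OF lim0, of 2]] by simp
        have "(nrm (\<lambda>x. u \<tau> x - f n \<tau> x))\<^sup>2 \<le> 2 * \<eta> + 2 * (nrm (\<lambda>x. f k \<tau> x - u \<tau> x))\<^sup>2" if "n \<le> k" for k
        proof -
          have "\<tau> \<in> {0<..<T}" "u \<tau> \<in> X" using \<open>\<tau> \<in> G\<close> by (auto simp: G_def)
          moreover have "d n k \<tau> \<le> \<eta>"
            using \<open>\<tau> \<notin> B\<close> \<open>\<tau> \<in> {0<..<T}\<close> that by (force simp: B_def S'_def S_def)
          ultimately show ?thesis
            using quasi[of "u \<tau>" "f k \<tau>" "f n \<tau>"] f(2)[of \<tau>]
              sym[of "u \<tau>" "f k \<tau>"] by (simp add: d_def)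
        qed
        then show "\<exists>N. \<forall>k\<ge>N. (nrm (\<lambda>x. u \<tau> x - f n \<tau> x))\<^sup>2 \<le> 2 * \<eta> + 2 * (nrm (\<lambda>x. f k \<tau> x - u \<tau> x))\<^sup>2"
          by blast
      qed
      have eq: "f n \<sigma> = f n t"
        using False G \<open>\<bar>\<sigma> - t\<bar> < h\<close> by (intro h(2)) (auto simp: B_def G_def)
      have "(nrm (\<lambda>x. u \<sigma> x - u t x))\<^sup>2 \<le> 2 * (2 * \<eta>) + 2 * (2 * \<eta>)"
        using quasi[OF X(1) _ X(2), of "f n t"] close[OF G(1)] close[OF G(2)] False f(2)[of t] G
        by (auto simp: eq G_def)
      also have "\<dots> \<le> \<rho> \<sigma> + \<rho> t"
        using \<open>0 < \<eta>\<close> tl_nonneg[of \<sigma>] tl_nonneg[of t] by (simp add: \<rho>_def)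
      finally show ?thesis .
    qed
  qed
qed

section \<open>Smooth test functions and weak time derivatives\<close>

text \<open>
  Smoothness by coinduction: membership in a family of functions that is closed under differentiation.
\<close>
lemma deriv_iterates_differentiable:
  fixes f :: "real \<Rightarrow> real"
  assumes closed: "\<And>f. f \<in> S \<Longrightarrow> \<exists>f'\<in>S. \<forall>t. (f has_field_derivative f' t) (at t)"
    and "f \<in> S"
  shows "(deriv ^^ k) f differentiable (at t)"
proof -
  have "(deriv ^^ k) f \<in> S"
  proof (induction k)
    case (Suc k)
    then obtain f' where f': "f' \<in> S" "\<And>t. ((deriv ^^ k) f has_field_derivative f' t) (at t)"
      using closed by blast
    then have "deriv ((deriv ^^ k) f) = f'" by (intro ext DERIV_imp_deriv)
    then show ?case using f' by simp
  qed (use \<open>f \<in> S\<close> in simp)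
  then show ?thesis using closed real_differentiable_def by blast
qed

text \<open>
  The family contains \<open>exp (- 1 / (x * (1 - x)))\<close>, cut off outside the unit interval, and is closed under
  differentiation by \<open>bump_has_derivative\<close>.
\<close>
definition bump :: "real poly \<Rightarrow> nat \<Rightarrow> real \<Rightarrow> real" where
  "bump P n x = (if 0 < x \<and> x < 1 then poly P x / (x * (1 - x)) ^ n * exp (- 1 / (x * (1 - x))) else 0)"

lemma power_le_fact_mult_exp: "0 \<le> (y::real) \<Longrightarrow> y ^ k \<le> fact k * exp y"
proof -
  assume y: "0 \<le> y"
  have "(\<Sum>i\<in>{k}. y ^ i /\<^sub>R fact i) \<le> (\<Sum>i. y ^ i /\<^sub>R fact i)"
    by (rule sum_le_suminf[OF summable_exp_generic]) (use y in auto)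
  then have "y ^ k / fact k \<le> exp y" by (simp add: exp_def field_simps)
  then show ?thesis by (simp add: field_simps)
qed

text \<open>
  The exponential beats \<open>n + 2\<close> powers of \<open>x * (1 - x)\<close>; the two powers in excess of the denominator are
  what makes the derivative vanish at both endpoints.
\<close>
lemma bump_flat_at_endpoints:
  obtains C where "\<And>x a. a = 0 \<or> a = 1 \<Longrightarrow> \<bar>bump P n x\<bar> \<le> C * (x - a)\<^sup>2"
proof -
  have "compact (poly P ` {0..1})"
    by (intro compact_continuous_image continuous_intros) auto
  then obtain M where M: "\<And>x. x \<in> {0..1} \<Longrightarrow> \<bar>poly P x\<bar> \<le> M"
    by (metis (no_types, lifting) compact_imp_bounded bounded_real imageI)
  have "0 \<le> M" using M[of 0] by auto
  define C where "C = M * fact (n + 2)"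
  have "\<bar>bump P n x\<bar> \<le> C * (x - a)\<^sup>2" if a: "a = 0 \<or> a = 1" for x a
  proof (cases "0 < x \<and> x < 1")
    case True
    define w where "w = x * (1 - x)"
    have w: "0 < w" using True by (simp add: w_def)
    have "(1 / w) ^ (n + 2) \<le> fact (n + 2) * exp (1 / w)"
      using w by (intro power_le_fact_mult_exp) simp
    then have e: "exp (- 1 / w) \<le> fact (n + 2) * w ^ (n + 2)"
      using w by (simp add: exp_minus field_simps)
    have "\<bar>bump P n x\<bar> = \<bar>poly P x\<bar> / w ^ n * exp (- 1 / w)"
      using True w by (simp add: bump_def w_def abs_mult)
    also have "\<dots> \<le> M / w ^ n * (fact (n + 2) * w ^ (n + 2))"
      using M[of x] True w e \<open>0 \<le> M\<close> by (intro mult_mono divide_right_mono) auto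
    also have "\<dots> = C * w\<^sup>2"
      using w by (simp add: C_def power_add power2_eq_square)
    also have "\<dots> \<le> C * (x - a)\<^sup>2"
    proof -
      have "w \<le> \<bar>x - a\<bar>" using a True by (auto simp: w_def mult_left_le mult_left_le_one_le)
      then have "w\<^sup>2 \<le> \<bar>x - a\<bar>\<^sup>2" using w by (intro power_mono) auto
      then show ?thesis using \<open>0 \<le> M\<close> by (intro mult_left_mono) (auto simp: C_def)
    qed
    finally show ?thesis .
  next
    case False
    then have "bump P n x = 0" by (auto simp: bump_def)
    then show ?thesis using \<open>0 \<le> M\<close> by (simp add: C_def)
  qed
  then show thesis using that by blast
qed

lemma DERIV_zero_of_quadratic_bound:
  fixes f :: "real \<Rightarrow> real"
  assumes "\<And>x. \<bar>f x\<bar> \<le> C * (x - a)\<^sup>2"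
  shows "(f has_field_derivative 0) (at a)"
proof -
  have "f a = 0" using assms[of a] by simp
  have "(\<lambda>h. (f (a + h) - f a) / h) \<midarrow>0\<rightarrow> 0"
  proof (rule Lim_null_comparison)
    show "eventually (\<lambda>h. norm ((f (a + h) - f a) / h) \<le> C * \<bar>h\<bar>) (at 0)"
      using assms[of "a + _"] by (auto simp: \<open>f a = 0\<close> eventually_at_filter field_simps power2_eq_square abs_mult_self_eq
          intro!: always_eventually)
    show "(\<lambda>h. C * \<bar>h\<bar>) \<midarrow>0\<rightarrow> 0" by (intro tendsto_eq_intros) auto
  qed
  then show ?thesis by (simp add: DERIV_def)
qed

lemma bump_has_derivative:
  "(bump P n has_field_derivative
     bump (pderiv P * [:0, 1, - 1:]\<^sup>2 - of_nat n * P * [:1, - 2:] * [:0, 1, - 1:] + P * [:1, - 2:]) (n + 2) t) (at t)"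
  (is "(_ has_field_derivative bump ?P' _ _) _")
proof -
  consider "t < 0 \<or> 1 < t" | "t = 0 \<or> t = 1" | "0 < t" "t < 1" by linarith
  then show ?thesis
  proof cases
    case 1
    have "(bump P n has_field_derivative 0) (at t)"
    proof (rule has_field_derivative_transform_within_open[where S = "{..<0} \<union> {1<..}"])
      show "((\<lambda>_. 0) has_field_derivative 0) (at t)" by simp
    qed (use 1 in \<open>auto simp: bump_def\<close>)
    then show ?thesis using 1 by (auto simp: bump_def)
  next
    case 2
    obtain C where "\<And>x a. a = 0 \<or> a = 1 \<Longrightarrow> \<bar>bump P n x\<bar> \<le> C * (x - a)\<^sup>2"
      using bump_flat_at_endpoints by blast
    then have "(bump P n has_field_derivative 0) (at t)"
      using 2 by (intro DERIV_zero_of_quadratic_bound) blast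
    then show ?thesis using 2 by (auto simp: bump_def)
  next
    case 3
    define w where "w = t * (1 - t)"
    have w: "w \<noteq> 0" using 3 by (simp add: w_def)
    define v where "v = inverse w"
    have vw: "v * w = 1" using w by (simp add: v_def)
    have dv: "((\<lambda>x. inverse (x * (1 - x))) has_field_derivative - ((1 - 2 * t) * v\<^sup>2)) (at t)"
    proof -
      have "((\<lambda>x. x * (1 - x)) has_field_derivative (1 - 2 * t)) (at t)"
        by (auto intro!: derivative_eq_intros)
      from DERIV_inverse'[OF this] w show ?thesis
        by (simp add: v_def w_def power2_eq_square mult_ac)
    qed
    \<comment> \<open>In terms of \<open>v = inverse w\<close> the derivative is polynomial, and only \<open>v * w = 1\<close> is needed.\<close>
    have "((\<lambda>x. poly P x * inverse (x * (1 - x)) ^ n * exp (- inverse (x * (1 - x)))) has_field_derivative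
        (poly (pderiv P) t * v ^ n + poly P t * (real n * v ^ (n - 1) * - ((1 - 2 * t) * v\<^sup>2))) * exp (- v)
        + poly P t * v ^ n * (exp (- v) * ((1 - 2 * t) * v\<^sup>2))) (at t)"
      by (rule derivative_eq_intros dv refl poly_DERIV)+ (simp add: v_def w_def)
    also have "(poly (pderiv P) t * v ^ n + poly P t * (real n * v ^ (n - 1) * - ((1 - 2 * t) * v\<^sup>2))) * exp (- v)
        + poly P t * v ^ n * (exp (- v) * ((1 - 2 * t) * v\<^sup>2)) = poly ?P' t / w ^ (n + 2) * exp (- 1 / w)"
    proof -
      have P': "poly ?P' t = poly (pderiv P) t * w\<^sup>2 - real n * poly P t * (1 - 2 * t) * w + poly P t * (1 - 2 * t)"
        by (simp add: w_def algebra_simps)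
      have n1: "real n * v ^ (n - 1) * v\<^sup>2 = real n * v ^ n * v"
        by (cases n) (auto simp: power2_eq_square)
      have "poly ?P' t * v ^ (n + 2) = poly (pderiv P) t * v ^ n * (v * w)\<^sup>2
          - real n * poly P t * (1 - 2 * t) * v ^ n * v * (v * w) + poly P t * (1 - 2 * t) * v ^ n * v\<^sup>2"
        unfolding P' by (simp add: algebra_simps power2_eq_square)
      also have "\<dots> = poly (pderiv P) t * v ^ n - poly P t * (1 - 2 * t) * (real n * v ^ (n - 1) * v\<^sup>2)
          + poly P t * (1 - 2 * t) * v ^ n * v\<^sup>2"
        unfolding vw n1 by (simp add: algebra_simps)
      finally have "poly ?P' t * v ^ (n + 2) * exp (- v) = (poly (pderiv P) t * v ^ n
           - poly P t * (1 - 2 * t) * (real n * v ^ (n - 1) * v\<^sup>2)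
           + poly P t * (1 - 2 * t) * v ^ n * v\<^sup>2) * exp (- v)" by simp
      moreover have "poly ?P' t * v ^ (n + 2) * exp (- v) = poly ?P' t / w ^ (n + 2) * exp (- 1 / w)"
        by (simp add: v_def divide_inverse power_inverse)
      ultimately show ?thesis by (simp add: algebra_simps)
    qed
    finally have "((\<lambda>x. poly P x / (x * (1 - x)) ^ n * exp (- 1 / (x * (1 - x)))) has_field_derivative
        poly ?P' t / w ^ (n + 2) * exp (- 1 / w)) (at t)"
      by (simp only: divide_inverse power_inverse mult_minus_left mult_1_left)
    then have "(bump P n has_field_derivative poly ?P' t / w ^ (n + 2) * exp (- 1 / w)) (at t)"
      by (rule has_field_derivative_transform_within_open[where S = "{0<..<1}"]) (use 3 in \<open>auto simp: bump_def\<close>)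
    then show ?thesis using 3 by (simp add: bump_def w_def)
  qed
qed

text \<open>
  The step is the normalised primitive of a bump. The family \<open>S\<close> is returned with it, since the smoothness
  of rescaled differences of steps is again proved by \<open>deriv_iterates_differentiable\<close>.
\<close>
lemma smooth_step_exists:
  obtains S and B \<beta> :: "real \<Rightarrow> real" where
    "\<And>f. f \<in> S \<Longrightarrow> \<exists>f'\<in>S. \<forall>t. (f has_field_derivative f' t) (at t)" "B \<in> S"
    "\<And>t. (B has_field_derivative \<beta> t) (at t)" "\<And>t. 0 \<le> \<beta> t" "\<And>t. t \<notin> {0..1} \<Longrightarrow> \<beta> t = 0"
    "continuous_on UNIV \<beta>" "\<And>t. t \<le> 0 \<Longrightarrow> B t = 0" "\<And>t. 1 \<le> t \<Longrightarrow> B t = 1" "\<And>t. 0 \<le> B t" "\<And>t. B t \<le> 1"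
proof -
  define A where "A = (\<lambda>x. integral {-1..x} (bump 1 0))"
  have cont: "continuous_on X (bump P n)" for P n X
    using bump_has_derivative by (meson DERIV_isCont continuous_at_imp_continuous_on)
  have A0: "A x = 0" if "x \<le> 0" for x
    unfolding A_def by (rule integral_unique, rule has_integral_is_0) (use that in \<open>auto simp: bump_def\<close>)
  have A': "(A has_field_derivative bump 1 0 x) (at x)" for x
  proof (cases "x < 0")
    case True
    have "(A has_field_derivative 0) (at x)"
      by (rule has_field_derivative_transform_within_open[where S = "{..<0}" and f = "\<lambda>_. 0"]) (use True A0 in auto)
    then show ?thesis using True by (simp add: bump_def)
  next
    case False
    have "(A has_field_derivative bump 1 0 x) (at x within {-1..x + 1})"
      unfolding A_def by (rule integral_has_real_derivative) (use False cont in auto)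
    then show ?thesis using False by (simp add: at_within_Icc_at)
  qed
  have bump_nonneg: "0 \<le> bump 1 0 x" for x by (simp add: bump_def)
  have mono: "A x \<le> A y" if "x \<le> y" for x y
    using that by (rule DERIV_nonneg_imp_nondecreasing) (use A' bump_nonneg in blast)
  have "A 0 < A 1"
  proof (rule DERIV_pos_imp_increasing_open[where f = A and a = 0 and b = 1])
    show "\<exists>y. (A has_real_derivative y) (at x) \<and> 0 < y" if "0 < x" "x < 1" for x
      using A'[of x] that by (intro exI[of _ "bump 1 0 x"]) (simp add: bump_def)
    show "continuous_on {0..1} A" using A' by (meson DERIV_isCont continuous_at_imp_continuous_on)
  qed simp
  then have c: "0 < A 1" by (simp add: A0)
  have A1: "A x = A 1" if "1 \<le> x" for x
  proof (cases "x = 1")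
    case False
    then have "1 < x" using that by simp
    then show ?thesis
    proof (rule DERIV_isconst_end)
      show "continuous_on {1..x} A" using A' by (meson DERIV_isCont continuous_at_imp_continuous_on)
      show "(A has_real_derivative 0) (at y)" if "1 < y" "y < x" for y
        using A'[of y] that by (simp add: bump_def)
    qed
  qed simp
  define S where "S = {\<lambda>x. g x / A 1 | g. g = A \<or> (\<exists>P n. g = bump P n)}"
  show thesis
  proof (rule that[of S "\<lambda>x. A x / A 1" "\<lambda>x. bump 1 0 x / A 1"])
    fix f assume "f \<in> S"
    then obtain g where g: "f = (\<lambda>x. g x / A 1)" "g = A \<or> (\<exists>P n. g = bump P n)" by (auto simp: S_def)
    then obtain P n where "\<And>t. (g has_field_derivative bump P n t) (at t)"
      using A' bump_has_derivative by metis
    then have "\<forall>t. (f has_field_derivative bump P n t / A 1) (at t)"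
      unfolding g(1) by (intro allI DERIV_cdivide)
    then show "\<exists>f'\<in>S. \<forall>t. (f has_field_derivative f' t) (at t)"
      by (intro bexI[of _ "\<lambda>t. bump P n t / A 1"]) (auto simp: S_def)
  next
    show "((\<lambda>x. A x / A 1) has_field_derivative bump 1 0 t / A 1) (at t)" for t
      by (intro DERIV_cdivide A')
    show "0 \<le> A t / A 1" for t using mono[of 0 t] A0[of 0] A0[of t] c by (cases "t \<le> 0") auto
    show "A t / A 1 \<le> 1" for t using mono[of t 1] A1[of t] c by (cases "1 \<le> t") auto
    show "continuous_on UNIV (\<lambda>x. bump 1 0 x / A 1)"
      using c by (intro continuous_on_divide cont continuous_on_const) auto
    show "(\<lambda>x. A x / A 1) \<in> S" by (auto simp: S_def)
    show "0 \<le> bump 1 0 t / A 1" for t using bump_nonneg c by simp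
    show "bump 1 0 t / A 1 = 0" if "t \<notin> {0..1}" for t using that by (auto simp: bump_def)
    show "A t / A 1 = 0" if "t \<le> 0" for t using A0[OF that] by simp
    show "A t / A 1 = 1" if "1 \<le> t" for t using A1[OF that] c by simp
  qed
qed

text \<open>
  The fundamental theorem of calculus for a distributional derivative. The test function rises smoothly
  from 0 to 1 just after \<open>\<tau>\<close> and falls just after \<open>t\<close>. As the width \<open>\<epsilon> n\<close> of the two steps tends to 0,
  its derivative acts on the continuous \<open>F\<close> as the difference of two point masses, and the function
  itself tends to the indicator of \<open>{\<tau><..<t}\<close> almost everywhere.
\<close>
lemma increment_of_weak_derivative:
  fixes F G :: "real \<Rightarrow> real"
  assumes F: "continuous_on {0..T} F" and G: "integrable (lebesgue_on {0<..<T}) G"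
    and weak: "\<And>\<phi>. test_function T \<phi> \<Longrightarrow>
      (LINT t|lebesgue_on {0<..<T}. deriv \<phi> t * F t) = - (LINT t|lebesgue_on {0<..<T}. \<phi> t * G t)"
    and \<tau>t: "0 < \<tau>" "\<tau> < t" "t < T"
  shows "F t - F \<tau> = integral {\<tau>..t} G"
proof -
  let ?M = "lebesgue_on {0<..<T}"
  obtain S and B \<beta> :: "real \<Rightarrow> real" where
    S: "\<And>f. f \<in> S \<Longrightarrow> \<exists>f'\<in>S. \<forall>t. (f has_field_derivative f' t) (at t)" "B \<in> S"
    and \<beta>: "\<And>t. (B has_field_derivative \<beta> t) (at t)" "\<And>t. 0 \<le> \<beta> t" "\<And>t. t \<notin> {0..1} \<Longrightarrow> \<beta> t = 0"
      "continuous_on UNIV \<beta>"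
    and B: "\<And>t. t \<le> 0 \<Longrightarrow> B t = 0" "\<And>t. 1 \<le> t \<Longrightarrow> B t = 1" "\<And>t. 0 \<le> B t" "\<And>t. B t \<le> 1"
    using smooth_step_exists by metis
  \<comment> \<open>Room for the two steps: they take place in \<open>{\<tau>..\<tau> + e0}\<close> and \<open>{t..t + e0}\<close>.\<close>
  define e0 where "e0 = min (t - \<tau>) (T - t) / 2"
  have e0: "0 < e0" "\<tau> + e0 < t" "t + e0 < T" using \<tau>t by (auto simp: e0_def min_def field_simps)
  define \<epsilon> where "\<epsilon> = (\<lambda>n. e0 / real (Suc n))"
  have \<epsilon>: "0 < \<epsilon> n" "\<epsilon> n \<le> e0" for n using e0 by (auto simp: \<epsilon>_def divide_le_eq)
  have \<epsilon>0: "\<epsilon> \<longlonglongrightarrow> 0" unfolding \<epsilon>_def using lim_const_over_n[of e0] LIMSEQ_Suc by blast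
  define \<phi> where "\<phi> = (\<lambda>n x. B ((x - \<tau>) / \<epsilon> n) - B ((x - t) / \<epsilon> n))"
  define b where "b = (\<lambda>a n x. \<beta> ((x - a) / \<epsilon> n) / \<epsilon> n)"
  have dB: "((\<lambda>x. g ((x - a) / \<epsilon> n)) has_field_derivative g' ((x - a) / \<epsilon> n) / \<epsilon> n) (at x)"
    if "\<And>t. (g has_field_derivative g' t) (at t)" for g g' :: "real \<Rightarrow> real" and a n x
  proof -
    have "((\<lambda>x. x - a) has_field_derivative 1) (at x)" by (auto intro!: derivative_eq_intros)
    then have "((\<lambda>x. (x - a) / \<epsilon> n) has_field_derivative 1 / \<epsilon> n) (at x)" by (rule DERIV_cdivide)
    from DERIV_chain2[OF that this] show ?thesis by simp
  qed
  have bc: "continuous_on X (b a n)" for X a n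
    unfolding b_def using \<epsilon>(1)[of n]
    by (intro continuous_intros continuous_on_compose2[OF \<beta>(4)]) auto
  have \<phi>': "deriv (\<phi> n) x = b \<tau> n x - b t n x" for n x
    unfolding \<phi>_def b_def by (intro DERIV_imp_deriv DERIV_diff dB \<beta>)
  have test: "test_function T (\<phi> n)" for n
  proof -
    define S' where "S' = {\<lambda>x. c * (g ((x - \<tau>) / \<epsilon> n) - g ((x - t) / \<epsilon> n)) | c g. g \<in> S}"
    have "(deriv ^^ k) (\<phi> n) differentiable (at x)" for k x
    proof (rule deriv_iterates_differentiable[where S = S'])
      show "\<phi> n \<in> S'" unfolding S'_def \<phi>_def using S(2) by (intro CollectI exI[of _ 1] exI[of _ B]) auto
      fix f assume "f \<in> S'"
      then obtain c g where f: "f = (\<lambda>x. c * (g ((x - \<tau>) / \<epsilon> n) - g ((x - t) / \<epsilon> n)))" "g \<in> S"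
        by (auto simp: S'_def)
      then obtain g' where g': "g' \<in> S" "\<And>t. (g has_field_derivative g' t) (at t)" using S(1) by blast
      have "(f has_field_derivative (c / \<epsilon> n) * (g' ((x - \<tau>) / \<epsilon> n) - g' ((x - t) / \<epsilon> n))) (at x)" for x
        using DERIV_cmult[OF DERIV_diff[OF dB[OF g'(2), of \<tau> n x] dB[OF g'(2), of t n x]], of c]
        unfolding f(1) by (simp add: diff_divide_distrib right_diff_distrib)
      moreover have "(\<lambda>x. (c / \<epsilon> n) * (g' ((x - \<tau>) / \<epsilon> n) - g' ((x - t) / \<epsilon> n))) \<in> S'"
        unfolding S'_def using g'(1) by blast
      ultimately show "\<exists>f'\<in>S'. \<forall>t. (f has_field_derivative f' t) (at t)"
        by (intro bexI[of _ "\<lambda>x. (c / \<epsilon> n) * (g' ((x - \<tau>) / \<epsilon> n) - g' ((x - t) / \<epsilon> n))"] allI)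
    qed
    moreover have "\<phi> n x = 0" if "x \<notin> {\<tau>..t + e0}" for x
    proof (cases "x < \<tau>")
      case True
      then show ?thesis using \<tau>t \<epsilon>(1)[of n] by (simp add: \<phi>_def B(1) divide_nonpos_pos)
    next
      case False
      then have "t + e0 < x" using that by auto
      then have "1 \<le> (x - t) / \<epsilon> n" "1 \<le> (x - \<tau>) / \<epsilon> n" using \<epsilon>[of n] \<tau>t by (auto simp: le_divide_eq)
      then show ?thesis by (simp add: \<phi>_def B(2))
    qed
    ultimately show ?thesis
      unfolding test_function_def using \<tau>t e0 by (intro conjI exI[of _ \<tau>] exI[of _ "t + e0"]) auto
  qed
  have Fi: "integrable ?M (\<lambda>x. b a n x * F x)" for a n
    by (intro continuous_integrable_Ioo continuous_intros bc F)
  have approx: "(\<lambda>n. LINT x|?M. b a n x * F x) \<longlonglongrightarrow> F a" if a: "0 < a" "a + e0 < T" for a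
  proof (rule LIMSEQ_I)
    fix r :: real assume "0 < r"
    have bi: "integrable ?M (b a n)" for n by (intro continuous_integrable_Ioo bc)
    have b1: "(LINT x|?M. b a n x) = 1" for n
    proof -
      have "(b a n has_integral B ((T - a) / \<epsilon> n) - B ((0 - a) / \<epsilon> n)) {0..T}"
        unfolding b_def
        by (rule fundamental_theorem_of_calculus)
           (use \<tau>t dB[OF \<beta>(1)] in \<open>auto simp: has_real_derivative_iff_has_vector_derivative[symmetric] intro: has_field_derivative_at_within\<close>)
      moreover have "B ((T - a) / \<epsilon> n) = 1" "B ((0 - a) / \<epsilon> n) = 0"
        using a \<epsilon>[of n] by (auto intro!: B simp: le_divide_eq divide_nonpos_pos)
      ultimately have "integral {0..T} (b a n) = 1" by (simp add: integral_unique)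
      then show ?thesis using time_integral_eq[OF bi, of 0 T] by simp
    qed
    have "isCont F a" using F a e0 by (auto intro: continuous_on_interior)
    then obtain d where d: "0 < d" "\<And>x. \<bar>x - a\<bar> < d \<Longrightarrow> \<bar>F x - F a\<bar> < r / 2"
      using \<open>0 < r\<close> unfolding continuous_at_eps_delta dist_real_def by (metis half_gt_zero)
    obtain N where N: "\<And>n. N \<le> n \<Longrightarrow> \<epsilon> n < d"
      using order_tendstoD(2)[OF \<epsilon>0 d(1)] by (auto simp: eventually_sequentially)
    have "\<bar>(LINT x|?M. b a n x * F x) - F a\<bar> < r" if "N \<le> n" for n
    proof -
      have "(LINT x|?M. b a n x * F x) - F a = (LINT x|?M. b a n x * F x) - (LINT x|?M. b a n x * F a)"
        using b1[of n] by simp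
      also have "\<dots> = (LINT x|?M. b a n x * F x - b a n x * F a)"
        using Fi bi by (subst Bochner_Integration.integral_diff) auto
      also have "\<bar>\<dots>\<bar> \<le> (LINT x|?M. b a n x * (r / 2))"
      proof (rule integral_abs_bound_integral)
        fix x
        have "b a n x * \<bar>F x - F a\<bar> \<le> b a n x * (r / 2)"
        proof (cases "b a n x = 0")
          case False
          then have "(x - a) / \<epsilon> n \<in> {0..1}" using \<beta>(3) by (auto simp: b_def)
          then have "\<bar>x - a\<bar> \<le> \<epsilon> n" using \<epsilon>(1)[of n] by (auto simp: divide_le_eq zero_le_divide_iff)
          then have "\<bar>F x - F a\<bar> < r / 2" using d(2) N[OF \<open>N \<le> n\<close>] by simp
          then show ?thesis using \<beta>(2) \<epsilon>(1)[of n] by (intro mult_left_mono) (auto simp: b_def)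
        qed simp
        moreover have "0 \<le> b a n x" using \<beta>(2) \<epsilon>(1)[of n] by (simp add: b_def)
        ultimately show "\<bar>b a n x * F x - b a n x * F a\<bar> \<le> b a n x * (r / 2)"
          by (simp add: abs_mult flip: right_diff_distrib)
      qed (use Fi bi in auto)
      also have "\<dots> = r / 2" using b1[of n] by simp
      finally show ?thesis using \<open>0 < r\<close> by simp
    qed
    then show "\<exists>N. \<forall>n\<ge>N. norm ((LINT x|?M. b a n x * F x) - F a) < r" by auto
  qed
  have "(\<lambda>n. LINT x|?M. deriv (\<phi> n) x * F x) \<longlonglongrightarrow> F \<tau> - F t"
  proof -
    have "(LINT x|?M. deriv (\<phi> n) x * F x) = (LINT x|?M. b \<tau> n x * F x) - (LINT x|?M. b t n x * F x)" for n
      unfolding \<phi>' left_diff_distrib by (rule Bochner_Integration.integral_diff[OF Fi Fi])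
    then show ?thesis using approx[of \<tau>] approx[of t] \<tau>t e0 by (auto intro!: tendsto_diff)
  qed
  moreover have "(\<lambda>n. LINT x|?M. \<phi> n x * G x) \<longlonglongrightarrow> (LINT x|?M. indicator {\<tau><..<t} x * G x)"
  proof (rule integral_dominated_convergence[where w = "\<lambda>x. \<bar>G x\<bar>"])
    have \<phi>c: "continuous_on X (\<phi> n)" for X n
      unfolding \<phi>_def
      by (intro continuous_at_imp_continuous_on ballI DERIV_isCont[OF DERIV_diff[OF dB[OF \<beta>(1)] dB[OF \<beta>(1)]]])
    have [measurable]: "\<phi> n \<in> borel_measurable ?M" for n
      using continuous_integrable_Ioo[OF \<phi>c] by (rule borel_measurable_integrable)
    have [measurable]: "G \<in> borel_measurable ?M" using G by simp
    show "(\<lambda>x. \<phi> n x * G x) \<in> borel_measurable ?M" for n by measurable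
    have "indicator {\<tau><..<t} \<in> borel_measurable ?M"
      by (intro measurable_restrict_space1 borel_measurable_indicator) simp
    then show "(\<lambda>x. indicator {\<tau><..<t} x * G x) \<in> borel_measurable ?M" by measurable
    show "integrable ?M (\<lambda>x. \<bar>G x\<bar>)" using G by simp
    show "AE x in ?M. norm (\<phi> n x * G x) \<le> \<bar>G x\<bar>" for n
    proof (rule AE_I2)
      fix x
      have "\<bar>\<phi> n x\<bar> \<le> 1"
        using B(3,4)[of "(x - \<tau>) / \<epsilon> n"] B(3,4)[of "(x - t) / \<epsilon> n"] by (simp add: \<phi>_def abs_le_iff)
      then show "norm (\<phi> n x * G x) \<le> \<bar>G x\<bar>" by (simp add: abs_mult mult_left_le_one_le)
    qed
    have stepB: "(\<lambda>n. B ((x - a) / \<epsilon> n)) \<longlonglongrightarrow> (if a < x then 1 else 0)" for x a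
    proof (cases "a < x")
      case True
      then have "eventually (\<lambda>n. \<epsilon> n < x - a) sequentially" by (intro order_tendstoD(2)[OF \<epsilon>0]) simp
      then have "eventually (\<lambda>n. B ((x - a) / \<epsilon> n) = 1) sequentially"
        by eventually_elim (use \<epsilon>(1) in \<open>auto intro!: B(2) simp: le_divide_eq\<close>)
      then show ?thesis using True by (simp add: tendsto_eventually)
    next
      case False
      then have "B ((x - a) / \<epsilon> n) = 0" for n using \<epsilon>(1)[of n] by (intro B(1) divide_nonpos_pos) auto
      then show ?thesis using False by simp
    qed
    have "AE x in lebesgue. x \<noteq> t" by (rule AE_completion[OF AE_lborel_singleton])
    then have "AE x in ?M. x \<noteq> t"
      by (simp add: AE_restrict_space_iff) (elim eventually_mono, simp)
    then show "AE x in ?M. (\<lambda>n. \<phi> n x * G x) \<longlonglongrightarrow> indicator {\<tau><..<t} x * G x"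
    proof eventually_elim
      case (elim x)
      have "(\<lambda>n. \<phi> n x) \<longlonglongrightarrow> (if \<tau> < x then 1 else 0) - (if t < x then 1 else 0)"
        unfolding \<phi>_def by (intro tendsto_diff stepB)
      also have "(if \<tau> < x then 1 else 0) - (if t < x then 1 else 0) = (indicator {\<tau><..<t} x :: real)"
        using \<tau>t elim by (auto simp: indicator_def)
      finally show ?case by (intro tendsto_mult) auto
    qed
  qed
  then have "(\<lambda>n. LINT x|?M. deriv (\<phi> n) x * F x) \<longlonglongrightarrow> - (LINT x|?M. indicator {\<tau><..<t} x * G x)"
    unfolding weak[OF test] by (intro tendsto_minus)
  ultimately have "F \<tau> - F t = - (LINT x|?M. indicator {\<tau><..<t} x * G x)"
    by (rule LIMSEQ_unique)
  also have "(LINT x|?M. indicator {\<tau><..<t} x * G x) = integral {\<tau>..t} G"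
  proof -
    have "(LINT x|?M. indicator {\<tau><..<t} x * G x) = (LINT x|lebesgue. indicator {0<..<T} x * (indicator {\<tau><..<t} x * G x))"
      by (subst integral_restrict_space) auto
    also have "\<dots> = (LINT x|lebesgue. indicator {\<tau><..<t} x * G x)"
      using \<tau>t by (intro Bochner_Integration.integral_cong) (auto simp: indicator_def)
    also have "\<dots> = (LINT x|lebesgue_on {\<tau><..<t}. G x)"
      by (subst integral_restrict_space) auto
    also have "\<dots> = integral {\<tau>..t} G"
      using time_integral_eq[OF G, of \<tau> t] \<tau>t by simp
    finally show ?thesis .
  qed
  finally show ?thesis by simp
qed

section \<open>Bounded truncations and their primitives\<close>

definition ramp :: "real \<Rightarrow> real \<Rightarrow> real \<Rightarrow> real" where
  "ramp k h x = min 1 (max 0 ((x - k) / (h - k)))"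

text \<open>
  This is the primitive of \<open>ramp k h\<close> that vanishes at \<open>k\<close>, written as the maximum over \<open>\<theta>\<close> in the unit
  interval of \<open>\<theta> * (x - k) - \<theta>\<^sup>2 * (h - k) / 2\<close>, which is attained at \<open>\<theta> = ramp k h x\<close>. In this form
  convexity and the bounds below are instances of \<open>ramp_primitive_ge\<close>.
\<close>
definition ramp_primitive :: "real \<Rightarrow> real \<Rightarrow> real \<Rightarrow> real" where
  "ramp_primitive k h x = ramp k h x * (x - k) - (ramp k h x)\<^sup>2 * (h - k) / 2"

lemma ramp_bounds [simp]: "0 \<le> ramp k h x" "ramp k h x \<le> 1"
  by (auto simp: ramp_def)

lemma ramp_zero: "k < h \<Longrightarrow> x \<le> k \<Longrightarrow> ramp k h x = 0"
  by (auto simp: ramp_def divide_nonpos_pos)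

lemma mono_ramp: "k < h \<Longrightarrow> mono (ramp k h)"
  unfolding ramp_def by (intro monoI min.mono max.mono divide_right_mono) auto

lemma ramp_lipschitz:
  assumes "k < h" shows "\<bar>ramp k h a - ramp k h b\<bar> \<le> 1 / (h - k) * \<bar>a - b\<bar>"
proof -
  have "\<bar>min 1 (max 0 x) - min 1 (max 0 y)\<bar> \<le> \<bar>x - y\<bar>" for x y :: real
    by linarith
  then have "\<bar>ramp k h a - ramp k h b\<bar> \<le> \<bar>(a - k) / (h - k) - (b - k) / (h - k)\<bar>"
    unfolding ramp_def .
  also have "\<dots> = \<bar>(a - b) / (h - k)\<bar>" by (simp flip: diff_divide_distrib)
  also have "\<dots> = 1 / (h - k) * \<bar>a - b\<bar>" using assms by (simp add: abs_divide)
  finally show ?thesis .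
qed

lemma ramp_primitive_ge:
  assumes "k < h" "0 \<le> \<theta>" "\<theta> \<le> 1"
  shows "\<theta> * (x - k) - \<theta>\<^sup>2 * (h - k) / 2 \<le> ramp_primitive k h x"
proof -
  define d y where "d = h - k" and "y = (x - k) / d"
  have d: "0 < d" using assms by (simp add: d_def)
  have xk: "x - k = y * d" using d by (simp add: y_def)
  define \<tau> where "\<tau> = ramp k h x"
  have \<tau>: "\<tau> = min 1 (max 0 y)" by (simp add: \<tau>_def ramp_def y_def d_def)
  have "0 \<le> (\<tau> - \<theta>) * (y - (\<tau> + \<theta>) / 2)"
  proof -
    consider "y < 0" | "0 \<le> y" "y \<le> 1" | "1 < y" by linarith
    then show ?thesis
    proof cases
      case 1
      then have "\<tau> = 0" using \<tau> by simp
      then show ?thesis using 1 assms(2) by (intro mult_nonpos_nonpos) auto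
    next
      case 2
      then have eq: "(\<tau> - \<theta>) * (y - (\<tau> + \<theta>) / 2) = (y - \<theta>)\<^sup>2 / 2"
        using \<tau> by (simp add: power2_eq_square field_simps)
      show ?thesis unfolding eq by simp
    next
      case 3
      then show ?thesis using assms \<tau> by (auto intro!: mult_nonneg_nonneg)
    qed
  qed
  then have "0 \<le> (\<tau> - \<theta>) * (y - (\<tau> + \<theta>) / 2) * d" using d by simp
  also have "\<dots> = (\<tau> * (x - k) - \<tau>\<^sup>2 * d / 2) - (\<theta> * (x - k) - \<theta>\<^sup>2 * d / 2)"
    unfolding xk by (simp add: power2_eq_square field_simps)
  finally show ?thesis by (simp add: ramp_primitive_def \<tau>_def d_def)
qed

lemma ramp_primitive_subgradient:
  assumes "k < h"
  shows "ramp_primitive k h y - ramp_primitive k h x \<le> ramp k h y * (y - x)"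
  using ramp_primitive_ge[OF assms, of "ramp k h y" x]
  by (simp add: ramp_primitive_def[of k h y] algebra_simps)

lemma ramp_primitive_nonneg: "k < h \<Longrightarrow> 0 \<le> ramp_primitive k h x"
  using ramp_primitive_ge[of k h 0 x] by simp

lemma ramp_primitive_zero: "k < h \<Longrightarrow> x \<le> k \<Longrightarrow> ramp_primitive k h x = 0"
  by (simp add: ramp_primitive_def ramp_zero)

lemma ramp_primitive_le: "k < h \<Longrightarrow> ramp_primitive k h x \<le> (x - k) * ramp k h x"
  by (simp add: ramp_primitive_def)

lemma ramp_primitive_ge_above: "k < h \<Longrightarrow> h \<le> x \<Longrightarrow> (h - k) / 2 \<le> ramp_primitive k h x"
  using ramp_primitive_ge[of k h 1 x] by (simp add: field_simps)

lemma ramp_primitive_lipschitz: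
  assumes "k < h"
  shows "\<bar>ramp_primitive k h y - ramp_primitive k h x\<bar> \<le> \<bar>y - x\<bar>"
proof -
  have *: "ramp_primitive k h y - ramp_primitive k h x \<le> \<bar>y - x\<bar>" for x y
  proof -
    have "ramp k h y * (y - x) \<le> \<bar>ramp k h y * (y - x)\<bar>" by simp
    also have "\<dots> \<le> \<bar>y - x\<bar>" by (simp add: abs_mult mult_left_le_one_le)
    finally show ?thesis using ramp_primitive_subgradient[OF assms, of y x] by linarith
  qed
  show ?thesis using *[of y x] *[of x y] by (simp add: abs_le_iff abs_minus_commute)
qed

lemma borel_measurable_ramp [measurable]: "ramp k h \<in> borel_measurable borel"
  unfolding ramp_def by measurable

lemma borel_measurable_ramp_primitive [measurable]: "ramp_primitive k h \<in> borel_measurable borel"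
  unfolding ramp_primitive_def by measurable

section \<open>Pairings in Lebesgue spaces\<close>

lemma integral_mult_Lp_norm_2:
  assumes "d \<in> Lp_space S 2" "v \<in> Lp_space S 2"
  shows "integrable (lebesgue_on S) (\<lambda>x. d x * v x)"
    and "(LINT x|lebesgue_on S. \<bar>d x * v x\<bar>) \<le> Lp_norm S 2 d * Lp_norm S 2 v"
proof -
  let ?M = "lebesgue_on S"
  have [measurable]: "d \<in> borel_measurable ?M" "v \<in> borel_measurable ?M"
    and sq: "integrable ?M (\<lambda>x. (d x)\<^sup>2)" "integrable ?M (\<lambda>x. (v x)\<^sup>2)"
    using assms by (auto simp: Lp_space_2_iff)
  have *: "\<bar>a * b\<bar> \<le> a\<^sup>2 + b\<^sup>2" for a b :: real
    using sum_squares_bound[of "\<bar>a\<bar>" "\<bar>b\<bar>"] abs_ge_zero[of "a * b"] unfolding abs_mult power2_abs by linarith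
  show i: "integrable ?M (\<lambda>x. d x * v x)"
    by (rule Bochner_Integration.integrable_bound[OF Bochner_Integration.integrable_add[OF sq]])
       (use * in \<open>auto intro!: order_trans[OF * abs_ge_self]\<close>)
  have "(\<integral>\<^sup>+x. ennreal \<bar>d x\<bar> * ennreal \<bar>v x\<bar> \<partial>?M) = ennreal (LINT x|?M. \<bar>d x * v x\<bar>)"
    using nn_integral_eq_integral[OF integrable_abs[OF i]] by (simp add: abs_mult ennreal_mult)
  then have "ennreal ((LINT x|?M. \<bar>d x * v x\<bar>)\<^sup>2) = (\<integral>\<^sup>+x. ennreal \<bar>d x\<bar> * ennreal \<bar>v x\<bar> \<partial>?M)\<^sup>2"
    by (simp add: ennreal_power integral_nonneg_AE)
  also have "\<dots> \<le> (\<integral>\<^sup>+x. (ennreal \<bar>d x\<bar>)\<^sup>2 \<partial>?M) * (\<integral>\<^sup>+x. (ennreal \<bar>v x\<bar>)\<^sup>2 \<partial>?M)"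
    by (rule Cauchy_Schwarz_nn_integral) measurable
  also have "\<dots> = ennreal ((LINT x|?M. (d x)\<^sup>2) * (LINT x|?M. (v x)\<^sup>2))"
    using sq by (simp add: ennreal_power nn_integral_eq_integral ennreal_mult integral_nonneg_AE)
  finally have "(LINT x|?M. \<bar>d x * v x\<bar>)\<^sup>2 \<le> (LINT x|?M. (d x)\<^sup>2) * (LINT x|?M. (v x)\<^sup>2)"
    by (simp add: integral_nonneg_AE)
  then have "(LINT x|?M. \<bar>d x * v x\<bar>)\<^sup>2 \<le> (Lp_norm S 2 d * Lp_norm S 2 v)\<^sup>2"
    by (simp add: Lp_norm_2 power_mult_distrib integral_nonneg_AE)
  then show "(LINT x|?M. \<bar>d x * v x\<bar>) \<le> Lp_norm S 2 d * Lp_norm S 2 v"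
    by (rule power2_le_imp_le) (auto simp: Lp_norm_2 integral_nonneg_AE)
qed

lemma Lp_space_2_diff:
  assumes "f \<in> Lp_space S 2" "g \<in> Lp_space S 2"
  shows "(\<lambda>x. f x - g x) \<in> Lp_space S 2"
proof -
  have [measurable]: "f \<in> borel_measurable (lebesgue_on S)" "g \<in> borel_measurable (lebesgue_on S)"
    and sq: "integrable (lebesgue_on S) (\<lambda>x. (f x)\<^sup>2)" "integrable (lebesgue_on S) (\<lambda>x. (g x)\<^sup>2)"
    using assms by (auto simp: Lp_space_2_iff)
  have "integrable (lebesgue_on S) (\<lambda>x. (f x)\<^sup>2 + (g x)\<^sup>2 - 2 * (f x * g x))"
    using sq integral_mult_Lp_norm_2(1)[OF assms] by simp
  also have "(\<lambda>x. (f x)\<^sup>2 + (g x)\<^sup>2 - 2 * (f x * g x)) = (\<lambda>x. (f x - g x)\<^sup>2)"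
    by (simp add: power2_diff algebra_simps)
  finally show ?thesis by (simp add: Lp_space_2_iff)
qed

lemma Lp_norm_powr:
  assumes "0 < p" shows "Lp_norm S p f powr p = (LINT x|lebesgue_on S. \<bar>f x\<bar> powr p)"
  using assms by (simp add: Lp_norm_def powr_powr integral_nonneg_AE)

text \<open>
  Since \<open>v\<close> takes values in the unit interval, it is dominated by the indicator of its support, and the
  exponent \<open>1 - 1 / p\<close> is that of Hoelder's inequality for \<open>z\<close> against this indicator.
\<close>
lemma functional_of_le_support:
  fixes z v :: "'a::euclidean_space \<Rightarrow> real"
  assumes z: "z \<in> Lp_space S p" and "1 \<le> p" and v: "v \<in> borel_measurable (lebesgue_on S)"
    "\<And>x. 0 \<le> v x" "\<And>x. v x \<le> 1"
    and "0 < a" and small: "emeasure (lebesgue_on S) {x \<in> S. v x \<noteq> 0} \<le> ennreal a"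
  shows "functional_of S z v \<le> 2 * Lp_norm S p z * a powr (1 - 1 / p)"
proof (rule le_of_young_split[OF \<open>0 < a\<close>])
  let ?M = "lebesgue_on S"
  let ?A = "{x \<in> S. v x \<noteq> 0}"
  have [measurable]: "z \<in> borel_measurable ?M" "v \<in> borel_measurable ?M"
    and zp: "integrable ?M (\<lambda>x. \<bar>z x\<bar> powr p)"
    using z v by (auto simp: Lp_space_def)
  have "{x \<in> space ?M. v x \<noteq> 0} \<in> sets ?M" by measurable
  then have A: "?A \<in> sets ?M" by simp
  have fin: "emeasure ?M ?A < \<infinity>" using small by (rule le_less_trans) simp
  then have iA: "integrable ?M (indicator ?A :: 'a \<Rightarrow> real)" using A by simp
  have "measure ?M ?A \<le> a" using small \<open>0 < a\<close> unfolding measure_def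
    by (metis enn2real_ennreal enn2real_mono ennreal_less_top less_imp_le)
  fix c :: real assume "0 < c"
  have le: "\<bar>z x * v x\<bar> \<le> c * indicator ?A x + c powr (1 - p) * \<bar>z x\<bar> powr p" if "x \<in> S" for x
  proof (cases "v x = 0")
    case False
    have "\<bar>z x * v x\<bar> \<le> \<bar>z x\<bar>" using v(2,3)[of x] by (simp add: abs_mult mult_left_le)
    also have "\<dots> \<le> c + c powr (1 - p) * \<bar>z x\<bar> powr p"
      by (rule young_split) (use \<open>0 < c\<close> \<open>1 \<le> p\<close> in auto)
    finally show ?thesis using False that by simp
  qed simp
  have i: "integrable ?M (\<lambda>x. c * indicator ?A x + c powr (1 - p) * \<bar>z x\<bar> powr p)"
    using iA zp by simp
  have izv: "integrable ?M (\<lambda>x. z x * v x)"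
    by (rule Bochner_Integration.integrable_bound[OF i]) (use le in \<open>auto intro!: AE_I2 order_trans[OF le abs_ge_self]\<close>)
  have "functional_of S z v \<le> (LINT x|?M. c * indicator ?A x + c powr (1 - p) * \<bar>z x\<bar> powr p)"
    unfolding functional_of_def by (rule integral_mono[OF izv i]) (use le in \<open>auto intro: order_trans[OF abs_ge_self le]\<close>)
  also have "\<dots> = c * measure ?M ?A + c powr (1 - p) * Lp_norm S p z powr p"
    using iA zp A \<open>1 \<le> p\<close> sets.sets_into_space[OF A] by (simp add: Lp_norm_powr Int_absorb1 Int_absorb2)
  also have "\<dots> \<le> c * a + c powr (1 - p) * Lp_norm S p z powr p"
    using \<open>measure ?M ?A \<le> a\<close> \<open>0 < c\<close> by simp
  finally show "functional_of S z v \<le> c * a + c powr (1 - p) * Lp_norm S p z powr p" .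
qed (use \<open>1 \<le> p\<close> in \<open>auto simp: Lp_norm_def\<close>)

section \<open>Functions that vanish outside the domain\<close>

lemma W0_spaceD: "u \<in> W0_space s \<Omega> \<Longrightarrow> u \<in> W_space s"
  by (simp add: W0_space_def)

lemma W0_space_diff: "u \<in> W0_space s \<Omega> \<Longrightarrow> v \<in> W0_space s \<Omega> \<Longrightarrow> (\<lambda>x. u x - v x) \<in> W0_space s \<Omega>"
  using W_space_diff(1)[of u s v] by (auto simp: W0_space_def elim!: eventually_elim2)

lemma W0_space_lipschitz:
  assumes "u \<in> W0_space s \<Omega>" "\<And>a b. \<bar>\<psi> a - \<psi> b\<bar> \<le> L * \<bar>a - b\<bar>" "\<psi> 0 = 0"
  shows "(\<lambda>x. \<psi> (u x)) \<in> W0_space s \<Omega>"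
  using W_space_lipschitz(1)[of u s \<psi> L] assms by (auto simp: W0_space_def elim!: eventually_mono)

lemma W_space_imp_Lp_space:
  fixes u :: "'a::euclidean_space \<Rightarrow> real"
  assumes "u \<in> W_space s" "S \<in> sets lebesgue" shows "u \<in> Lp_space S 2"
proof -
  have [measurable]: "u \<in> borel_measurable lebesgue" and i: "integrable lebesgue (\<lambda>x. (u x)\<^sup>2)"
    using assms by (auto simp: W_space_iff)
  have "u \<in> borel_measurable (lebesgue_on S)" by (rule measurable_restrict_space1) measurable
  moreover have "integrable (lebesgue_on S) (\<lambda>x. (u x)\<^sup>2)"
    using integrable_mult_indicator[OF assms(2) i] assms(2) by (simp add: integrable_restrict_space)
  ultimately show ?thesis by (simp add: Lp_space_2_iff)
qed

lemma AE_lebesgue_on_iff: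
  "S \<in> sets lebesgue \<Longrightarrow> (AE x in lebesgue_on S. P x) \<longleftrightarrow> (AE x in lebesgue. x \<in> S \<longrightarrow> P x)"
  by (simp add: AE_restrict_space_iff)

section \<open>Continuous paths and evolutions\<close>

locale L2_path =
  fixes \<Omega> :: "'a::euclidean_space set" and T :: real and U :: "real \<Rightarrow> 'a \<Rightarrow> real"
  assumes \<Omega>: "\<Omega> \<in> lmeasurable" and T: "0 < T"
    and U_L2: "\<And>t. t \<in> {0..T} \<Longrightarrow> U t \<in> Lp_space \<Omega> 2"
    and U_cont: "\<And>t. t \<in> {0..T} \<Longrightarrow>
      ((\<lambda>\<tau>. Lp_norm \<Omega> 2 (\<lambda>x. U \<tau> x - U t x)) \<longlongrightarrow> 0) (at t within {0..T})"
begin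

lemma \<Omega>_sets: "\<Omega> \<in> sets lebesgue"
  using \<Omega> by auto

lemma finite_measure_\<Omega>: "finite_measure (lebesgue_on \<Omega>)"
  using \<Omega> by (rule finite_measure_lebesgue_on)

lemma const_Lp_space: "(\<lambda>x. c) \<in> Lp_space \<Omega> 2"
  using finite_measure.integrable_const[OF finite_measure_\<Omega>] by (simp add: Lp_space_2_iff)

lemma U_integrable:
  assumes "t \<in> {0..T}" shows "integrable (lebesgue_on \<Omega>) (U t)"
  using integral_mult_Lp_norm_2(1)[OF U_L2[OF assms] const_Lp_space[of 1]] by simp

lemma superlevel_sets:
  assumes "t \<in> {0..T}" shows "{x \<in> \<Omega>. k < U t x} \<in> sets lebesgue"
proof -
  have "U t \<in> borel_measurable (lebesgue_on \<Omega>)" using U_integrable[OF assms] by simp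
  then have "{x \<in> space (lebesgue_on \<Omega>). k < U t x} \<in> sets (lebesgue_on \<Omega>)" by measurable
  then show ?thesis using \<Omega>_sets by (simp add: sets_restrict_space_iff)
qed

lemma continuous_if_L2_controlled:
  fixes \<Phi> :: "real \<Rightarrow> real"
  assumes bound: "\<And>\<tau> t. \<tau> \<in> {0..T} \<Longrightarrow> t \<in> {0..T} \<Longrightarrow>
    \<bar>\<Phi> \<tau> - \<Phi> t\<bar> \<le> Lp_norm \<Omega> 2 (\<lambda>x. U \<tau> x - U t x) * c"
  shows "continuous_on {0..T} \<Phi>"
  unfolding continuous_on_def
proof
  fix t assume t: "t \<in> {0..T}"
  have "((\<lambda>\<tau>. \<Phi> \<tau> - \<Phi> t) \<longlongrightarrow> 0) (at t within {0..T})"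
  proof (rule Lim_null_comparison)
    show "eventually (\<lambda>\<tau>. norm (\<Phi> \<tau> - \<Phi> t) \<le> Lp_norm \<Omega> 2 (\<lambda>x. U \<tau> x - U t x) * c) (at t within {0..T})"
      using bound t by (auto simp: eventually_at_topological intro!: exI[of _ UNIV])
    show "((\<lambda>\<tau>. Lp_norm \<Omega> 2 (\<lambda>x. U \<tau> x - U t x) * c) \<longlongrightarrow> 0) (at t within {0..T})"
      using tendsto_mult_right[OF U_cont[OF t], of c] by simp
  qed
  then show "(\<Phi> \<longlongrightarrow> \<Phi> t) (at t within {0..T})" by (simp add: LIM_zero_iff)
qed

lemma pairing_continuous:
  assumes "v \<in> Lp_space \<Omega> 2"
  shows "continuous_on {0..T} (\<lambda>t. LINT x|lebesgue_on \<Omega>. U t x * v x)"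
proof (rule continuous_if_L2_controlled)
  fix \<tau> t assume \<tau>: "\<tau> \<in> {0..T}" and t: "t \<in> {0..T}"
  have "(LINT x|lebesgue_on \<Omega>. U \<tau> x * v x) - (LINT x|lebesgue_on \<Omega>. U t x * v x)
      = (LINT x|lebesgue_on \<Omega>. (U \<tau> x - U t x) * v x)"
    using integral_mult_Lp_norm_2(1)[OF U_L2[OF \<tau>] assms] integral_mult_Lp_norm_2(1)[OF U_L2[OF t] assms]
    by (simp add: left_diff_distrib)
  also have "\<bar>\<dots>\<bar> \<le> (LINT x|lebesgue_on \<Omega>. \<bar>(U \<tau> x - U t x) * v x\<bar>)"
    by (rule integral_abs_bound)
  also have "\<dots> \<le> Lp_norm \<Omega> 2 (\<lambda>x. U \<tau> x - U t x) * Lp_norm \<Omega> 2 v"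
    by (rule integral_mult_Lp_norm_2(2)[OF Lp_space_2_diff[OF U_L2[OF \<tau>] U_L2[OF t]] assms])
  finally show "\<bar>(LINT x|lebesgue_on \<Omega>. U \<tau> x * v x) - (LINT x|lebesgue_on \<Omega>. U t x * v x)\<bar>
    \<le> Lp_norm \<Omega> 2 (\<lambda>x. U \<tau> x - U t x) * Lp_norm \<Omega> 2 v" .
qed

end

text \<open>
  The surplus exponent of the level set iteration. It is positive exactly if
  \<open>N / (2 * p * s) + 1 / r < 1\<close>.
\<close>
definition smoothing_gain :: "nat \<Rightarrow> real \<Rightarrow> real \<Rightarrow> real \<Rightarrow> real" where
  "smoothing_gain N s p r = 2 * s / real N * (1 - 1 / r) - 1 / p"

definition level_set_const :: "nat \<Rightarrow> real \<Rightarrow> real \<Rightarrow> real" where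
  "level_set_const N s r = 8 * (C_Ns N s / 2 * faber_krahn_const N s) powr (1 / r - 1)"

definition sup_bound_const :: "nat \<Rightarrow> real \<Rightarrow> real \<Rightarrow> real \<Rightarrow> real \<Rightarrow> real" where
  "sup_bound_const N s p r V = 2 * level_set_const N s r *
     (V + 1) powr smoothing_gain N s p r * 2 powr (1 / smoothing_gain N s p r)"

text \<open>
  What the estimates use of a weak solution, in a form that is invariant under a change of sign. The
  derivative \<open>g\<close> enters through increments of the continuous representative \<open>U\<close>, which exist for each
  fixed test function and all pairs of interior times; the test function may therefore be chosen depending on
  one of the two times. The equation itself holds only off a null set of times that depends on the test
  function.
\<close>
locale fractional_evolution = L2_path \<Omega> T U
  for \<Omega> :: "'a::euclidean_space set" and T :: real and U :: "real \<Rightarrow> 'a \<Rightarrow> real" +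
  fixes s p r :: real and u z :: "real \<Rightarrow> 'a \<Rightarrow> real" and g :: "real \<Rightarrow> ('a \<Rightarrow> real) \<Rightarrow> real"
  assumes s: "0 < s" "s < 1" and pr: "1 \<le> p" "1 \<le> r"
    and u: "u \<in> Bochner_space T 2 (W0_space s \<Omega>) (W0_norm s)"
    and U_eq_u: "AE t in lebesgue_on {0<..<T}. AE x in lebesgue_on \<Omega>. U t x = u t x"
    and U_initial: "AE x in lebesgue_on \<Omega>. U 0 x = 0"
    and g_integrable: "\<And>v. v \<in> W0_space s \<Omega> \<Longrightarrow> integrable (lebesgue_on {0<..<T}) (\<lambda>t. g t v)"
    and g_increment: "\<And>v \<tau> t. v \<in> W0_space s \<Omega> \<Longrightarrow> 0 < \<tau> \<Longrightarrow> \<tau> < t \<Longrightarrow> t < T \<Longrightarrow>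
      (LINT x|lebesgue_on \<Omega>. (U t x - U \<tau> x) * v x) = integral {\<tau>..t} (\<lambda>\<sigma>. g \<sigma> v)"
    and equation: "\<And>v. v \<in> W0_space s \<Omega> \<Longrightarrow> AE t in lebesgue_on {0<..<T}.
      g t v + energy_form s (u t) v = functional_of \<Omega> (z t) v"
    and z_Lp: "AE t in lebesgue_on {0<..<T}. z t \<in> Lp_space \<Omega> p"
    and z_Lr: "integrable (lebesgue_on {0<..<T}) (\<lambda>t. Lp_norm \<Omega> p (z t) powr r)"
begin

section \<open>The truncated energy estimate\<close>

definition excess :: "real \<Rightarrow> real \<Rightarrow> real \<Rightarrow> real" where
  "excess k h t = (LINT x|lebesgue_on \<Omega>. ramp_primitive k h (U t x))"

lemma ramp_primitive_U_integrable:
  assumes "k < h" "t \<in> {0..T}"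
  shows "integrable (lebesgue_on \<Omega>) (\<lambda>x. ramp_primitive k h (U t x))"
proof (rule Bochner_Integration.integrable_bound)
  show "integrable (lebesgue_on \<Omega>) (\<lambda>x. \<bar>ramp_primitive k h 0\<bar> + \<bar>U t x\<bar>)"
    by (intro Bochner_Integration.integrable_add integrable_abs U_integrable assms
        finite_measure.integrable_const finite_measure_\<Omega>)
  have "U t \<in> borel_measurable (lebesgue_on \<Omega>)" using U_integrable[OF assms(2)] by simp
  then show "(\<lambda>x. ramp_primitive k h (U t x)) \<in> borel_measurable (lebesgue_on \<Omega>)" by measurable
  show "AE x in lebesgue_on \<Omega>. norm (ramp_primitive k h (U t x)) \<le> norm (\<bar>ramp_primitive k h 0\<bar> + \<bar>U t x\<bar>)"
  proof (rule AE_I2)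
    fix x
    show "norm (ramp_primitive k h (U t x)) \<le> norm (\<bar>ramp_primitive k h 0\<bar> + \<bar>U t x\<bar>)"
      using ramp_primitive_lipschitz[OF assms(1), of "U t x" 0] by simp
  qed
qed

lemma excess_initial: "0 \<le> k \<Longrightarrow> k < h \<Longrightarrow> excess k h 0 = 0"
  unfolding excess_def using U_initial
  by (intro integral_eq_zero_AE) (auto elim!: eventually_mono simp: ramp_primitive_zero)

lemma excess_continuous:
  assumes "k < h" shows "continuous_on {0..T} (excess k h)"
proof (rule continuous_if_L2_controlled)
  fix \<tau> t assume \<tau>: "\<tau> \<in> {0..T}" and t: "t \<in> {0..T}"
  have "excess k h \<tau> - excess k h t = (LINT x|lebesgue_on \<Omega>. ramp_primitive k h (U \<tau> x) - ramp_primitive k h (U t x))"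
    unfolding excess_def using ramp_primitive_U_integrable[OF assms] \<tau> t by simp
  also have "\<bar>\<dots>\<bar> \<le> (LINT x|lebesgue_on \<Omega>. \<bar>(U \<tau> x - U t x) * 1\<bar>)"
    using ramp_primitive_U_integrable[OF assms] ramp_primitive_lipschitz[OF assms] U_integrable \<tau> t
    by (intro integral_abs_bound_integral) auto
  also have "\<dots> \<le> Lp_norm \<Omega> 2 (\<lambda>x. U \<tau> x - U t x) * Lp_norm \<Omega> 2 (\<lambda>x. 1)"
    by (rule integral_mult_Lp_norm_2(2)[OF Lp_space_2_diff[OF U_L2[OF \<tau>] U_L2[OF t]] const_Lp_space])
  finally show "\<bar>excess k h \<tau> - excess k h t\<bar>
    \<le> Lp_norm \<Omega> 2 (\<lambda>x. U \<tau> x - U t x) * Lp_norm \<Omega> 2 (\<lambda>x. 1)" .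
qed

definition source :: "real \<Rightarrow> real" where
  "source t = Lp_norm \<Omega> p (z t)"

lemma source_nonneg [simp]: "0 \<le> source t"
  by (simp add: source_def Lp_norm_def)

lemma source_powr_integrable: "integrable (lebesgue_on {0<..<T}) (\<lambda>t. source t powr r)"
  using z_Lr by (simp add: source_def)

lemma source_integrable: "integrable (lebesgue_on {0<..<T}) source"
proof (rule Bochner_Integration.integrable_bound)
  show "integrable (lebesgue_on {0<..<T}) (\<lambda>t. 1 + source t powr r)"
    using source_powr_integrable continuous_integrable_Ioo[of 0 T "\<lambda>_. 1"] by simp
  have "(\<lambda>t. (source t powr r) powr (1 / r)) \<in> borel_measurable (lebesgue_on {0<..<T})"
    using source_powr_integrable by measurable
  also have "(\<lambda>t. (source t powr r) powr (1 / r)) = source"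
    using pr by (auto simp: powr_powr)
  finally show "source \<in> borel_measurable (lebesgue_on {0<..<T})" .
  show "AE t in lebesgue_on {0<..<T}. norm (source t) \<le> norm (1 + source t powr r)"
    using young_split[OF source_nonneg, of 1 r] pr by (intro AE_I2) simp
qed

definition decay :: "real \<Rightarrow> real" where
  "decay a = C_Ns DIM('a) s / 2 * faber_krahn_const DIM('a) s * a powr (- (2 * s / real DIM('a)))"

lemma AE_u_W0: "AE t in lebesgue_on {0<..<T}. u t \<in> W0_space s \<Omega>"
  using u unfolding Bochner_space_def strongly_measurable_def by (auto elim: eventually_mono)

text \<open>
  One time step of the energy estimate, with the test function \<open>v\<close> frozen at the later time \<open>t\<close>. The
  primitive of the ramp is convex, so its increment is at most its slope at the later time times the
  increment of \<open>U\<close>. By the equation this is an integral over \<open>\<sigma>\<close> in \<open>{\<tau>..t}\<close> of the source, which sees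
  only the set \<open>{k < u t}\<close>, minus the energy of \<open>u \<sigma>\<close> against \<open>v\<close>. The latter differs from the coercive
  energy of \<open>u t\<close> against \<open>v\<close> by a term in \<open>u \<sigma> - u t\<close>.
\<close>
lemma ramp_testing:
  assumes k: "0 \<le> k" "k < h" and "0 < a" and \<tau>t: "0 < \<tau>" "\<tau> < t" "t < T" and "0 < \<delta>"
    and ut: "u t \<in> W0_space s \<Omega>" "AE x in lebesgue_on \<Omega>. U t x = u t x"
    and small: "emeasure lebesgue {x \<in> \<Omega>. k < U t x} \<le> ennreal a"
  defines "v \<equiv> \<lambda>x. ramp k h (u t x)"
  shows "v \<in> W0_space s \<Omega>" and "excess k h t - excess k h \<tau> \<le> integral {\<tau>..t} (\<lambda>\<sigma>. g \<sigma> v)"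
    and "AE \<sigma> in lebesgue_on {0<..<T}. g \<sigma> v \<le> 2 * a powr (1 - 1 / p) * source \<sigma> - decay a * excess k h t
      + C_Ns DIM('a) s * ((W0_norm s (\<lambda>x. u \<sigma> x - u t x))\<^sup>2 / \<delta> + \<delta> * ((W0_norm s (u t))\<^sup>2 / (h - k)\<^sup>2))"
proof -
  have uW: "u t \<in> W_space s" using ut(1) by (rule W0_spaceD)
  then have um[measurable]: "u t \<in> borel_measurable lebesgue" by (simp add: W_space_iff)
  have u_out: "AE x in lebesgue. x \<notin> \<Omega> \<longrightarrow> u t x = 0" using ut(1) by (simp add: W0_space_def)
  have Uu: "AE x in lebesgue. x \<in> \<Omega> \<longrightarrow> U t x = u t x"
    using ut(2) by (simp add: AE_lebesgue_on_iff \<Omega>_sets)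
  note lip = ramp_lipschitz[OF k(2)]
  have ramp0: "ramp k h 0 = 0" using k by (intro ramp_zero) auto
  show v: "v \<in> W0_space s \<Omega>" unfolding v_def by (rule W0_space_lipschitz[OF ut(1) lip ramp0])
  have vW: "v \<in> W_space s" using v by (rule W0_spaceD)
  then have vm[measurable]: "v \<in> borel_measurable lebesgue" by (simp add: W_space_iff)
  have vL2: "v \<in> Lp_space \<Omega> 2" by (rule W_space_imp_Lp_space[OF vW \<Omega>_sets])
  have t: "t \<in> {0..T}" and \<tau>: "\<tau> \<in> {0..T}" using \<tau>t by auto
  note UtL = Lp_space_2_diff[OF U_L2[OF t] U_L2[OF \<tau>]]
  show "excess k h t - excess k h \<tau> \<le> integral {\<tau>..t} (\<lambda>\<sigma>. g \<sigma> v)"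
  proof -
    have "excess k h t - excess k h \<tau> = (LINT x|lebesgue_on \<Omega>. ramp_primitive k h (U t x) - ramp_primitive k h (U \<tau> x))"
      unfolding excess_def using ramp_primitive_U_integrable[OF k(2)] \<tau> t by simp
    also have "\<dots> \<le> (LINT x|lebesgue_on \<Omega>. (U t x - U \<tau> x) * v x)"
    proof (rule integral_mono_AE)
      show "integrable (lebesgue_on \<Omega>) (\<lambda>x. ramp_primitive k h (U t x) - ramp_primitive k h (U \<tau> x))"
        using ramp_primitive_U_integrable[OF k(2)] \<tau> t by simp
      show "integrable (lebesgue_on \<Omega>) (\<lambda>x. (U t x - U \<tau> x) * v x)"
        by (rule integral_mult_Lp_norm_2(1)[OF UtL vL2])
      show "AE x in lebesgue_on \<Omega>. ramp_primitive k h (U t x) - ramp_primitive k h (U \<tau> x) \<le> (U t x - U \<tau> x) * v x"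
        using ut(2)
      proof eventually_elim
        case (elim x)
        then show ?case using ramp_primitive_subgradient[OF k(2), of "U t x" "U \<tau> x"] by (simp add: v_def mult.commute)
      qed
    qed
    also have "\<dots> = integral {\<tau>..t} (\<lambda>\<sigma>. g \<sigma> v)" by (rule g_increment[OF v \<tau>t])
    finally show ?thesis .
  qed
  have level: "emeasure lebesgue {x. k < u t x} \<le> ennreal a"
  proof -
    note A = superlevel_sets[OF t, of k]
    have B: "{x. k < u t x} \<in> sets lebesgue"
      using borel_measurable_less[of "\<lambda>x. k" lebesgue "u t"] by simp
    have "emeasure lebesgue {x. k < u t x} = emeasure lebesgue {x \<in> \<Omega>. k < U t x}"
    proof (rule emeasure_eq_AE[OF _ B A])
      show "AE x in lebesgue. x \<in> {x. k < u t x} \<longleftrightarrow> x \<in> {x \<in> \<Omega>. k < U t x}"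
        using Uu u_out by eventually_elim (use k in auto)
    qed
    then show ?thesis using small by simp
  qed
  have coercive: "decay a * excess k h t \<le> energy_form s (u t) v"
  proof -
    have "excess k h t = (LINT x|lebesgue. ramp_primitive k h (u t x))"
    proof -
      have "excess k h t = (LINT x|lebesgue. indicator \<Omega> x *\<^sub>R ramp_primitive k h (U t x))"
        unfolding excess_def using \<Omega>_sets by (subst integral_restrict_space) auto
      also have "\<dots> = (LINT x|lebesgue. ramp_primitive k h (u t x))"
      proof (rule integral_cong_AE)
        show "(\<lambda>x. indicator \<Omega> x *\<^sub>R ramp_primitive k h (U t x)) \<in> borel_measurable lebesgue"
          using ramp_primitive_U_integrable[OF k(2) t] \<Omega>_sets
          by (simp add: integrable_restrict_space borel_measurable_integrable)
        show "(\<lambda>x. ramp_primitive k h (u t x)) \<in> borel_measurable lebesgue" by measurable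
        show "AE x in lebesgue. indicator \<Omega> x *\<^sub>R ramp_primitive k h (U t x) = ramp_primitive k h (u t x)"
          using Uu u_out
        proof eventually_elim
          case (elim x)
          then show ?case using ramp_primitive_zero[OF k(2,1)] by (cases "x \<in> \<Omega>") auto
        qed
      qed
      finally show ?thesis .
    qed
    then show ?thesis
      unfolding v_def decay_def using level \<open>0 < a\<close> k
      by (simp only:) (rule energy_form_truncation_lower_bound[OF uW s lip mono_ramp k(1)],
        auto intro: ramp_zero ramp_primitive_nonneg ramp_primitive_zero ramp_primitive_le)
  qed
  have vnorm: "(W0_norm s v)\<^sup>2 \<le> (W0_norm s (u t))\<^sup>2 / (h - k)\<^sup>2"
    using W_space_lipschitz(2)[OF uW lip ramp0] by (simp add: v_def power_divide)
  show "AE \<sigma> in lebesgue_on {0<..<T}. g \<sigma> v \<le> 2 * a powr (1 - 1 / p) * source \<sigma> - decay a * excess k h t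
      + C_Ns DIM('a) s * ((W0_norm s (\<lambda>x. u \<sigma> x - u t x))\<^sup>2 / \<delta> + \<delta> * ((W0_norm s (u t))\<^sup>2 / (h - k)\<^sup>2))"
    using equation[OF v] z_Lp AE_u_W0
  proof eventually_elim
    case (elim \<sigma>)
    have "functional_of \<Omega> (z \<sigma>) v \<le> 2 * Lp_norm \<Omega> p (z \<sigma>) * a powr (1 - 1 / p)"
    proof (rule functional_of_le_support[OF elim(2) pr(1) _ _ _ \<open>0 < a\<close>])
      show "v \<in> borel_measurable (lebesgue_on \<Omega>)" by (rule measurable_restrict_space1) measurable
      have sub: "{x \<in> \<Omega>. v x \<noteq> 0} \<subseteq> {x. k < u t x}"
        using ramp_zero[OF k(2)] by (auto simp: v_def not_le[symmetric])
      have "emeasure (lebesgue_on \<Omega>) {x \<in> \<Omega>. v x \<noteq> 0} = emeasure lebesgue {x \<in> \<Omega>. v x \<noteq> 0}"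
        using \<Omega>_sets by (intro emeasure_restrict_space) auto
      also have "\<dots> \<le> emeasure lebesgue {x. k < u t x}"
        using sub borel_measurable_less[of "\<lambda>x. k" lebesgue "u t"] by (intro emeasure_mono) auto
      finally show "emeasure (lebesgue_on \<Omega>) {x \<in> \<Omega>. v x \<noteq> 0} \<le> ennreal a" using level by (rule order_trans)
    qed (auto simp: v_def)
    moreover have "energy_form s (u t) v \<le> energy_form s (u \<sigma>) v +
        C_Ns DIM('a) s * ((W0_norm s (\<lambda>x. u \<sigma> x - u t x))\<^sup>2 / \<delta> + \<delta> * (W0_norm s v)\<^sup>2)"
      by (rule energy_form_diff_bound[OF W0_spaceD[OF elim(3)] uW vW s \<open>0 < \<delta>\<close>])
    moreover have "C_Ns DIM('a) s * ((W0_norm s (\<lambda>x. u \<sigma> x - u t x))\<^sup>2 / \<delta> + \<delta> * (W0_norm s v)\<^sup>2)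
      \<le> C_Ns DIM('a) s * ((W0_norm s (\<lambda>x. u \<sigma> x - u t x))\<^sup>2 / \<delta> + \<delta> * ((W0_norm s (u t))\<^sup>2 / (h - k)\<^sup>2))"
      using vnorm \<open>0 < \<delta>\<close> C_Ns_pos[OF s, of "DIM('a)"] by (intro mult_left_mono add_left_mono) auto
    ultimately show ?case using elim(1) coercive by (simp add: source_def mult_ac)
  qed
qed

end

context fractional_evolution
begin

text \<open>
  The steps of \<open>ramp_testing\<close> are short, so \<open>Bochner_space_modulus\<close> bounds the error terms by \<open>\<rho>\<close>, and
  \<open>integrate_left_difference_quotients\<close> removes the discretisation. The modulus has integral at most
  \<open>\<delta>\<^sup>2\<close> and is divided by the parameter \<open>\<delta>\<close> of Young's inequality, so the total error is proportional to
  \<open>\<delta>\<close>.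
\<close>
lemma excess_damped:
  assumes k: "0 \<le> k" "k < h" and a: "0 < a"
    and small: "\<And>t. t \<in> {0<..<T} \<Longrightarrow> emeasure lebesgue {x \<in> \<Omega>. k < U t x} \<le> ennreal a"
    and t12: "0 \<le> t1" "t1 \<le> t2" "t2 \<le> T"
  shows "excess k h t2 - excess k h t1 \<le>
    integral {t1..t2} (\<lambda>t. 2 * a powr (1 - 1 / p) * source t - decay a * excess k h t)"
proof -
  let ?M = "lebesgue_on {0<..<T}"
  let ?C = "C_Ns DIM('a) s"
  let ?b = "2 * a powr (1 - 1 / p)"
  define n2 where "n2 = (\<lambda>t. (W0_norm s (u t))\<^sup>2 / (h - k)\<^sup>2)"
  have C: "0 < ?C" by (rule C_Ns_pos[OF s])
  have n2: "integrable ?M n2"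
  proof -
    have "W0_norm s v powr 2 = (W0_norm s v)\<^sup>2" for v :: "'a \<Rightarrow> real"
      using abs_powr_2[of "W0_norm s v"] by simp
    then have "integrable ?M (\<lambda>t. (W0_norm s (u t))\<^sup>2)" using u by (simp add: Bochner_space_def)
    then show ?thesis by (simp add: n2_def)
  qed
  have ei: "integrable ?M (excess k h)" by (rule continuous_integrable_Ioo[OF excess_continuous[OF k(2)]])
  define D where "D = (\<lambda>t. ?b * source t - decay a * excess k h t)"
  have D: "integrable ?M D" unfolding D_def using source_integrable ei by simp
  let ?N = "LINT t|?M. n2 t"
  have N: "0 \<le> ?N" by (intro integral_nonneg_AE AE_I2) (simp add: n2_def)
  have step: "excess k h t2 - excess k h t1 \<le> integral {t1..t2} D + \<delta> * (?C * (2 + ?N))" if "0 < \<delta>" for \<delta>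
  proof -
    have "0 < \<delta>\<^sup>2" using that by simp
    obtain \<rho> h0 G where \<rho>: "integrable ?M \<rho>" "\<And>t. 0 \<le> \<rho> t" "(LINT t|?M. \<rho> t) \<le> \<delta>\<^sup>2"
      and h0: "0 < h0" and G: "AE t in ?M. t \<in> G"
        "\<And>\<sigma> t. \<sigma> \<in> G \<Longrightarrow> t \<in> G \<Longrightarrow> \<bar>\<sigma> - t\<bar> < h0 \<Longrightarrow> (W0_norm s (\<lambda>x. u \<sigma> x - u t x))\<^sup>2 \<le> \<rho> \<sigma> + \<rho> t"
    proof (rule Bochner_space_modulus[OF u W0_norm_nonneg _ _ _ \<open>0 < \<delta>\<^sup>2\<close> T])
      fix v w y :: "'a \<Rightarrow> real" assume *: "v \<in> W0_space s \<Omega>" "w \<in> W0_space s \<Omega>" "y \<in> W0_space s \<Omega>"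
      have "(\<lambda>x. v x - y x) = (\<lambda>x. (v x - w x) - (y x - w x))" by auto
      then show "(W0_norm s (\<lambda>x. v x - y x))\<^sup>2 \<le> 2 * (W0_norm s (\<lambda>x. v x - w x))\<^sup>2 + 2 * (W0_norm s (\<lambda>x. y x - w x))\<^sup>2"
        using W_space_diff(2)[of "\<lambda>x. v x - w x" s "\<lambda>x. y x - w x"] * W0_space_diff W0_spaceD by metis
    next
      fix v w :: "'a \<Rightarrow> real" assume *: "v \<in> W0_space s \<Omega>" "w \<in> W0_space s \<Omega>"
      show "W0_norm s (\<lambda>x. v x - w x) = W0_norm s (\<lambda>x. w x - v x)"
        by (simp add: W0_norm_def gagliardo_def abs_minus_commute diff_diff_eq2 algebra_simps)
      show "(W0_norm s (\<lambda>x. v x - w x))\<^sup>2 \<le> 2 * (W0_norm s v)\<^sup>2 + 2 * (W0_norm s w)\<^sup>2"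
        using W_space_diff(2) * W0_spaceD by blast
    qed blast
    have wi: "integrable ?M (\<lambda>t. 2 * ?C / \<delta> * \<rho> t + \<delta> * ?C * n2 t)"
      using \<rho>(1) n2 by simp
    have w0: "0 \<le> 2 * ?C / \<delta> * \<rho> t + \<delta> * ?C * n2 t" for t
      using \<rho>(2)[of t] C \<open>0 < \<delta>\<close> by (simp add: n2_def)
    define f where "f = (\<lambda>t. ?b * source t + ?C / \<delta> * \<rho> t)"
    define q where "q = (\<lambda>t. ?C / \<delta> * \<rho> t + \<delta> * ?C * n2 t - decay a * excess k h t)"
    have f: "integrable ?M f" and q: "integrable ?M q"
      unfolding f_def q_def using source_integrable \<rho>(1) n2 ei by simp_all
    have "excess k h t2 - excess k h t1 \<le> integral {t1..t2} (\<lambda>t. f t + q t)"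
    proof (rule integrate_left_difference_quotients[OF excess_continuous[OF k(2)] f q h0 _ t12])
      show "AE t in ?M. \<forall>h'. 0 < h' \<longrightarrow> h' < h0 \<longrightarrow> h' < t \<longrightarrow>
          excess k h t - excess k h (t - h') \<le> integral {t - h'..t} f + h' * q t"
        using G(1) AE_u_W0 U_eq_u AE_space
      proof (eventually_elim, intro allI impI)
        case (elim t)
        fix h' assume h': "0 < h'" "h' < h0" "h' < t"
        have t: "0 < t - h'" "t - h' < t" "t < T" "t \<in> {0<..<T}" using elim(4) h' by auto
        let ?v = "\<lambda>x. ramp k h (u t x)"
        note rt = ramp_testing[OF k a t(1-3) \<open>0 < \<delta>\<close> elim(2,3) small[OF t(4)]]
        let ?c = "?C / \<delta> * \<rho> t + \<delta> * ?C * n2 t - decay a * excess k h t"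
        have "excess k h t - excess k h (t - h') \<le> integral {t - h'..t} (\<lambda>\<sigma>. g \<sigma> ?v)" by (rule rt(2))
        also have "\<dots> \<le> integral {t - h'..t} (\<lambda>\<sigma>. f \<sigma> + q t)"
        proof (rule time_integral_mono_AE[OF g_integrable[OF rt(1)]])
          show "integrable ?M (\<lambda>\<sigma>. f \<sigma> + q t)"
            using f continuous_integrable_Ioo[of 0 T "\<lambda>_. q t"] by simp
          show "AE \<sigma> in ?M. t - h' < \<sigma> \<and> \<sigma> < t \<longrightarrow> g \<sigma> ?v \<le> f \<sigma> + q t"
            using rt(3) G(1)
          proof (eventually_elim, intro impI)
            fix \<sigma> assume e1: "g \<sigma> ?v \<le> ?b * source \<sigma> - decay a * excess k h t
                + ?C * ((W0_norm s (\<lambda>x. u \<sigma> x - u t x))\<^sup>2 / \<delta> + \<delta> * ((W0_norm s (u t))\<^sup>2 / (h - k)\<^sup>2))"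
              and e2: "\<sigma> \<in> G" and \<sigma>: "t - h' < \<sigma> \<and> \<sigma> < t"
            have "(W0_norm s (\<lambda>x. u \<sigma> x - u t x))\<^sup>2 \<le> \<rho> \<sigma> + \<rho> t"
              using G(2)[OF e2 elim(1)] \<sigma> h' by simp
            then have "?C * ((W0_norm s (\<lambda>x. u \<sigma> x - u t x))\<^sup>2 / \<delta> + \<delta> * n2 t) \<le> ?C * ((\<rho> \<sigma> + \<rho> t) / \<delta> + \<delta> * n2 t)"
              using C \<open>0 < \<delta>\<close> by (intro mult_left_mono add_right_mono divide_right_mono) auto
            also have "\<dots> = ?C / \<delta> * \<rho> \<sigma> + (?C / \<delta> * \<rho> t + \<delta> * ?C * n2 t)"
              by (simp add: add_divide_distrib distrib_left mult_ac)
            finally show "g \<sigma> ?v \<le> f \<sigma> + q t"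
              using e1 unfolding f_def q_def n2_def[symmetric] by (simp add: n2_def)
          qed
        qed (use t in auto)
        also have "\<dots> = integral {t - h'..t} f + integral {t - h'..t} (\<lambda>\<sigma>. q t)"
          using t by (intro Henstock_Kurzweil_Integration.integral_add time_integrable_on[OF f]) auto
        also have "integral {t - h'..t} (\<lambda>\<sigma>. q t) = h' * q t" using h' by simp
        finally show "excess k h t - excess k h (t - h') \<le> integral {t - h'..t} f + h' * q t" .
      qed
    qed
    also have "\<dots> = integral {t1..t2} (\<lambda>t. D t + (2 * ?C / \<delta> * \<rho> t + \<delta> * ?C * n2 t))"
      by (intro arg_cong[where f = "integral {t1..t2}"] ext) (simp add: f_def q_def D_def)
    also have "\<dots> = integral {t1..t2} D + integral {t1..t2} (\<lambda>t. 2 * ?C / \<delta> * \<rho> t + \<delta> * ?C * n2 t)"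
      using t12 \<rho>(1) n2
      by (intro Henstock_Kurzweil_Integration.integral_add time_integrable_on[where T = T] D) auto
    also have "integral {t1..t2} (\<lambda>t. 2 * ?C / \<delta> * \<rho> t + \<delta> * ?C * n2 t) \<le> integral {0..T} (\<lambda>t. 2 * ?C / \<delta> * \<rho> t + \<delta> * ?C * n2 t)"
      using t12 by (intro integral_subset_le time_integrable_on[where T = T] wi ballI w0) auto
    also have "\<dots> = (LINT t|?M. 2 * ?C / \<delta> * \<rho> t + \<delta> * ?C * n2 t)"
      using \<rho>(1) n2 by (intro time_integral_eq[where T = T]) auto
    also have "\<dots> = 2 * ?C / \<delta> * (LINT t|?M. \<rho> t) + \<delta> * ?C * ?N"
      using \<rho>(1) n2 by simp
    also have "\<dots> \<le> 2 * ?C / \<delta> * \<delta>\<^sup>2 + \<delta> * ?C * ?N"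
      using \<rho>(3) C \<open>0 < \<delta>\<close> by (intro add_right_mono mult_left_mono) auto
    also have "\<dots> = \<delta> * (?C * (2 + ?N))"
      using \<open>0 < \<delta>\<close> by (simp add: power2_eq_square algebra_simps)
    finally show ?thesis by simp
  qed
  have "excess k h t2 - excess k h t1 \<le> integral {t1..t2} D"
  proof (rule field_le_epsilon)
    fix e :: real assume "0 < e"
    define K where "K = ?C * (2 + ?N)"
    have K: "0 < K" using C N unfolding K_def by (intro mult_pos_pos) auto
    then show "excess k h t2 - excess k h t1 \<le> integral {t1..t2} D + e"
      using step[of "e / K"] \<open>0 < e\<close> unfolding K_def[symmetric] by simp
  qed
  then show ?thesis by (simp add: D_def)
qed

section \<open>Iteration over level sets\<close>

lemma decay_pos: "0 < a \<Longrightarrow> 0 < decay a"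
  using C_Ns_pos[OF s, of "DIM('a)"] faber_krahn_const_pos[of "DIM('a)" s] by (simp add: decay_def)

lemma level_const_pos: "0 < level_set_const DIM('a) s r"
  using C_Ns_pos[OF s, of "DIM('a)"] faber_krahn_const_pos[of "DIM('a)" s] by (simp add: level_set_const_def)

text \<open>
  The heart of the argument. If the sets above \<open>k\<close> have measure at most \<open>a\<close>, the source contributes
  \<open>a powr (1 - 1 / p)\<close>, and the damping with rate \<open>a powr (- 2 * s / N)\<close> contributes the further power
  \<open>a powr (2 * s / N * (1 - 1 / r))\<close>. Chebyshev's inequality passes from the excess over \<open>k\<close> to the measure
  of the sets above \<open>h\<close>. The resulting exponent exceeds 1 by \<open>smoothing_gain\<close>.
\<close>
lemma level_set_decay:
  assumes k: "0 \<le> k" "k < h" and a: "0 < a"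
    and small: "\<And>t. t \<in> {0<..<T} \<Longrightarrow> emeasure lebesgue {x \<in> \<Omega>. k < U t x} \<le> ennreal a"
    and R: "0 \<le> R" "(LINT t|lebesgue_on {0<..<T}. source t powr r) \<le> R powr r"
    and t: "t \<in> {0<..<T}"
  shows "emeasure lebesgue {x \<in> \<Omega>. h < U t x} \<le> ennreal (level_set_const DIM('a) s r * R / (h - k) * a powr (1 + smoothing_gain DIM('a) s p r))"
proof -
  let ?G = "smoothing_gain DIM('a) s p r"
  let ?K = "C_Ns DIM('a) s / 2 * faber_krahn_const DIM('a) s"
  have K: "0 < ?K" using C_Ns_pos[OF s, of "DIM('a)"] faber_krahn_const_pos[of "DIM('a)" s] by simp
  have t': "t \<in> {0..T}" using t by auto
  have "excess k h t \<le> 2 * (2 * a powr (1 - 1 / p)) * R * decay a powr (1 / r - 1)"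
  proof (rule damped_integral_inequality_Lr[OF excess_continuous[OF k(2)] excess_initial[OF k]
        source_integrable source_powr_integrable source_nonneg pr(2) decay_pos[OF a] _ R])
    show "\<And>t1 t2. 0 \<le> t1 \<Longrightarrow> t1 \<le> t2 \<Longrightarrow> t2 \<le> T \<Longrightarrow> excess k h t2 - excess k h t1 \<le>
        integral {t1..t2} (\<lambda>t. 2 * a powr (1 - 1 / p) * source t - decay a * excess k h t)"
      by (rule excess_damped[OF k a small])
  qed (use a t in auto)
  also have "decay a powr (1 / r - 1) = ?K powr (1 / r - 1) * a powr (2 * s / real DIM('a) * (1 - 1 / r))"
  proof -
    have "decay a powr (1 / r - 1) = ?K powr (1 / r - 1) * (a powr (- (2 * s / real DIM('a)))) powr (1 / r - 1)"
      unfolding decay_def by (rule powr_mult)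
    also have "(a powr (- (2 * s / real DIM('a)))) powr (1 / r - 1) = a powr (2 * s / real DIM('a) * (1 - 1 / r))"
    proof -
      have "(- x) * (y - 1) = x * (1 - y)" for x y :: real by (simp add: algebra_simps)
      then show ?thesis by (simp only: powr_powr)
    qed
    finally show ?thesis .
  qed
  also have "2 * (2 * a powr (1 - 1 / p)) * R * (?K powr (1 / r - 1) * a powr (2 * s / real DIM('a) * (1 - 1 / r)))
     = level_set_const DIM('a) s r / 2 * R * a powr (1 + ?G)"
  proof -
    have "a powr (1 + ?G) = a powr (1 - 1 / p) * a powr (2 * s / real DIM('a) * (1 - 1 / r))"
      unfolding powr_add[symmetric] by (rule arg_cong[where f = "\<lambda>x. a powr x"]) (simp add: smoothing_gain_def)
    then show ?thesis by (simp add: level_set_const_def)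
  qed
  finally have E: "excess k h t \<le> level_set_const DIM('a) s r / 2 * R * a powr (1 + ?G)" .
  let ?A = "{x \<in> \<Omega>. h < U t x}"
  have A: "?A \<in> sets (lebesgue_on \<Omega>)"
    using superlevel_sets[OF t'] \<Omega>_sets by (simp add: sets_restrict_space_iff)
  have "measure (lebesgue_on \<Omega>) ?A * ((h - k) / 2) = (LINT x|lebesgue_on \<Omega>. indicator ?A x * ((h - k) / 2))"
    using A sets.sets_into_space[OF A] by (simp add: Int_absorb1 Int_absorb2)
  also have "\<dots> \<le> excess k h t"
    unfolding excess_def
  proof (rule integral_mono)
    show "integrable (lebesgue_on \<Omega>) (\<lambda>x. indicator ?A x * ((h - k) / 2))"
      using A finite_measure.emeasure_finite[OF finite_measure_\<Omega>, of ?A]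
      by (intro integrable_mult_left integrable_real_indicator) (auto simp: top.not_eq_extremum)
    show "integrable (lebesgue_on \<Omega>) (\<lambda>x. ramp_primitive k h (U t x))"
      by (rule ramp_primitive_U_integrable[OF k(2) t'])
    show "indicator ?A x * ((h - k) / 2) \<le> ramp_primitive k h (U t x)" for x
      using ramp_primitive_ge_above[OF k(2), of "U t x"] ramp_primitive_nonneg[OF k(2), of "U t x"]
      by (auto simp: indicator_def)
  qed
  finally have "measure (lebesgue_on \<Omega>) ?A * ((h - k) / 2) \<le> level_set_const DIM('a) s r / 2 * R * a powr (1 + ?G)"
    using E by linarith
  then have "measure (lebesgue_on \<Omega>) ?A \<le> level_set_const DIM('a) s r * R / (h - k) * a powr (1 + ?G)"
    using k(2) by (simp add: field_simps)
  moreover have "emeasure lebesgue ?A = ennreal (measure (lebesgue_on \<Omega>) ?A)"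
  proof -
    have "emeasure lebesgue ?A = emeasure (lebesgue_on \<Omega>) ?A"
      using \<Omega>_sets by (intro emeasure_restrict_space[symmetric]) auto
    then show ?thesis using finite_measure.emeasure_eq_measure[OF finite_measure_\<Omega>] by simp
  qed
  ultimately show ?thesis by (simp add: ennreal_leI)
qed

text \<open>
  De Giorgi's iteration over the levels \<open>M * (1 - 1 / 2 ^ j)\<close>. Their distances shrink by the factor \<open>1 / 2\<close>
  in each step; as the exponent in \<open>level_set_decay\<close> exceeds 1, measures that decay like \<open>\<theta> ^ j\<close> with
  \<open>\<theta> powr smoothing_gain = 1 / 2\<close> compensate this, provided that \<open>M\<close> is the stated multiple of \<open>R\<close>.
\<close>
lemma essential_upper_bound:
  assumes gain: "0 < smoothing_gain DIM('a) s p r"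
    and R: "0 < R" "(LINT t|lebesgue_on {0<..<T}. source t powr r) \<le> R powr r"
    and t: "t \<in> {0<..<T}"
  shows "AE x in lebesgue_on \<Omega>. U t x \<le> sup_bound_const DIM('a) s p r (measure lebesgue \<Omega>) * R"
proof -
  let ?G = "smoothing_gain DIM('a) s p r"
  define M where "M = 2 * level_set_const DIM('a) s r * R * (measure lebesgue \<Omega> + 1) powr ?G * 2 powr (1 / ?G)"
  define a0 where "a0 = measure lebesgue \<Omega> + 1"
  have a0: "0 < a0" by (simp add: a0_def add_nonneg_pos)
  define \<theta> where "\<theta> = 2 powr (- 1 / ?G)"
  have \<theta>: "0 < \<theta>" "\<theta> < 1" using gain powr_less_mono[of "- 1 / ?G" 0 2] by (auto simp: \<theta>_def)
  have M: "0 < M" using level_const_pos R(1) a0 by (simp add: M_def flip: a0_def)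
  define kk where "kk = (\<lambda>j::nat. M * (1 - 1 / 2 ^ j))"
  have small: "\<forall>t\<in>{0<..<T}. emeasure lebesgue {x \<in> \<Omega>. kk j < U t x} \<le> ennreal (a0 * \<theta> ^ j)" for j
  proof (induction j)
    case 0
    show ?case
    proof
      fix t
      have "emeasure lebesgue {x \<in> \<Omega>. kk 0 < U t x} \<le> emeasure lebesgue \<Omega>"
        using \<Omega>_sets by (intro emeasure_mono) auto
      also have "\<dots> = ennreal (measure lebesgue \<Omega>)" using \<Omega> by (simp add: emeasure_eq_measure2)
      also have "\<dots> \<le> ennreal (a0 * \<theta> ^ 0)" by (intro ennreal_leI) (simp add: a0_def)
      finally show "emeasure lebesgue {x \<in> \<Omega>. kk 0 < U t x} \<le> ennreal (a0 * \<theta> ^ 0)" .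
    qed
  next
    case (Suc j)
    have k: "0 \<le> kk j" "kk j < kk (Suc j)" using M by (auto simp: kk_def field_simps)
    have diff: "kk (Suc j) - kk j = M / 2 ^ Suc j" by (simp add: kk_def field_simps)
    have aj: "0 < a0 * \<theta> ^ j" using a0 \<theta> by simp
    have "level_set_const DIM('a) s r * R / (kk (Suc j) - kk j) * (a0 * \<theta> ^ j) powr (1 + ?G) = a0 * \<theta> ^ Suc j"
    proof -
      have "(\<theta> ^ j) powr ?G = 1 / 2 ^ j"
      proof -
        have "\<theta> powr ?G = 2 powr (- 1 / ?G * ?G)" unfolding \<theta>_def by (rule powr_powr)
        also have "\<dots> = 1 / 2" using gain by (simp add: powr_minus_divide)
        finally have half: "\<theta> powr ?G = 1 / 2" .
        have pow: "(\<theta> ^ j) powr ?G = (\<theta> powr ?G) ^ j"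
          using \<theta> by (simp add: powr_powr mult.commute flip: powr_realpow)
        show ?thesis unfolding pow half by (simp add: power_one_over)
      qed
      then have "(a0 * \<theta> ^ j) powr (1 + ?G) = a0 * \<theta> ^ j * (a0 powr ?G * (1 / 2 ^ j))"
        using aj a0 \<theta> by (simp add: powr_add powr_mult)
      moreover have "level_set_const DIM('a) s r * R / (M / 2 ^ Suc j) = 2 ^ j * \<theta> / a0 powr ?G"
      proof -
        have "2 powr (1 / ?G) * \<theta> = 1" by (simp add: \<theta>_def flip: powr_add)
        then have "M * \<theta> = 2 * level_set_const DIM('a) s r * R * a0 powr ?G" by (simp add: M_def a0_def mult.assoc)
        then have "level_set_const DIM('a) s r * R = M * \<theta> / (2 * a0 powr ?G)" using a0 by simp
        then show ?thesis using M by simp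
      qed
      ultimately show ?thesis using a0 by (simp add: diff)
    qed
    then show ?case
      using level_set_decay[OF k aj _ less_imp_le[OF R(1)] R(2)] Suc by simp
  qed
  have t': "t \<in> {0..T}" using t by auto
  have "emeasure lebesgue {x \<in> \<Omega>. M < U t x} \<le> 0"
  proof (rule LIMSEQ_le_const)
    have "(\<lambda>j. a0 * \<theta> ^ j) \<longlonglongrightarrow> a0 * 0" using \<theta> by (intro tendsto_mult LIMSEQ_realpow_zero tendsto_const) auto
    then show "(\<lambda>j. ennreal (a0 * \<theta> ^ j)) \<longlonglongrightarrow> 0" using tendsto_ennrealI by fastforce
    have "emeasure lebesgue {x \<in> \<Omega>. M < U t x} \<le> ennreal (a0 * \<theta> ^ j)" for j
    proof -
      have "{x \<in> \<Omega>. kk j < U t x} \<in> sets lebesgue" by (rule superlevel_sets[OF t'])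
      moreover have "kk j \<le> M" using M by (simp add: kk_def)
      ultimately have "emeasure lebesgue {x \<in> \<Omega>. M < U t x} \<le> emeasure lebesgue {x \<in> \<Omega>. kk j < U t x}"
        by (intro emeasure_mono) auto
      then show ?thesis using small[of j] t by (auto intro: order_trans)
    qed
    then show "\<exists>N. \<forall>j\<ge>N. emeasure lebesgue {x \<in> \<Omega>. M < U t x} \<le> ennreal (a0 * \<theta> ^ j)" by blast
  qed
  moreover have "{x \<in> \<Omega>. M < U t x} \<in> sets lebesgue" by (rule superlevel_sets[OF t'])
  ultimately have "{x \<in> \<Omega>. M < U t x} \<in> null_sets lebesgue" by auto
  then have "AE x in lebesgue. x \<notin> {x \<in> \<Omega>. M < U t x}" by (rule AE_not_in)
  moreover have "M = sup_bound_const DIM('a) s p r (measure lebesgue \<Omega>) * R"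
    by (simp add: M_def sup_bound_const_def)
  ultimately show ?thesis
    by (simp add: AE_lebesgue_on_iff \<Omega>_sets) (elim eventually_mono, auto)
qed

end

section \<open>Symmetry under a change of sign\<close>

lemma gagliardo_uminus: "gagliardo s (\<lambda>x. - v x) = gagliardo s v"
proof -
  have "\<bar>- v x - - v y\<bar> = \<bar>v x - v y\<bar>" for x y by linarith
  then show ?thesis by (simp only: gagliardo_def)
qed

lemma W0_norm_uminus: "W0_norm s (\<lambda>x. - v x) = W0_norm s v"
  by (simp only: W0_norm_def gagliardo_uminus)

lemma W0_space_uminus: "v \<in> W0_space s \<Omega> \<Longrightarrow> (\<lambda>x. - v x) \<in> W0_space s \<Omega>"
  by (rule W0_space_lipschitz[where L = 1]) auto

lemma energy_form_uminus: "energy_form s (\<lambda>x. - u x) v = - energy_form s u v"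
proof -
  have "(- u x - - u y) * (v x - v y) / c = - ((u x - u y) * (v x - v y) / c)" for x y c
    by (simp add: algebra_simps diff_divide_distrib)
  then show ?thesis by (simp only: energy_form_def integral_minus mult_minus_right)
qed

lemma Lp_space_uminus: "(\<lambda>x. - f x) \<in> Lp_space S p \<longleftrightarrow> f \<in> Lp_space S p"
  by (simp add: Lp_space_def)

lemma Lp_norm_uminus: "Lp_norm S p (\<lambda>x. - f x) = Lp_norm S p f"
  by (simp add: Lp_norm_def)

lemma Bochner_space_W0_uminus:
  assumes "u \<in> Bochner_space T 2 (W0_space s \<Omega>) (W0_norm s)"
  shows "(\<lambda>t x. - u t x) \<in> Bochner_space T 2 (W0_space s \<Omega>) (W0_norm s)"
proof -
  from assms obtain f where f: "\<And>n. simple_function (lebesgue_on {0<..<T}) (f n)"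
      "\<And>n t. t \<in> {0<..<T} \<Longrightarrow> f n t \<in> W0_space s \<Omega>"
    and lim: "AE t in lebesgue_on {0<..<T}. u t \<in> W0_space s \<Omega> \<and> (\<lambda>n. W0_norm s (\<lambda>x. f n t x - u t x)) \<longlonglongrightarrow> 0"
    and int: "integrable (lebesgue_on {0<..<T}) (\<lambda>t. W0_norm s (u t) powr 2)"
    unfolding Bochner_space_def strongly_measurable_def by blast
  have eq: "(\<lambda>x. - v x - - w x) = (\<lambda>x. - (v x - w x))" for v w :: "'a \<Rightarrow> real" by auto
  show ?thesis
    unfolding Bochner_space_def strongly_measurable_def
  proof (intro CollectI conjI exI[of _ "\<lambda>n t x. - f n t x"] allI ballI)
    show "simple_function (lebesgue_on {0<..<T}) (\<lambda>t x. - f n t x)" for n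
      using simple_function_compose1[OF f(1)[of n], of "\<lambda>v x. - v x"] .
    show "(\<lambda>x. - f n t x) \<in> W0_space s \<Omega>" if "t \<in> {0<..<T}" for n t
      using f(2)[OF that] by (rule W0_space_uminus)
    show "AE t in lebesgue_on {0<..<T}. (\<lambda>x. - u t x) \<in> W0_space s \<Omega> \<and>
        (\<lambda>n. W0_norm s (\<lambda>x. - f n t x - - u t x)) \<longlonglongrightarrow> 0"
      using lim by eventually_elim (simp only: eq W0_norm_uminus W0_space_uminus simp_thms)
    show "integrable (lebesgue_on {0<..<T}) (\<lambda>t. W0_norm s (\<lambda>x. - u t x) powr 2)"
      using int by (simp add: W0_norm_uminus)
  qed
qed

context fractional_evolution
begin

lemma fractional_evolution_uminus:
  "fractional_evolution \<Omega> T (\<lambda>t x. - U t x) s p r (\<lambda>t x. - u t x) (\<lambda>t x. - z t x) (\<lambda>t v. - g t v)"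
proof unfold_locales
  have eq: "(\<lambda>x. - v x - - w x) = (\<lambda>x. - (v x - w x))" for v w :: "'a \<Rightarrow> real" by auto
  show "((\<lambda>\<tau>. Lp_norm \<Omega> 2 (\<lambda>x. - U \<tau> x - - U t x)) \<longlongrightarrow> 0) (at t within {0..T})" if "t \<in> {0..T}" for t
    using U_cont[OF that] by (simp only: eq Lp_norm_uminus)
  show "(LINT x|lebesgue_on \<Omega>. (- U t x - - U \<tau> x) * v x) = integral {\<tau>..t} (\<lambda>\<sigma>. - g \<sigma> v)"
    if "v \<in> W0_space s \<Omega>" "0 < \<tau>" "\<tau> < t" "t < T" for v \<tau> t
  proof -
    have "(- U t x - - U \<tau> x) * v x = - ((U t x - U \<tau> x) * v x)" for x by (simp add: algebra_simps)
    then show ?thesis using g_increment[OF that] by simp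
  qed
  show "AE t in lebesgue_on {0<..<T}. - g t v + energy_form s (\<lambda>x. - u t x) v = functional_of \<Omega> (\<lambda>x. - z t x) v"
    if "v \<in> W0_space s \<Omega>" for v
    using equation[OF that] by eventually_elim (simp add: energy_form_uminus functional_of_def)
qed (use \<Omega> T s pr U_L2 U_eq_u U_initial g_integrable z_Lp z_Lr Bochner_space_W0_uminus[OF u]
    in \<open>auto simp: Lp_space_uminus Lp_norm_uminus\<close>)

text \<open>
  The upper bounds for \<open>U\<close> and \<open>- U\<close> hold with every \<open>R\<close> that is positive and at least the norm of the
  source; the limit \<open>R\<close> to the norm along a sequence covers a vanishing source.
\<close>
lemma essential_bound:
  assumes gain: "0 < smoothing_gain DIM('a) s p r" and t: "t \<in> {0<..<T}"
  shows "AE x in lebesgue_on \<Omega>. \<bar>U t x\<bar> \<le>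
    sup_bound_const DIM('a) s p r (measure lebesgue \<Omega>) * Bochner_norm T r (Lp_norm \<Omega> p) z"
proof -
  interpret neg: fractional_evolution \<Omega> T "\<lambda>t x. - U t x" s p r "\<lambda>t x. - u t x" "\<lambda>t x. - z t x" "\<lambda>t v. - g t v"
    by (rule fractional_evolution_uminus)
  let ?B = "Bochner_norm T r (Lp_norm \<Omega> p) z" and ?K = "sup_bound_const DIM('a) s p r (measure lebesgue \<Omega>)"
  have Z: "0 \<le> (LINT t|lebesgue_on {0<..<T}. Lp_norm \<Omega> p (z t) powr r)"
    by (intro integral_nonneg_AE) auto
  have B: "0 \<le> ?B" "(LINT t|lebesgue_on {0<..<T}. Lp_norm \<Omega> p (z t) powr r) = ?B powr r"
    using Z pr by (auto simp: Bochner_norm_def powr_powr)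
  have "AE x in lebesgue_on \<Omega>. \<forall>n. \<bar>U t x\<bar> \<le> ?K * (?B + 1 / real (Suc n))"
  proof (subst AE_all_countable, intro allI)
    fix n
    let ?R = "?B + 1 / real (Suc n)"
    have R: "0 < ?R" using B by (simp add: add_nonneg_pos)
    have "(LINT t|lebesgue_on {0<..<T}. Lp_norm \<Omega> p (z t) powr r) \<le> ?R powr r"
      unfolding B(2) using B(1) pr by (intro powr_mono2) auto
    then show "AE x in lebesgue_on \<Omega>. \<bar>U t x\<bar> \<le> ?K * ?R"
      using essential_upper_bound[OF gain R _ t] neg.essential_upper_bound[OF gain R _ t]
      by (auto simp: source_def neg.source_def Lp_norm_uminus elim!: eventually_elim2)
  qed
  then show ?thesis
  proof eventually_elim
    case (elim x)
    have "(\<lambda>n. ?K * (?B + 1 / real (Suc n))) \<longlonglongrightarrow> ?K * (?B + 0)"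
      by (intro tendsto_mult tendsto_add tendsto_const LIMSEQ_Suc[OF lim_1_over_n])
    then show ?case using elim by (intro LIMSEQ_le_const[of _ "?K * ?B"]) auto
  qed
qed

end

context L2_path
begin

section \<open>A jointly measurable representative\<close>

definition sq_dist :: "real \<Rightarrow> real \<Rightarrow> real" where
  "sq_dist t \<tau> = (LINT x|lebesgue_on \<Omega>. (U t x - U \<tau> x)\<^sup>2)"

lemma sq_diff_integrable:
  "t \<in> {0..T} \<Longrightarrow> \<tau> \<in> {0..T} \<Longrightarrow> integrable (lebesgue_on \<Omega>) (\<lambda>x. (U t x - U \<tau> x)\<^sup>2)"
  using Lp_space_2_diff[OF U_L2 U_L2] by (simp add: Lp_space_2_iff)

lemma sq_dist_quasi_triangle:
  assumes "t \<in> {0..T}" "\<tau> \<in> {0..T}" "c \<in> {0..T}"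
  shows "sq_dist t \<tau> \<le> 2 * sq_dist t c + 2 * sq_dist \<tau> c"
proof -
  have "(a - b)\<^sup>2 \<le> 2 * (a - c)\<^sup>2 + 2 * (b - c)\<^sup>2" for a b c :: real
    using zero_le_power2[of "a + b - 2 * c"] by (simp add: power2_eq_square algebra_simps)
  then have "sq_dist t \<tau> \<le> (LINT x|lebesgue_on \<Omega>. 2 * (U t x - U c x)\<^sup>2 + 2 * (U \<tau> x - U c x)\<^sup>2)"
    unfolding sq_dist_def using sq_diff_integrable assms by (intro integral_mono) auto
  also have "\<dots> = 2 * sq_dist t c + 2 * sq_dist \<tau> c"
    unfolding sq_dist_def using sq_diff_integrable assms by simp
  finally show ?thesis .
qed

lemma uniformly_continuous_sq_dist:
  assumes "0 < e"
  obtains d where "0 < d" "\<And>t \<tau>. t \<in> {0..T} \<Longrightarrow> \<tau> \<in> {0..T} \<Longrightarrow> \<bar>t - \<tau>\<bar> < d \<Longrightarrow> sq_dist t \<tau> \<le> e"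
proof -
  have "\<exists>d>0. \<forall>\<tau>\<in>{0..T}. \<bar>\<tau> - t\<bar> < d \<longrightarrow> sq_dist \<tau> t \<le> e / 4" if t: "t \<in> {0..T}" for t
  proof -
    have "((\<lambda>\<tau>. (Lp_norm \<Omega> 2 (\<lambda>x. U \<tau> x - U t x))\<^sup>2) \<longlongrightarrow> 0) (at t within {0..T})"
      using tendsto_power[OF U_cont[OF t], of 2] by simp
    then have "((\<lambda>\<tau>. sq_dist \<tau> t) \<longlongrightarrow> 0) (at t within {0..T})"
      by (simp add: Lp_norm_2 sq_dist_def integral_nonneg_AE)
    then have "eventually (\<lambda>\<tau>. sq_dist \<tau> t < e / 4) (at t within {0..T})"
      using assms by (intro order_tendstoD(2)) auto
    then obtain d where d: "0 < d" "\<And>\<tau>. \<tau> \<in> {0..T} \<Longrightarrow> \<tau> \<noteq> t \<Longrightarrow> dist \<tau> t < d \<Longrightarrow> sq_dist \<tau> t < e / 4"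
      by (auto simp: eventually_at)
    moreover have "sq_dist t t \<le> e / 4" using assms by (simp add: sq_dist_def)
    ultimately show ?thesis by (intro exI[of _ d]) (force simp: dist_real_def)
  qed
  then obtain d where d: "\<And>t. t \<in> {0..T} \<Longrightarrow> 0 < d t"
      "\<And>t \<tau>. t \<in> {0..T} \<Longrightarrow> \<tau> \<in> {0..T} \<Longrightarrow> \<bar>\<tau> - t\<bar> < d t \<Longrightarrow> sq_dist \<tau> t \<le> e / 4"
    by metis
  obtain e' where e': "0 < e'" "\<And>t. t \<in> {0..T} \<Longrightarrow> \<exists>G\<in>(\<lambda>c. ball c (d c)) ` {0..T}. ball t e' \<subseteq> G"
    by (rule Heine_Borel_lemma[of "{0..T}" "(\<lambda>c. ball c (d c)) ` {0..T}"]) (use d(1) in auto)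
  show thesis
  proof (rule that[OF e'(1)])
    fix t \<tau> assume t: "t \<in> {0..T}" "\<tau> \<in> {0..T}" "\<bar>t - \<tau>\<bar> < e'"
    obtain c where c: "c \<in> {0..T}" "ball t e' \<subseteq> ball c (d c)" using e'(2)[OF t(1)] by auto
    have "t \<in> ball c (d c)" "\<tau> \<in> ball c (d c)"
      using c(2) t(3) e'(1) by (auto simp: dist_real_def subset_iff)
    then have "sq_dist t c \<le> e / 4" "sq_dist \<tau> c \<le> e / 4"
      using d(2)[OF c(1)] t by (auto simp: dist_real_def abs_minus_commute)
    then show "sq_dist t \<tau> \<le> e" using sq_dist_quasi_triangle[OF t(1,2) c(1)] by simp
  qed
qed

text \<open>
  Piecewise constant interpolation of \<open>U\<close> on grids, with Borel measurable values, is jointly measurable.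
  By uniform continuity the grids can be chosen with squared distance to \<open>U t\<close> at most \<open>(1 / 2) ^ n\<close> for
  every \<open>t\<close>. These bounds are summable, so for every \<open>t\<close> the interpolations converge to \<open>U t\<close> almost
  everywhere on \<open>\<Omega>\<close>.
\<close>
lemma borel_representative:
  obtains V :: "real \<times> 'a \<Rightarrow> real" where "V \<in> borel_measurable borel"
    "\<And>t. t \<in> {0<..<T} \<Longrightarrow> AE x in lebesgue_on \<Omega>. V (t, x) = U t x"
proof -
  have \<Omega>s: "\<Omega> \<in> sets lebesgue" using \<Omega> by auto
  have "\<exists>w. w \<in> borel_measurable borel \<and> (AE x in lebesgue_on \<Omega>. w x = U t x)" if "t \<in> {0..T}" for t
  proof -
    have "(\<lambda>x. if x \<in> \<Omega> then U t x else 0) \<in> borel_measurable (completion lborel)"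
      using U_L2[OF that] by (intro borel_measurable_if[OF \<Omega>s, THEN iffD2]) (simp add: Lp_space_2_iff)
    then obtain w where w: "w \<in> borel_measurable lborel" "AE x in lborel. (if x \<in> \<Omega> then U t x else 0) = w x"
      using completion_ex_borel_measurable_real by blast
    have "AE x in lebesgue_on \<Omega>. w x = U t x"
      unfolding AE_lebesgue_on_iff[OF \<Omega>s]
      using AE_completion[OF w(2)] by eventually_elim auto
    then show ?thesis using w(1) by auto
  qed
  then obtain w where w: "\<And>t. t \<in> {0..T} \<Longrightarrow> w t \<in> borel_measurable borel"
      "\<And>t. t \<in> {0..T} \<Longrightarrow> AE x in lebesgue_on \<Omega>. w t x = U t x" by metis
  have "\<exists>d>0. \<forall>t\<in>{0..T}. \<forall>\<tau>\<in>{0..T}. \<bar>t - \<tau>\<bar> < d \<longrightarrow> sq_dist t \<tau> \<le> (1 / 2) ^ n" for n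
    using uniformly_continuous_sq_dist[of "(1 / 2) ^ n"] by (metis zero_less_power half_gt_zero zero_less_one)
  then obtain d where d: "\<And>n. 0 < d n"
      "\<And>n t \<tau>. t \<in> {0..T} \<Longrightarrow> \<tau> \<in> {0..T} \<Longrightarrow> \<bar>t - \<tau>\<bar> < d n \<Longrightarrow> sq_dist t \<tau> \<le> (1 / 2) ^ n" by metis
  \<comment> \<open>Clamping to \<open>{0..T}\<close> keeps the grid points in the range where \<open>w\<close> was chosen.\<close>
  define grid where "grid = (\<lambda>n k. max 0 (min T (real_of_int k * (d n / 2))))"
  have grid: "grid n k \<in> {0..T}" for n k using T by (auto simp: grid_def)
  define V where "V = (\<lambda>n (p :: real \<times> 'a). w (grid n \<lfloor>fst p / (d n / 2)\<rfloor>) (snd p))"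
  have V_meas[measurable]: "V n \<in> borel_measurable borel" for n
  proof -
    have "V n = (\<lambda>p. (\<lambda>k p. w (grid n k) (snd p)) \<lfloor>fst p / (d n / 2)\<rfloor> p)" by (simp add: V_def)
    also have "\<dots> \<in> borel_measurable borel"
    proof (rule measurable_compose_countable)
      fix k
      have [measurable]: "w (grid n k) \<in> borel_measurable borel" by (rule w(1)[OF grid])
      show "(\<lambda>p :: real \<times> 'a. w (grid n k) (snd p)) \<in> borel_measurable borel"
        by (rule measurable_compose[OF borel_measurable_continuous_onI]) (auto intro: continuous_intros)
    next
      have "(\<lambda>p :: real \<times> 'a. fst p / (d n / 2)) \<in> borel_measurable borel"
        by (rule borel_measurable_continuous_onI) (use d(1)[of n] in \<open>auto intro!: continuous_intros\<close>)
      then show "(\<lambda>p :: real \<times> 'a. \<lfloor>fst p / (d n / 2)\<rfloor>) \<in> borel \<rightarrow>\<^sub>M count_space UNIV"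
        by measurable
    qed
    finally show ?thesis .
  qed
  define W where "W = (\<lambda>p. lim (\<lambda>n. V n p))"
  have "W \<in> borel_measurable borel" unfolding W_def by (rule borel_measurable_lim_metric) (rule V_meas)
  moreover have "AE x in lebesgue_on \<Omega>. W (t, x) = U t x" if t: "t \<in> {0<..<T}" for t
  proof -
    have tT: "t \<in> {0..T}" using t by auto
    define \<gamma> where "\<gamma> = (\<lambda>n. grid n \<lfloor>t / (d n / 2)\<rfloor>)"
    have \<gamma>T: "\<gamma> n \<in> {0..T}" for n unfolding \<gamma>_def by (rule grid)
    have close: "\<bar>\<gamma> n - t\<bar> < d n" for n
    proof -
      have dn: "0 < d n / 2" using d(1)[of n] by simp
      have "real_of_int \<lfloor>t / (d n / 2)\<rfloor> * (d n / 2) \<le> t"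
        using mult_right_mono[OF of_int_floor_le[of "t / (d n / 2)"], of "d n / 2"] dn by simp
      moreover have "t < (real_of_int \<lfloor>t / (d n / 2)\<rfloor> + 1) * (d n / 2)"
        using mult_strict_right_mono[OF floor_correct[THEN conjunct2, of "t / (d n / 2)"] dn] dn by simp
      ultimately show ?thesis using t dn by (auto simp: \<gamma>_def grid_def abs_less_iff min_def max_def algebra_simps)
    qed
    have AEV: "AE x in lebesgue_on \<Omega>. \<forall>n. V n (t, x) = U (\<gamma> n) x"
      unfolding AE_all_countable V_def fst_conv snd_conv \<gamma>_def by (intro allI w(2) grid)
    have meas: "(\<lambda>x. ennreal ((U (\<gamma> n) x - U t x)\<^sup>2)) \<in> borel_measurable (lebesgue_on \<Omega>)" for n
      by (rule measurable_compose[OF borel_measurable_integrable[OF sq_diff_integrable[OF \<gamma>T tT]] measurable_ennreal])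
    have "(\<integral>\<^sup>+x. (\<Sum>n. ennreal ((U (\<gamma> n) x - U t x)\<^sup>2)) \<partial>lebesgue_on \<Omega>)
        = (\<Sum>n. \<integral>\<^sup>+x. ennreal ((U (\<gamma> n) x - U t x)\<^sup>2) \<partial>lebesgue_on \<Omega>)"
      by (rule nn_integral_suminf[OF meas])
    also have "\<dots> \<le> (\<Sum>n. ennreal ((1 / 2) ^ n))"
    proof (rule suminf_le)
      show "(\<integral>\<^sup>+x. ennreal ((U (\<gamma> n) x - U t x)\<^sup>2) \<partial>lebesgue_on \<Omega>) \<le> ennreal ((1 / 2) ^ n)" for n
        using d(2)[OF \<gamma>T tT close] nn_integral_eq_integral[OF sq_diff_integrable[OF \<gamma>T tT, of n]]
        by (auto simp: sq_dist_def intro: ennreal_leI)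
    qed auto
    also have "\<dots> < \<infinity>"
      by (subst suminf_ennreal2) (auto intro: summable_geometric)
    finally have "AE x in lebesgue_on \<Omega>. (\<Sum>n. ennreal ((U (\<gamma> n) x - U t x)\<^sup>2)) \<noteq> \<infinity>"
      using meas by (intro nn_integral_PInf_AE borel_measurable_suminf) auto
    with AEV show ?thesis
    proof eventually_elim
      case (elim x)
      have "summable (\<lambda>n. (U (\<gamma> n) x - U t x)\<^sup>2)"
        using elim(2) by (intro summable_suminf_not_top) auto
      then have "(\<lambda>n. (U (\<gamma> n) x - U t x)\<^sup>2) \<longlonglongrightarrow> 0" by (rule summable_LIMSEQ_zero)
      then have "(\<lambda>n. sqrt ((U (\<gamma> n) x - U t x)\<^sup>2)) \<longlonglongrightarrow> sqrt 0" by (rule tendsto_real_sqrt)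
      then have "(\<lambda>n. U (\<gamma> n) x - U t x) \<longlonglongrightarrow> 0" by (simp add: tendsto_rabs_zero_iff)
      then have "(\<lambda>n. U (\<gamma> n) x) \<longlonglongrightarrow> U t x" by (simp add: LIM_zero_iff)
      then show ?case using elim(1) by (simp add: W_def limI)
    qed
  qed
  ultimately show thesis by (rule that)
qed

end

section \<open>Weak solutions as evolutions\<close>

lemma borel_measurable_lebesgue_on_AE:
  fixes f h :: "'a::euclidean_space \<Rightarrow> real"
  assumes S: "S \<in> sets lebesgue" and f: "f \<in> borel_measurable (lebesgue_on S)"
    and "AE x in lebesgue_on S. f x = h x"
  shows "h \<in> borel_measurable (lebesgue_on S)"
proof -
  have "(\<lambda>x. if x \<in> S then h x else 0) \<in> borel_measurable lebesgue"
  proof (rule borel_measurable_AE)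
    show "(\<lambda>x. if x \<in> S then f x else 0) \<in> borel_measurable lebesgue"
      by (rule borel_measurable_if_I[OF f S])
    show "AE x in lebesgue. (if x \<in> S then f x else 0) = (if x \<in> S then h x else 0)"
      using assms(3) unfolding AE_lebesgue_on_iff[OF S] by eventually_elim auto
  qed
  then show ?thesis by (rule borel_measurable_if_D)
qed

text \<open>
  The supremum in \<open>W_dual_norm\<close> is over a set bounded by \<open>max K 0\<close>, and a test function of positive norm
  can be normalised; the bound \<open>K\<close> itself settles test functions of norm 0.
\<close>
lemma W_dual_bound:
  assumes F: "F \<in> W_dual s \<Omega>" and v: "v \<in> W0_space s \<Omega>"
  shows "\<bar>F v\<bar> \<le> W_dual_norm s \<Omega> F * W0_norm s v"
proof -
  from F obtain K where K: "\<And>w. w \<in> W0_space s \<Omega> \<Longrightarrow> \<bar>F w\<bar> \<le> K * W0_norm s w"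
    and hom: "\<And>c w. w \<in> W0_space s \<Omega> \<Longrightarrow> F (\<lambda>x. c * w x) = c * F w"
    unfolding W_dual_def by blast
  show ?thesis
  proof (cases "W0_norm s v = 0")
    case True
    then show ?thesis using K[OF v] by simp
  next
    case False
    define n where "n = W0_norm s v"
    have n: "0 < n" using False by (simp add: n_def less_le)
    let ?w = "\<lambda>x. (1 / n) * v x"
    have w: "?w \<in> W0_space s \<Omega>"
      by (rule W0_space_lipschitz[OF v, where L = "1 / n"])
         (use n in \<open>auto simp: abs_mult simp flip: diff_divide_distrib\<close>)
    have "(W0_norm s ?w)\<^sup>2 \<le> (1 / n)\<^sup>2 * (W0_norm s v)\<^sup>2"
      by (rule W_space_lipschitz(2)[OF W0_spaceD[OF v]])
         (use n in \<open>auto simp: abs_mult simp flip: diff_divide_distrib\<close>)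
    also have "\<dots> = 1" using n by (simp add: n_def[symmetric] power_divide)
    finally have w1: "W0_norm s ?w \<le> 1"
      using power2_le_imp_le[of "W0_norm s ?w" 1] by simp
    have "bdd_above ((\<lambda>v. \<bar>F v\<bar>) ` {v \<in> W0_space s \<Omega>. W0_norm s v \<le> 1})"
    proof (rule bdd_aboveI2[where M = "max K 0"])
      fix y assume y: "y \<in> {v \<in> W0_space s \<Omega>. W0_norm s v \<le> 1}"
      have "\<bar>F y\<bar> \<le> K * W0_norm s y" using K y by simp
      also have "\<dots> \<le> max K 0 * 1" using y by (intro mult_mono) auto
      finally show "\<bar>F y\<bar> \<le> max K 0" by simp
    qed
    then have "\<bar>F ?w\<bar> \<le> W_dual_norm s \<Omega> F"
      unfolding W_dual_norm_def by (rule cSUP_upper[rotated]) (use w w1 in auto)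
    then have "\<bar>F v\<bar> / n \<le> W_dual_norm s \<Omega> F"
      using n by (simp only: hom[OF v]) (simp add: abs_mult)
    then show ?thesis using n by (simp add: n_def[symmetric] field_simps)
  qed
qed

lemma W_dual_diff:
  assumes "F \<in> W_dual s \<Omega>" "H \<in> W_dual s \<Omega>"
  shows "(\<lambda>v. F v - H v) \<in> W_dual s \<Omega>"
proof -
  obtain K L where "\<forall>v\<in>W0_space s \<Omega>. \<bar>F v\<bar> \<le> K * W0_norm s v" "\<forall>v\<in>W0_space s \<Omega>. \<bar>H v\<bar> \<le> L * W0_norm s v"
    using assms by (auto simp: W_dual_def)
  then have "\<forall>v\<in>W0_space s \<Omega>. \<bar>F v - H v\<bar> \<le> (K + L) * W0_norm s v"
    by (auto simp: distrib_right intro: order_trans[OF abs_triangle_ineq4] add_mono)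
  then have "\<exists>K. \<forall>v\<in>W0_space s \<Omega>. \<bar>F v - H v\<bar> \<le> K * W0_norm s v" by blast
  moreover have "\<forall>v\<in>W0_space s \<Omega>. \<forall>w\<in>W0_space s \<Omega>. F (\<lambda>x. v x + w x) - H (\<lambda>x. v x + w x) = (F v - H v) + (F w - H w)"
    using assms by (simp add: W_dual_def)
  moreover have "\<forall>c. \<forall>v\<in>W0_space s \<Omega>. F (\<lambda>x. c * v x) - H (\<lambda>x. c * v x) = c * (F v - H v)"
    using assms by (simp add: W_dual_def right_diff_distrib)
  ultimately show ?thesis unfolding W_dual_def by blast
qed

text \<open>
  Evaluation at \<open>v\<close> turns the simple approximations of \<open>g\<close> into real simple functions which converge to
  \<open>g t v\<close> for almost every \<open>t\<close>; completeness of the measure then gives measurability.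
\<close>
lemma dual_pairing_integrable:
  assumes g: "g \<in> Bochner_space T 2 (W_dual s \<Omega>) (W_dual_norm s \<Omega>)" and v: "v \<in> W0_space s \<Omega>"
  shows "integrable (lebesgue_on {0<..<T}) (\<lambda>t. g t v)"
proof -
  let ?M = "lebesgue_on {0<..<T}"
  from g obtain f where f: "\<And>n. simple_function ?M (f n)" "\<And>n t. t \<in> {0<..<T} \<Longrightarrow> f n t \<in> W_dual s \<Omega>"
    and lim: "AE t in ?M. g t \<in> W_dual s \<Omega> \<and> (\<lambda>n. W_dual_norm s \<Omega> (\<lambda>v. f n t v - g t v)) \<longlonglongrightarrow> 0"
    and int: "integrable ?M (\<lambda>t. W_dual_norm s \<Omega> (g t) powr 2)"
    unfolding Bochner_space_def strongly_measurable_def by blast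
  have fm: "(\<lambda>t. f n t v) \<in> borel_measurable ?M" for n
    by (rule borel_measurable_simple_function, rule simple_function_compose1[OF f(1), of "\<lambda>F. F v"])
  have gm: "(\<lambda>t. g t v) \<in> borel_measurable ?M"
  proof (rule borel_measurable_lebesgue_on_AE)
    show "(\<lambda>t. lim (\<lambda>n. f n t v)) \<in> borel_measurable ?M"
      by (rule borel_measurable_lim_metric[OF fm])
    show "AE t in ?M. lim (\<lambda>n. f n t v) = g t v"
      using lim AE_space
    proof eventually_elim
      case (elim t)
      have "(\<lambda>n. f n t v - g t v) \<longlonglongrightarrow> 0"
      proof (rule Lim_null_comparison)
        show "eventually (\<lambda>n. norm (f n t v - g t v) \<le> W_dual_norm s \<Omega> (\<lambda>v. f n t v - g t v) * W0_norm s v) sequentially"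
          using W_dual_bound[OF W_dual_diff[OF f(2)[of t] conjunct1[OF elim(1)]] v] elim(2) by simp
        show "(\<lambda>n. W_dual_norm s \<Omega> (\<lambda>v. f n t v - g t v) * W0_norm s v) \<longlonglongrightarrow> 0"
          using tendsto_mult_right[OF conjunct2[OF elim(1)], of "W0_norm s v"] by simp
      qed
      then show ?case by (intro limI) (simp add: LIM_zero_iff)
    qed
  qed simp
  show ?thesis
  proof (rule Bochner_Integration.integrable_bound[OF _ gm])
    show "integrable ?M (\<lambda>t. (1 + W_dual_norm s \<Omega> (g t) powr 2) * W0_norm s v)"
      using int continuous_integrable_Ioo[of 0 T "\<lambda>_. 1"] by simp
    show "AE t in ?M. norm (g t v) \<le> norm ((1 + W_dual_norm s \<Omega> (g t) powr 2) * W0_norm s v)"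
      using lim
    proof eventually_elim
      case (elim t)
      have "\<bar>g t v\<bar> \<le> W_dual_norm s \<Omega> (g t) * W0_norm s v" by (rule W_dual_bound[OF conjunct1[OF elim] v])
      also have "W_dual_norm s \<Omega> (g t) \<le> 1 + W_dual_norm s \<Omega> (g t) powr 2"
      proof (cases "0 \<le> W_dual_norm s \<Omega> (g t)")
        case True
        then show ?thesis using young_split[of "W_dual_norm s \<Omega> (g t)" 1 2] by simp
      next
        case False
        then show ?thesis by (simp add: add_increasing2)
      qed
      then have "W_dual_norm s \<Omega> (g t) * W0_norm s v \<le> (1 + W_dual_norm s \<Omega> (g t) powr 2) * W0_norm s v"
        by (rule mult_right_mono) simp
      finally show ?case by (simp add: abs_mult)
    qed
  qed
qed

lemma weak_solution_evolution:
  fixes \<Omega> :: "'a::euclidean_space set"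
  assumes \<Omega>: "open \<Omega>" "bounded \<Omega>" and s: "0 < s" "s < 1" and T: "0 < T" and pr: "1 \<le> p" "1 \<le> r"
    and z: "z \<in> Bochner_space T r (Lp_space \<Omega> p) (Lp_norm \<Omega> p)"
    and sol: "weak_solution s \<Omega> T (\<lambda>t. functional_of \<Omega> (z t)) u"
  obtains U g where "fractional_evolution \<Omega> T U s p r u z g"
proof -
  have \<Omega>m: "\<Omega> \<in> lmeasurable" using \<Omega> by (simp add: bounded_set_imp_lmeasurable)
  have uB: "u \<in> Bochner_space T 2 (W0_space s \<Omega>) (W0_norm s)"
    using sol by (simp add: weak_solution_def U0_space_def)
  obtain U where U: "\<forall>t\<in>{0..T}. U t \<in> Lp_space \<Omega> 2"
      "\<forall>t\<in>{0..T}. ((\<lambda>\<tau>. Lp_norm \<Omega> 2 (\<lambda>x. U \<tau> x - U t x)) \<longlongrightarrow> 0) (at t within {0..T})"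
      "AE t in lebesgue_on {0<..<T}. AE x in lebesgue_on \<Omega>. U t x = u t x"
      "AE x in lebesgue_on \<Omega>. U 0 x = 0"
    using sol unfolding weak_solution_def initial_value_def by blast
  obtain g where g: "g \<in> Bochner_space T 2 (W_dual s \<Omega>) (W_dual_norm s \<Omega>)"
      and weak: "weak_time_derivative s \<Omega> T (\<lambda>t. functional_of \<Omega> (u t)) g"
      and eqn: "\<forall>v\<in>W0_space s \<Omega>. AE t in lebesgue_on {0<..<T}.
           g t v + energy_form s (u t) v = functional_of \<Omega> (z t) v"
    using sol unfolding weak_solution_def by blast
  interpret L2_path \<Omega> T U by unfold_locales (use \<Omega>m T U in auto)
  have AE_u: "AE t in lebesgue_on {0<..<T}. u t \<in> W0_space s \<Omega>"
    using uB unfolding Bochner_space_def strongly_measurable_def by (auto elim: eventually_mono)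
  have incr: "(LINT x|lebesgue_on \<Omega>. (U t x - U \<tau> x) * v x) = integral {\<tau>..t} (\<lambda>\<sigma>. g \<sigma> v)"
    if v: "v \<in> W0_space s \<Omega>" and \<tau>t: "0 < \<tau>" "\<tau> < t" "t < T" for v \<tau> t
  proof -
    define F where "F = (\<lambda>t. LINT x|lebesgue_on \<Omega>. U t x * v x)"
    have vL: "v \<in> Lp_space \<Omega> 2" by (rule W_space_imp_Lp_space[OF W0_spaceD[OF v] \<Omega>_sets])
    have Fc: "continuous_on {0..T} F" unfolding F_def by (rule pairing_continuous[OF vL])
    have "F t - F \<tau> = integral {\<tau>..t} (\<lambda>\<sigma>. g \<sigma> v)"
    proof (rule increment_of_weak_derivative[OF Fc dual_pairing_integrable[OF g v] _ \<tau>t])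
      fix \<phi> assume \<phi>: "test_function T \<phi>"
      have d\<phi>: "deriv \<phi> differentiable (at t)" for t
        using \<phi> unfolding test_function_def by (metis funpow_0 funpow.simps(2) o_apply)
      have "continuous_on {0..T} (deriv \<phi>)"
        using d\<phi> by (intro differentiable_imp_continuous_on) (auto simp: differentiable_on_def intro: differentiable_at_withinI)
      then have m: "(\<lambda>t. deriv \<phi> t * F t) \<in> borel_measurable (lebesgue_on {0<..<T})"
        using continuous_integrable_Ioo[OF continuous_on_mult[OF _ Fc]] by (intro borel_measurable_integrable) auto
      have AEeq: "AE t in lebesgue_on {0<..<T}. deriv \<phi> t * F t = deriv \<phi> t * functional_of \<Omega> (u t) v"
        using U(3) AE_u AE_space
      proof eventually_elim
        case (elim t)
        have "F t = functional_of \<Omega> (u t) v"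
          unfolding F_def functional_of_def
        proof (rule integral_cong_AE)
          show "(\<lambda>x. U t x * v x) \<in> borel_measurable (lebesgue_on \<Omega>)"
            using integral_mult_Lp_norm_2(1)[OF U_L2 vL] elim(3) by (intro borel_measurable_integrable) auto
          show "(\<lambda>x. u t x * v x) \<in> borel_measurable (lebesgue_on \<Omega>)"
            using integral_mult_Lp_norm_2(1)[OF W_space_imp_Lp_space[OF W0_spaceD[OF elim(2)] \<Omega>_sets] vL]
            by (rule borel_measurable_integrable)
          show "AE x in lebesgue_on \<Omega>. U t x * v x = u t x * v x"
            using elim(1) by eventually_elim simp
        qed
        then show ?case by simp
      qed
      have "(LINT t|lebesgue_on {0<..<T}. deriv \<phi> t * F t) = (LINT t|lebesgue_on {0<..<T}. deriv \<phi> t * functional_of \<Omega> (u t) v)"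
        by (rule integral_cong_AE[OF m borel_measurable_lebesgue_on_AE[OF _ m AEeq] AEeq]) simp
      also have "\<dots> = - (LINT t|lebesgue_on {0<..<T}. \<phi> t * g t v)"
        using weak \<phi> v by (simp add: weak_time_derivative_def)
      finally show "(LINT t|lebesgue_on {0<..<T}. deriv \<phi> t * F t) = - (LINT t|lebesgue_on {0<..<T}. \<phi> t * g t v)" .
    qed
    moreover have "F t - F \<tau> = (LINT x|lebesgue_on \<Omega>. (U t x - U \<tau> x) * v x)"
      using integral_mult_Lp_norm_2(1)[OF U_L2 vL] \<tau>t by (simp add: F_def left_diff_distrib)
    ultimately show ?thesis by simp
  qed
  have "fractional_evolution \<Omega> T U s p r u z g"
  proof unfold_locales
    show "integrable (lebesgue_on {0<..<T}) (\<lambda>t. g t v)" if "v \<in> W0_space s \<Omega>" for v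
      by (rule dual_pairing_integrable[OF g that])
    show "AE t in lebesgue_on {0<..<T}. z t \<in> Lp_space \<Omega> p"
      using z unfolding Bochner_space_def strongly_measurable_def by (auto elim: eventually_mono)
    show "integrable (lebesgue_on {0<..<T}) (\<lambda>t. Lp_norm \<Omega> p (z t) powr r)"
      using z by (simp add: Bochner_space_def)
    show "AE t in lebesgue_on {0<..<T}. g t v + energy_form s (u t) v = functional_of \<Omega> (z t) v"
      if "v \<in> W0_space s \<Omega>" for v using eqn that by blast
  qed (fact s pr uB U(3) U(4) incr)+
  then show thesis by (rule that)
qed


section \<open>The essential supremum over space and time\<close>

text \<open>
  Tonelli's theorem for the exceptional set, which is a Borel set because \<open>V\<close> is Borel measurable.
\<close>
lemma joint_bound:
  fixes V :: "real \<times> 'a::euclidean_space \<Rightarrow> real"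
  assumes V: "V \<in> borel_measurable borel" and \<Omega>: "open \<Omega>"
    and bound: "\<And>t. t \<in> {0<..<T} \<Longrightarrow> AE x in lebesgue_on \<Omega>. \<bar>V (t, x)\<bar> \<le> M"
  shows "AE p in lebesgue_on ({0<..<T} \<times> \<Omega>). \<bar>V p\<bar> \<le> M"
proof -
  have Q: "open ({0<..<T} \<times> \<Omega>)" using \<Omega> by (intro open_Times) auto
  have "AE p in lborel \<Otimes>\<^sub>M lborel. p \<in> {0<..<T} \<times> \<Omega> \<longrightarrow> \<bar>V p\<bar> \<le> M"
  proof (rule lborel_pair.AE_pair_measure)
    have "{p \<in> space borel. p \<in> {0<..<T} \<times> \<Omega> \<longrightarrow> \<bar>V p\<bar> \<le> M} \<in> sets (borel :: (real \<times> 'a) measure)"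
    proof -
      have "{p. \<bar>V p\<bar> \<le> M} \<in> sets borel"
        using borel_measurable_le[OF borel_measurable_abs[OF V] borel_measurable_const[of M]] by simp
      then have "- ({0<..<T} \<times> \<Omega>) \<union> {p. \<bar>V p\<bar> \<le> M} \<in> sets borel"
        using Q by (intro sets.Un borel_comp) auto
      also have "- ({0<..<T} \<times> \<Omega>) \<union> {p. \<bar>V p\<bar> \<le> M} = {p \<in> space borel. p \<in> {0<..<T} \<times> \<Omega> \<longrightarrow> \<bar>V p\<bar> \<le> M}"
        by auto
      finally show ?thesis .
    qed
    then show "{p \<in> space (lborel \<Otimes>\<^sub>M lborel). p \<in> {0<..<T} \<times> \<Omega> \<longrightarrow> \<bar>V p\<bar> \<le> M} \<in> sets (lborel \<Otimes>\<^sub>M lborel)"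
      unfolding lborel_prod by simp
    show "AE t in lborel. AE x in lborel. (t, x) \<in> {0<..<T} \<times> \<Omega> \<longrightarrow> \<bar>V (t, x)\<bar> \<le> M"
    proof (rule AE_I2)
      fix t :: real
      show "AE x in lborel. (t, x) \<in> {0<..<T} \<times> \<Omega> \<longrightarrow> \<bar>V (t, x)\<bar> \<le> M"
      proof (cases "t \<in> {0<..<T}")
        case True
        have "AE x in lebesgue. x \<in> \<Omega> \<longrightarrow> \<bar>V (t, x)\<bar> \<le> M"
          using bound[OF True] \<Omega> by (subst (asm) AE_lebesgue_on_iff) auto
        then show ?thesis by (simp add: AE_completion_iff) (elim eventually_mono, auto)
      next
        case False
        then show ?thesis by (intro AE_I2) auto
      qed
    qed
  qed
  then have "AE p in lebesgue. p \<in> {0<..<T} \<times> \<Omega> \<longrightarrow> \<bar>V p\<bar> \<le> M"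
    unfolding lborel_prod by (rule AE_completion)
  then show ?thesis using Q by (subst AE_lebesgue_on_iff) auto
qed

theorem theorem1p1:
  fixes \<Omega> :: "'a::euclidean_space set" and s T p r :: real
  assumes "open \<Omega>" and "bounded \<Omega>"
    and "0 < s" and "s < 1"
    and "0 < T"
    and "1 \<le> p" and "1 \<le> r"
    and "1 > real DIM('a) / (2 * p * s) + 1 / r"
  shows "\<exists>C>0. \<forall>z \<in> Bochner_space T r (Lp_space \<Omega> p) (Lp_norm \<Omega> p). \<forall>u.
           weak_solution s \<Omega> T (\<lambda>t. functional_of \<Omega> (z t)) u \<longrightarrow>
           (\<exists>U. joint_representative T \<Omega> u U \<and>
                U \<in> Linfty_space ({0<..<T} \<times> \<Omega>) \<and>
                Linfty_norm ({0<..<T} \<times> \<Omega>) U \<le> C * Bochner_norm T r (Lp_norm \<Omega> p) z)"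
proof (rule exI[of _ "sup_bound_const DIM('a) s p r (measure lebesgue \<Omega>)"], intro conjI ballI allI impI)
  let ?G = "smoothing_gain DIM('a) s p r"
  let ?C = "sup_bound_const DIM('a) s p r (measure lebesgue \<Omega>)"
  have gain: "0 < ?G"
  proof -
    have "2 * s / real DIM('a) * (real DIM('a) / (2 * p * s)) < 2 * s / real DIM('a) * (1 - 1 / r)"
      using assms by (intro mult_strict_left_mono) auto
    then show ?thesis using assms by (simp add: smoothing_gain_def)
  qed
  show C: "0 < ?C"
  proof -
    have A: "0 < C_Ns DIM('a) s / 2 * faber_krahn_const DIM('a) s"
      using C_Ns_pos[OF assms(3,4), of "DIM('a)"] faber_krahn_const_pos[of "DIM('a)" s] by simp
    have B: "0 < measure lebesgue \<Omega> + 1" by (simp add: add_nonneg_pos)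
    show ?thesis
      unfolding sup_bound_const_def level_set_const_def
      by (intro mult_pos_pos powr_gt_zero[THEN iffD2] less_imp_neq[OF A, symmetric] less_imp_neq[OF B, symmetric]) auto
  qed
  fix z u assume z: "z \<in> Bochner_space T r (Lp_space \<Omega> p) (Lp_norm \<Omega> p)"
    and sol: "weak_solution s \<Omega> T (\<lambda>t. functional_of \<Omega> (z t)) u"
  obtain U g where "fractional_evolution \<Omega> T U s p r u z g"
    using weak_solution_evolution[OF assms(1-7) z sol] by blast
  then interpret fractional_evolution \<Omega> T U s p r u z g .
  obtain V :: "real \<times> 'a \<Rightarrow> real" where V: "V \<in> borel_measurable borel"
      "\<And>t. t \<in> {0<..<T} \<Longrightarrow> AE x in lebesgue_on \<Omega>. V (t, x) = U t x"
    using borel_representative by blast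
  let ?Q = "{0<..<T} \<times> \<Omega>"
  let ?M = "?C * Bochner_norm T r (Lp_norm \<Omega> p) z"
  have M: "0 \<le> ?M" using C by (simp add: Bochner_norm_def)
  have Vm: "V \<in> borel_measurable (lebesgue_on ?Q)"
    using V(1) by (intro measurable_restrict_space1 measurable_completion) simp
  have "AE p in lebesgue_on ?Q. \<bar>V p\<bar> \<le> ?M"
  proof (rule joint_bound[OF V(1) assms(1)])
    fix t assume t: "t \<in> {0<..<T}"
    show "AE x in lebesgue_on \<Omega>. \<bar>V (t, x)\<bar> \<le> ?M"
      using V(2)[OF t] essential_bound[OF gain t] by eventually_elim simp
  qed
  then have "AE p in lebesgue_on ?Q. ennreal \<bar>V p\<bar> \<le> ennreal ?M"
    by eventually_elim (rule ennreal_leI)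
  then have ess: "esssup (lebesgue_on ?Q) (\<lambda>p. ennreal \<bar>V p\<bar>) \<le> ennreal ?M"
    using Vm by (intro esssup_I) measurable
  have "joint_representative T \<Omega> u V"
    unfolding joint_representative_def
  proof (intro conjI Vm)
    show "AE t in lebesgue_on {0<..<T}. AE x in lebesgue_on \<Omega>. V (t, x) = u t x"
      using U_eq_u AE_space
    proof eventually_elim
      case (elim t)
      then show ?case using V(2)[of t] by (auto elim: eventually_elim2)
    qed
  qed
  moreover have "V \<in> Linfty_space ?Q"
    using Vm ess by (auto simp: Linfty_space_def intro: le_less_trans)
  moreover have "Linfty_norm ?Q V \<le> ?M"
    unfolding Linfty_norm_def using enn2real_mono[OF ess] M by simp
  ultimately show "\<exists>V. joint_representative T \<Omega> u V \<and> V \<in> Linfty_space ?Q \<and> Linfty_norm ?Q V \<le> ?M"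
    by blast
qed

end
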